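(* Let $m,d\in\mathbb{N}^+$ and let $K\subset\mathbb{R}^m$ be a self-similar set satisfying the open set condition. Let $s=\dim_H K=\dim_P K$ (it is well known that these dimensions coincide and that $\mathcal{H}^s(K),\mathcal{P}^s(K)\in(0,\infty)$). Then for the prevalent $f\in C(K,\mathbb{R}^d)$ there exists an open set $U_f\subset\mathbb{R}^d$ such that $\mathcal{H}^s(f^{-1}(U_f))=\mathcal{H}^s(K)$ (hence $U_f$ is dense in $f(K)$) and $$\dim_H f^{-1}(y)=s\quad\text{for all }y\in U_f.$$ Similarly, for the prevalent $f\in C(K,\mathbb{R}^d)$ there exists an open set $V_f\subset\mathbb{R}^d$ such that $\mathcal{P}^s(f^{-1}(V_f))=\mathcal{P}^s(K)$ (hence $V_f$ is dense in $f(K)$) and $$\dim_P f^{-1}(y)=s\quad\text{for all }y\in V_f.$$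
   Context: Prevalence: for an abelian Polish group $G$, a set $A\subset G$ is shy if there exist a Borel set $B\supset A$ in $G$ and a Borel probability measure $\nu$ on $G$ with $\nu(B+x)=0$ for all $x\in G$; complements of shy sets are prevalent. "For the prevalent $f\in G$ property $P$ holds" means that $\{f\in G: P(f)\}$ is prevalent. For compact metric $K$, $C(K,\mathbb{R}^d)$ is the Banach space of continuous maps $K\to\mathbb{R}^d$ with the maximum norm (an abelian Polish group under addition). Dimensions and measures: $\mathcal{H}^s$ is $s$-dimensional Hausdorff measure and $\dim_H$ is Hausdorff dimension, with $\dim_H\emptyset=-1$. $\dim_P$ is packing dimension: $\dim_P X=\inf\{\sup_i\overline{\dim}_B X_i: X=\bigcup_{i=1}^\infty X_i\}$, where $\overline{\dim}_B$ is upper box dimension and $\overline{\dim}_B\emptyset=\dim_P\emptyset=-1$. $\mathcal{P}^s$ is $s$-dimensional packing measure: $\mathcal{P}^s(A)=\inf\{\sum_{i}\mathcal{P}^s_0(A_i): A\subset\bigcup_{i=1}^\infty A_i\}$, where $\mathcal{P}^s_0(A)=\lim_{\delta\to0+}\sup\{\sum_i(\operatorname{diam}B_i)^s\}$, the supremum being over countable families of pairwise disjoint closed balls $B_i$ of radius at most $\delta$ centered in $A$. Self-similar sets: $K\subset\mathbb{R}^m$ is self-similar if it is the unique non-empty compact set with $K=\bigcup_{i=1}^k F_i(K)$ for some $k\geq2$ and contracting similarities $F_1,\dots,F_k$ of $\mathbb{R}^m$ (ratios in $(0,1)$). It satisfies the open set condition if there is a non-empty bounded open set $O\subset\mathbb{R}^m$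 such that $\bigcup_{i=1}^k F_i(O)\subset O$ with the sets $F_i(O)$ pairwise disjoint. "$U_f$ is dense in $f(K)$" means that $U_f\cap f(K)$ is dense in $f(K)$; similarly for $V_f$. *)

theory Defs
  imports "HOL-Probability.Probability"
begin

section \<open>Prevalence\<close>

definition borel_of :: "'a topology \<Rightarrow> 'a measure" where
  "borel_of T = sigma (topspace T) {U. openin T U}"

text \<open>
  The group is the set \<open>topspace T\<close> with addition \<open>add\<close>. The definition is meant for
  the case that these form an abelian Polish group.
\<close>

definition shy :: "'a topology \<Rightarrow> ('a \<Rightarrow> 'a \<Rightarrow> 'a) \<Rightarrow> 'a set \<Rightarrow> bool" where
  "shy T add A \<longleftrightarrow> A \<subseteq> topspace T \<and>
     (\<exists>B \<nu>. A \<subseteq> B \<and> B \<in> sets (borel_of T) \<and>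
        prob_space \<nu> \<and> sets \<nu> = sets (borel_of T) \<and>
        (\<forall>x\<in>topspace T. (\<lambda>b. add b x) ` B \<in> null_sets \<nu>))"

definition prevalent :: "'a topology \<Rightarrow> ('a \<Rightarrow> 'a \<Rightarrow> 'a) \<Rightarrow> 'a set \<Rightarrow> bool" where
  "prevalent T add A \<longleftrightarrow> A \<subseteq> topspace T \<and> shy T add (topspace T - A)"

text \<open>
  For compact \<open>K\<close>, the space \<open>C(K, \<real>\<^sup>d)\<close> with the maximum metric. Its elements are the continuous
  maps on \<open>K\<close> that are \<open>undefined\<close> outside \<open>K\<close>, so each map on \<open>K\<close> is represented exactly once.
\<close>

definition C_top :: "'a::euclidean_space set \<Rightarrow> ('a \<Rightarrow> 'b::euclidean_space) topology" where
  "C_top K = mtopology_of (cfunspace (top_of_set K) euclidean_metric)"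

definition C_add :: "'a set \<Rightarrow> ('a \<Rightarrow> 'b) \<Rightarrow> ('a \<Rightarrow> 'b) \<Rightarrow> 'a \<Rightarrow> 'b::euclidean_space" where
  "C_add K f g = restrict (\<lambda>x. f x + g x) K"

lemma topspace_C_top:
  assumes "compact K"
  shows "topspace (C_top K) = {f. f \<in> extensional K \<and> continuous_on K f}"
proof -
  have "bounded (f ` K)" if "continuous_on K f" for f :: "'a \<Rightarrow> 'b"
    using compact_continuous_image[OF that assms] by (rule compact_imp_bounded)
  then show ?thesis
    by (auto simp: C_top_def)
qed

definition prevalent_in_C ::
  "'a::euclidean_space set \<Rightarrow> (('a \<Rightarrow> 'b::euclidean_space) \<Rightarrow> bool) \<Rightarrow> bool" where
  "prevalent_in_C K P \<longleftrightarrow> prevalent (C_top K) (C_add K) {f \<in> topspace (C_top K). P f}"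

section \<open>Hausdorff measure and dimension\<close>

text \<open>
  \<open>diam_pow s A\<close> is \<open>(diam A)\<^sup>s\<close> for bounded \<open>A\<close>. Since \<open>0 powr 0 = 0\<close> in the library, the case
  \<open>s = 0\<close> is separate: nonempty sets contribute 1 and the empty set contributes 0.
\<close>

definition diam_pow :: "real \<Rightarrow> 'a::metric_space set \<Rightarrow> ennreal" where
  "diam_pow s A = (if A = {} then 0 else if s = 0 then 1 else ennreal (diameter A powr s))"

text \<open>The explicit boundedness is needed because \<open>diameter\<close> is only meaningful for bounded sets.\<close>

definition hausdorff_premeasure :: "real \<Rightarrow> real \<Rightarrow> 'a::euclidean_space set \<Rightarrow> ennreal" where
  "hausdorff_premeasure s \<delta> A =
     (INF C \<in> {C :: nat \<Rightarrow> 'a set. A \<subseteq> (\<Union>i. C i) \<and> (\<forall>i. bounded (C i) \<and> diameter (C i) \<le> \<delta>)}.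
        \<Sum>i. diam_pow s (C i))"

definition hausdorff_measure :: "real \<Rightarrow> 'a::euclidean_space set \<Rightarrow> ennreal" where
  "hausdorff_measure s A = Lim (at_right 0) (\<lambda>\<delta>. hausdorff_premeasure s \<delta> A)"

definition hausdorff_dim :: "'a::euclidean_space set \<Rightarrow> ereal" where
  "hausdorff_dim A =
     (if A = {} then -1 else Inf {ereal t | t. 0 \<le> t \<and> hausdorff_measure t A = 0})"

section \<open>Packing measure and dimension\<close>

text \<open>
  The balls are balls of the ambient Euclidean space. A pairwise disjoint family of (nonempty)
  balls is the same thing as a disjoint set of balls.
\<close>

definition ball_packings :: "real \<Rightarrow> 'a::euclidean_space set \<Rightarrow> 'a set set set" where
  "ball_packings \<delta> A =
     {\<B>. countable \<B> \<and> disjoint \<B> \<and> (\<forall>B\<in>\<B>. \<exists>x\<in>A. \<exists>r. 0 < r \<and> r \<le> \<delta> \<and> B = cball x r)}"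

definition packing_premeasure :: "real \<Rightarrow> 'a::euclidean_space set \<Rightarrow> ennreal" where
  "packing_premeasure s A =
     Lim (at_right 0) (\<lambda>\<delta>. SUP \<B> \<in> ball_packings \<delta> A. \<Sum>\<^sub>\<infinity>B\<in>\<B>. diam_pow s B)"

definition packing_measure :: "real \<Rightarrow> 'a::euclidean_space set \<Rightarrow> ennreal" where
  "packing_measure s A =
     (INF C \<in> {C :: nat \<Rightarrow> 'a set. A \<subseteq> (\<Union>i. C i)}. \<Sum>i. packing_premeasure s (C i))"

text \<open>The covering number is only meaningful for bounded \<open>A\<close> and \<open>\<delta> > 0\<close>.\<close>

definition covering_number :: "real \<Rightarrow> 'a::euclidean_space set \<Rightarrow> nat" where
  "covering_number \<delta> A =
     (INF \<U> \<in> {\<U>. finite \<U> \<and> A \<subseteq> \<Union>\<U> \<and> (\<forall>U\<in>\<U>. bounded U \<and> diameter U \<le> \<delta>)}. card \<U>)"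

definition upper_box_dim :: "'a::euclidean_space set \<Rightarrow> ereal" where
  "upper_box_dim A =
     (if A = {} then -1
      else if \<not> bounded A then \<infinity>
      else Limsup (at_right 0) (\<lambda>\<delta>. ereal (ln (real (covering_number \<delta> A)) / ln (1 / \<delta>))))"

definition packing_dim :: "'a::euclidean_space set \<Rightarrow> ereal" where
  "packing_dim A =
     (INF C \<in> {C :: nat \<Rightarrow> 'a set. A = (\<Union>i. C i)}. SUP i. upper_box_dim (C i))"

lemma packing_dim_empty: "packing_dim ({} :: 'a::euclidean_space set) = -1"
proof -
  have "{C :: nat \<Rightarrow> 'a set. {} = (\<Union>i. C i)} = {\<lambda>_. {}}"
    by auto
  then show ?thesis
    by (simp add: packing_dim_def upper_box_dim_def)
qed

section \<open>Self-similar sets\<close>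

definition contracting_similarity :: "('a::euclidean_space \<Rightarrow> 'a) \<Rightarrow> bool" where
  "contracting_similarity F \<longleftrightarrow> (\<exists>r. 0 < r \<and> r < 1 \<and> (\<forall>x y. dist (F x) (F y) = r * dist x y))"

definition self_similar_set ::
  "nat \<Rightarrow> (nat \<Rightarrow> 'a::euclidean_space \<Rightarrow> 'a) \<Rightarrow> 'a set \<Rightarrow> bool" where
  "self_similar_set k F K \<longleftrightarrow>
     2 \<le> k \<and> (\<forall>i<k. contracting_similarity (F i)) \<and>
     compact K \<and> K \<noteq> {} \<and> K = (\<Union>i<k. F i ` K) \<and>
     (\<forall>L. compact L \<and> L \<noteq> {} \<and> L = (\<Union>i<k. F i ` L) \<longrightarrow> L = K)"

definition open_set_condition :: "nat \<Rightarrow> (nat \<Rightarrow> 'a::euclidean_space \<Rightarrow> 'a) \<Rightarrow> bool" where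
  "open_set_condition k F \<longleftrightarrow>
     (\<exists>O'. O' \<noteq> {} \<and> bounded O' \<and> open O' \<and> (\<Union>i<k. F i ` O') \<subseteq> O' \<and>
        disjoint_family_on (\<lambda>i. F i ` O') {..<k})"

end

theory Submission
  imports Defs
begin

text \<open>
  The natural measure \<open>\<mu>\<close> of a self-similar set with the open set condition is Ahlfors regular, and
  this gives all statements about the measures and dimensions of \<open>K\<close>. It also shows that a compact
  subset of \<open>K\<close> that is null for \<open>\<mu>\<close> is null for both \<open>s\<close>-dimensional measures.

  For the prevalence, fix \<open>f\<close> and add a random series \<open>g = \<Sum>j. g j\<close>, where \<open>g j\<close> takes independent
  values of size \<open>2 ^ -j\<close> on finitely many disjoint compact cells of tiny \<open>\<mu>\<close>-measure that cover almost
  all of \<open>K\<close>. Smooth the occupation density of the \<open>j\<close>-th partial sum with a hat function of width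
  \<open>2 ^ -j\<close>. By the refinement equation of the hat function the conditional expectation of the next
  density is the present one, and as the cells are small, the deviation is negligible, uniformly in
  the drift \<open>f\<close> and over a finite family of localized densities. Hence the densities converge
  uniformly to a continuous occupation density \<open>L\<close>, and localizing to small balls shows that a
  fiber over \<open>y\<close> with \<open>L y > 0\<close> has positive Hausdorff content for a gauge that is smaller than
  all \<open>r\<^sup>t\<close>, \<open>t < s\<close>. The set \<open>{L > 0}\<close> is open and its preimage has full measure.

  The set of maps for which such a conclusion holds is Borel because lower bounds of the content of
  fibers pass to uniform limits.
\<close>

section \<open>Hausdorff and packing measures\<close>

text \<open>The witness measure has to be fixed before the map \<open>f\<close> is known, so no
  bound may depend on the drift. This works because the mean of the next density is exact for every
  drift, while its fluctuation is a sum of independent contributions, each at most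
  \<open>2 ^ (Suc j * d)\<close> times the mass of one cell, where \<open>d\<close> is the dimension
  of the target; masses chosen after \<open>j\<close> beat this factor. The earlier summands do
  enter the choice of a level. Each level has finitely many outcomes, so a union bound over all
  possible pasts replaces conditioning, and the Borel-Cantelli lemma only sees single coordinates.
  The dimension \<open>s\<close> is reached by the schedule of the tests. A ball is charged the
  trivial bound \<open>2 ^ (j * d)\<close> at the level \<open>j\<close> where it is first tested.
  Starting at a level proportional to \<open>log 2 (1 / r)\<close> would lose a power of
  \<open>r\<close>; letting level \<open>j\<close> test all radii down to
  \<open>2 ^ -j\<^sup>2\<close> loses only \<open>2 powr (d * sqrt (log 2 (1 / r)))\<close>. The
  price is a tolerance below the mass of such tiny balls, which small cells can pay.\<close>

lemma Lim_at_right_0_antimono: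
  fixes f :: "real \<Rightarrow> ennreal"
  assumes "\<And>x y. 0 < x \<Longrightarrow> x \<le> y \<Longrightarrow> f y \<le> f x"
  shows "Lim (at_right 0) f = (SUP x\<in>{0<..}. f x)"
proof (rule tendsto_Lim)
  show "(f \<longlongrightarrow> (SUP x\<in>{0<..}. f x)) (at_right 0)"
  proof (rule order_tendstoI)
    fix a assume "a < (SUP x\<in>{0<..}. f x)"
    then obtain x where x: "0 < x" "a < f x" by (auto simp: less_SUP_iff)
    show "\<forall>\<^sub>F x in at_right 0. a < f x"
      unfolding eventually_at_right_field using x assms
      by (intro exI[of _ x]) (auto intro: less_le_trans)
  next
    fix a assume a: "(SUP x\<in>{0<..}. f x) < a"
    show "\<forall>\<^sub>F x in at_right 0. f x < a"
      unfolding eventually_at_right_field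
      by (intro exI[of _ 1]) (auto intro!: le_less_trans[OF _ a] SUP_upper)
  qed
qed simp

lemma Lim_at_right_0_mono:
  fixes f :: "real \<Rightarrow> ennreal"
  assumes "\<And>x y. 0 < x \<Longrightarrow> x \<le> y \<Longrightarrow> f x \<le> f y"
  shows "Lim (at_right 0) f = (INF x\<in>{0<..}. f x)"
proof (rule tendsto_Lim)
  show "(f \<longlongrightarrow> (INF x\<in>{0<..}. f x)) (at_right 0)"
  proof (rule order_tendstoI)
    fix a assume "(INF x\<in>{0<..}. f x) < a"
    then obtain x where x: "0 < x" "f x < a" by (auto simp: INF_less_iff)
    show "\<forall>\<^sub>F x in at_right 0. f x < a"
      unfolding eventually_at_right_field using x assms
      by (intro exI[of _ x]) (meson le_less_trans less_imp_le)
  next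
    fix a assume a: "a < (INF x\<in>{0<..}. f x)"
    show "\<forall>\<^sub>F x in at_right 0. a < f x"
      unfolding eventually_at_right_field
      by (intro exI[of _ 1]) (auto intro!: less_le_trans[OF a] INF_lower)
  qed
qed simp

lemma diam_pow_empty [simp]: "diam_pow s {} = 0"
  by (simp add: diam_pow_def)

lemma hausdorff_premeasure_le:
  assumes "A \<subseteq> (\<Union>i. C i)" "\<And>i. bounded (C i)" "\<And>i. diameter (C i) \<le> \<delta>"
  shows "hausdorff_premeasure s \<delta> A \<le> (\<Sum>i. diam_pow s (C i))"
  unfolding hausdorff_premeasure_def using assms by (auto intro!: INF_lower)

lemma hausdorff_premeasure_antimono:
  "\<delta> \<le> \<delta>' \<Longrightarrow> hausdorff_premeasure s \<delta>' A \<le> hausdorff_premeasure s \<delta> A"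
  unfolding hausdorff_premeasure_def by (rule INF_superset_mono) (auto intro: order_trans)

lemma hausdorff_premeasure_mono:
  "A \<subseteq> B \<Longrightarrow> hausdorff_premeasure s \<delta> A \<le> hausdorff_premeasure s \<delta> B"
  unfolding hausdorff_premeasure_def by (rule INF_superset_mono) auto

lemma hausdorff_measure_eq_SUP:
  "hausdorff_measure s A = (SUP \<delta>\<in>{0<..}. hausdorff_premeasure s \<delta> A)"
  unfolding hausdorff_measure_def
  by (rule Lim_at_right_0_antimono) (rule hausdorff_premeasure_antimono)

lemma hausdorff_premeasure_le_measure:
  "0 < \<delta> \<Longrightarrow> hausdorff_premeasure s \<delta> A \<le> hausdorff_measure s A"
  unfolding hausdorff_measure_eq_SUP by (rule SUP_upper) simp

lemma hausdorff_measure_mono: "A \<subseteq> B \<Longrightarrow> hausdorff_measure s A \<le> hausdorff_measure s B"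
  unfolding hausdorff_measure_eq_SUP by (intro SUP_mono) (auto intro: hausdorff_premeasure_mono)

lemma hausdorff_premeasure_cover:
  assumes "hausdorff_premeasure s \<delta> A < a"
  obtains C where "A \<subseteq> (\<Union>i. C i)" "\<And>i. bounded (C i)" "\<And>i. diameter (C i) \<le> \<delta>"
    "(\<Sum>i::nat. diam_pow s (C i)) < a"
  using assms unfolding hausdorff_premeasure_def INF_less_iff by auto

lemma suminf_half_pow_ennreal: "(\<Sum>i. ennreal (e * (1/2)^Suc i)) = ennreal e" if "0 \<le> e"
proof -
  have "(\<lambda>i. e * (1/2)^Suc i) sums (e * 1)"
    by (rule sums_mult) (rule power_half_series)
  then show ?thesis using that
    by (subst suminf_ennreal2) (auto simp: sums_iff)
qed

text \<open>Proved at a fixed scale \<open>\<delta>\<close>, where covers of the pieces merge into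
  one cover of the same scale; the supremum over \<open>\<delta>\<close> is taken
  afterwards.\<close>

lemma hausdorff_premeasure_countable_subadditive:
  "hausdorff_premeasure s \<delta> (\<Union>i. A i) \<le> (\<Sum>i::nat. hausdorff_premeasure s \<delta> (A i))"
proof (rule ennreal_le_epsilon)
  fix e :: real assume e: "0 < e" and fin: "(\<Sum>i. hausdorff_premeasure s \<delta> (A i)) < top"
  have fi: "hausdorff_premeasure s \<delta> (A i) < top" for i
    using ennreal_suminf_lessD[OF fin] .
  have "\<exists>C. A i \<subseteq> (\<Union>j. C j) \<and> (\<forall>j. bounded (C j) \<and> diameter (C j) \<le> \<delta>) \<and>
      (\<Sum>j::nat. diam_pow s (C j)) \<le> hausdorff_premeasure s \<delta> (A i) + ennreal (e * (1/2)^Suc i)" for i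
  proof -
    have "hausdorff_premeasure s \<delta> (A i) < hausdorff_premeasure s \<delta> (A i) + ennreal (e * (1/2)^Suc i)"
    proof -
      have "0 < ennreal (e * (1/2)^Suc i)" using e by simp
      then show ?thesis
        using fi[of i] ennreal_add_left_cancel_less[of "hausdorff_premeasure s \<delta> (A i)" 0] by simp
    qed
    from hausdorff_premeasure_cover[OF this] show ?thesis by (metis less_imp_le)
  qed
  then obtain C where C: "\<And>i. A i \<subseteq> (\<Union>j. C i j)" "\<And>i j. bounded (C i j)" "\<And>i j. diameter (C i j) \<le> \<delta>"
      "\<And>i. (\<Sum>j::nat. diam_pow s (C i j)) \<le> hausdorff_premeasure s \<delta> (A i) + ennreal (e * (1/2)^Suc i)"
    by metis
  define D where "D n = (case prod_decode n of (i,j) \<Rightarrow> C i j)" for n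
  have "hausdorff_premeasure s \<delta> (\<Union>i. A i) \<le> (\<Sum>n. diam_pow s (D n))"
  proof (rule hausdorff_premeasure_le)
    show "(\<Union>i. A i) \<subseteq> (\<Union>i. D i)"
    proof
      fix x assume "x \<in> (\<Union>i. A i)"
      then obtain i j where "x \<in> C i j" using C(1) by blast
      then have "x \<in> D (prod_encode (i,j))" by (simp add: D_def)
      then show "x \<in> (\<Union>i. D i)" by blast
    qed
  qed (auto simp: D_def C split: prod.splits)
  also have "\<dots> = (\<Sum>i. \<Sum>j. diam_pow s (C i j))"
    using suminf_ennreal_2dimen[of "\<lambda>i. \<Sum>j. diam_pow s (C i j)" "\<lambda>(i,j). diam_pow s (C i j)"]
    by (simp add: D_def comp_def case_prod_unfold)
  also have "\<dots> \<le> (\<Sum>i. hausdorff_premeasure s \<delta> (A i) + ennreal (e * (1/2)^Suc i))"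
    by (intro suminf_le C) auto
  also have "\<dots> = (\<Sum>i. hausdorff_premeasure s \<delta> (A i)) + (\<Sum>i. ennreal (e * (1/2)^Suc i))"
    by (subst suminf_add[symmetric]) auto
  also have "\<dots> = (\<Sum>i. hausdorff_premeasure s \<delta> (A i)) + ennreal e"
    using e by (subst suminf_half_pow_ennreal) auto
  finally show "hausdorff_premeasure s \<delta> (\<Union>i. A i) \<le> (\<Sum>i. hausdorff_premeasure s \<delta> (A i)) + ennreal e" .
qed

lemma hausdorff_measure_countable_subadditive:
  "hausdorff_measure s (\<Union>i. A i) \<le> (\<Sum>i::nat. hausdorff_measure s (A i))"
  unfolding hausdorff_measure_eq_SUP[of s "\<Union>i. A i"]
  by (rule SUP_least, rule order_trans[OF hausdorff_premeasure_countable_subadditive])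
     (auto intro!: suminf_le hausdorff_premeasure_le_measure)

lemma hausdorff_measure_empty [simp]: "hausdorff_measure s {} = 0"
proof -
  have "hausdorff_premeasure s \<delta> {} \<le> 0" if "0 < \<delta>" for \<delta>
    using hausdorff_premeasure_le[of "{}" "\<lambda>_. {}" \<delta> s] that by simp
  then have "hausdorff_measure s {} \<le> 0"
    unfolding hausdorff_measure_eq_SUP by (intro SUP_least) auto
  then show ?thesis by simp
qed

lemma suminf_two_ennreal: "(\<Sum>i::nat. if i = 0 then a else if i = 1 then b else (0::ennreal)) = a + b"
proof -
  have "(\<Sum>i::nat. if i = 0 then a else if i = 1 then b else 0) =
     (\<Sum>i\<in>{0,1::nat}. if i = 0 then a else if i = 1 then b else 0)"
    by (rule suminf_finite) auto
  then show ?thesis by simp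
qed

lemma hausdorff_measure_subadditive:
  "hausdorff_measure s (A \<union> B) \<le> hausdorff_measure s A + hausdorff_measure s B"
proof -
  define C where "C i = (if i = 0 then A else if i = 1 then B else {})" for i :: nat
  have "(\<Union>i. C i) = A \<union> B" by (auto simp: C_def split: if_splits)
  then have "hausdorff_measure s (A \<union> B) \<le> (\<Sum>i. hausdorff_measure s (C i))"
    using hausdorff_measure_countable_subadditive[of s C] by simp
  also have "(\<lambda>i. hausdorff_measure s (C i)) =
      (\<lambda>i. if i = 0 then hausdorff_measure s A else if i = 1 then hausdorff_measure s B else 0)"
    by (auto simp: C_def)
  finally show ?thesis by (simp add: suminf_two_ennreal)
qed

lemma hausdorff_premeasure_le_card:
  assumes "finite \<U>" "A \<subseteq> \<Union>\<U>" "\<And>U. U \<in> \<U> \<Longrightarrow> bounded U \<and> diameter U \<le> \<delta>" "0 < s" "0 \<le> \<delta>"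
  shows "hausdorff_premeasure s \<delta> A \<le> ennreal (real (card \<U>) * \<delta> powr s)"
proof -
  obtain e where e: "bij_betw e {..<card \<U>} \<U>"
    using assms(1) by (metis atLeast0LessThan ex_bij_betw_nat_finite)
  define C where "C i = (if i < card \<U> then e i else {})" for i
  have eU: "e i \<in> \<U>" if "i < card \<U>" for i using e that by (auto simp: bij_betw_def)
  have "hausdorff_premeasure s \<delta> A \<le> (\<Sum>i. diam_pow s (C i))"
  proof (rule hausdorff_premeasure_le)
    show "A \<subseteq> (\<Union>i. C i)"
    proof
      fix x assume "x \<in> A"
      then obtain U where "U \<in> \<U>" "x \<in> U" using assms by auto
      then obtain i where "i < card \<U>" "e i = U"
        using e by (metis bij_betw_def imageE lessThan_iff)
      then show "x \<in> (\<Union>i. C i)" using \<open>x \<in> U\<close> by (auto simp: C_def intro!: exI[of _ i])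
    qed
  qed (use assms eU in \<open>auto simp: C_def\<close>)
  also have "\<dots> = (\<Sum>i<card \<U>. diam_pow s (C i))"
    by (rule suminf_finite) (auto simp: C_def)
  also have "\<dots> \<le> (\<Sum>i<card \<U>. ennreal (\<delta> powr s))"
  proof (rule sum_mono)
    fix i assume "i \<in> {..<card \<U>}"
    then have "bounded (C i)" "diameter (C i) \<le> \<delta>" using assms(3) eU by (auto simp: C_def)
    then show "diam_pow s (C i) \<le> ennreal (\<delta> powr s)"
      using assms(4) diameter_ge_0[of "C i"] by (auto simp: diam_pow_def intro!: ennreal_leI powr_mono2)
  qed
  also have "\<dots> = ennreal (real (card \<U>) * \<delta> powr s)"
    by (simp add: ennreal_mult ennreal_of_nat_eq_real_of_nat)
  finally show ?thesis .
qed

lemma hausdorff_measure_0_ge_1: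
  assumes "A \<noteq> {}" shows "hausdorff_measure 0 A \<ge> 1"
proof -
  have "1 \<le> hausdorff_premeasure 0 1 A"
    unfolding hausdorff_premeasure_def
  proof (rule INF_greatest)
    fix C :: "nat \<Rightarrow> _" assume "C \<in> {C. A \<subseteq> \<Union> (range C) \<and> (\<forall>i. bounded (C i) \<and> diameter (C i) \<le> 1)}"
    then obtain i where "C i \<noteq> {}" using assms by (metis (no_types, lifting) UN_E all_not_in_conv mem_Collect_eq subsetD)
    then have "1 = diam_pow 0 (C i)" by (simp add: diam_pow_def)
    also have "\<dots> = (\<Sum>j\<in>{i}. diam_pow 0 (C j))" by simp
    also have "\<dots> \<le> (\<Sum>j. diam_pow 0 (C j))" by (rule sum_le_suminf) auto
    finally show "1 \<le> (\<Sum>j. diam_pow 0 (C j))" .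
  qed
  then show ?thesis using hausdorff_premeasure_le_measure[of 1 0 A] by simp
qed

lemma hausdorff_dim_le:
  assumes "0 \<le> t" "hausdorff_measure t A = 0"
  shows "hausdorff_dim A \<le> ereal t"
proof (cases "A = {}")
  case True
  have "(-1::ereal) \<le> 0" by simp
  also have "0 \<le> ereal t" using assms by simp
  finally show ?thesis using True by (simp add: hausdorff_dim_def)
next
  case False
  then show ?thesis using assms by (auto simp: hausdorff_dim_def intro!: Inf_lower)
qed

lemma hausdorff_dim_ge:
  assumes "A \<noteq> {}" "\<And>t. 0 \<le> t \<Longrightarrow> t < s \<Longrightarrow> hausdorff_measure t A \<noteq> 0"
  shows "ereal s \<le> hausdorff_dim A"
proof -
  have "ereal s \<le> Inf {ereal t |t. 0 \<le> t \<and> hausdorff_measure t A = 0}"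
    by (rule Inf_greatest) (use assms(2) in force)
  then show ?thesis using assms(1) by (simp add: hausdorff_dim_def)
qed

text \<open>Such a cover costs at most \<open>c * \<delta> powr (u - t)\<close>, which tends to 0.
  Covers are required at small scales only, the form in which box dimension bounds provide
  them.\<close>

lemma hausdorff_measure_0_if_covering:
  assumes "0 < t" "t < u" "0 \<le> c"
    and ev: "\<forall>\<^sub>F \<delta> in at_right 0. \<exists>\<U>. finite \<U> \<and> A \<subseteq> \<Union>\<U> \<and>
      (\<forall>U\<in>\<U>. bounded U \<and> diameter U \<le> \<delta>) \<and> real (card \<U>) \<le> c * \<delta> powr (-t)"
  shows "hausdorff_measure u A = 0"
proof -
  have le: "hausdorff_premeasure u d A \<le> 0" if "0 < d" for d
  proof (rule tendsto_le[OF _ _ tendsto_const])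
    have "((\<lambda>\<delta>. c * \<delta> powr (u - t)) \<longlongrightarrow> c * 0) (at_right 0)"
      using assms by (intro tendsto_mult tendsto_const) (auto intro!: tendsto_eq_intros eventually_at_right_less simp: eventually_at_filter)
    then show "((\<lambda>\<delta>. ennreal (c * \<delta> powr (u - t))) \<longlongrightarrow> 0) (at_right 0)"
      using tendsto_ennrealI by fastforce
    have "\<forall>\<^sub>F \<delta>::real in at_right 0. 0 < \<delta> \<and> \<delta> < d"
      using \<open>0 < d\<close> by (auto simp: eventually_at_right_field intro: exI[of _ d])
    with ev show "\<forall>\<^sub>F \<delta> in at_right 0. hausdorff_premeasure u d A \<le> ennreal (c * \<delta> powr (u - t))"
    proof eventually_elim
      case (elim \<delta>)
      then obtain \<U> where U: "finite \<U>" "A \<subseteq> \<Union>\<U>" "\<And>U. U\<in>\<U> \<Longrightarrow> bounded U \<and> diameter U \<le> \<delta>"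
        "real (card \<U>) \<le> c * \<delta> powr (-t)" by auto
      have "hausdorff_premeasure u d A \<le> hausdorff_premeasure u \<delta> A"
        using elim by (intro hausdorff_premeasure_antimono) auto
      also have "\<dots> \<le> ennreal (real (card \<U>) * \<delta> powr u)"
        using U elim assms by (intro hausdorff_premeasure_le_card) auto
      also have "\<dots> \<le> ennreal (c * \<delta> powr (u - t))"
      proof (rule ennreal_leI)
        have "real (card \<U>) * \<delta> powr u \<le> c * \<delta> powr (-t) * \<delta> powr u"
          using U by (intro mult_right_mono) auto
        also have "\<dots> = c * \<delta> powr (u - t)"
          by (simp add: powr_add[symmetric])
        finally show "real (card \<U>) * \<delta> powr u \<le> c * \<delta> powr (u - t)" .
      qed
      finally show ?case .
    qed
  qed auto
  have "hausdorff_measure u A \<le> 0"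
    unfolding hausdorff_measure_eq_SUP using le by (intro SUP_least) auto
  then show ?thesis by simp
qed

section \<open>Covering numbers and the comparison of box, Hausdorff and packing dimension\<close>

lemma covering_number_attained:
  fixes A :: "'a::euclidean_space set"
  assumes "bounded A" "0 < \<delta>"
  obtains \<U> where "finite \<U>" "A \<subseteq> \<Union>\<U>" "\<And>U. U\<in>\<U> \<Longrightarrow> bounded U \<and> diameter U \<le> \<delta>"
    "card \<U> = covering_number \<delta> A"
proof -
  let ?S = "{\<U>. finite \<U> \<and> A \<subseteq> \<Union>\<U> \<and> (\<forall>U\<in>\<U>. bounded U \<and> diameter U \<le> \<delta>)}"
  have "compact (closure A)" using assms by (simp add: compact_closure)
  then obtain k where k: "finite k" "closure A \<subseteq> (\<Union>x\<in>k. ball x (\<delta>/2))"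
    using compact_eq_totally_bounded[of "closure A"] assms by (meson half_gt_zero)
  have "(\<lambda>x. ball x (\<delta>/2)) ` k \<in> ?S"
    using k closure_subset assms by (auto simp: diameter_ball)
  then have "card ` ?S \<noteq> {}" by blast
  then have "Inf (card ` ?S) \<in> card ` ?S" by (rule Inf_nat_def1)
  then show ?thesis using that unfolding covering_number_def by auto
qed

lemma covering_number_le:
  assumes "finite \<U>" "A \<subseteq> \<Union>\<U>" "\<And>U. U\<in>\<U> \<Longrightarrow> bounded U \<and> diameter U \<le> \<delta>"
  shows "covering_number \<delta> A \<le> card \<U>"
  unfolding covering_number_def using assms by (intro cINF_lower) auto

lemma hausdorff_measure_0_if_upper_box_dim_less:
  fixes A :: "'a::euclidean_space set"
  assumes "0 < t" "upper_box_dim A < ereal t" "t < u"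
  shows "hausdorff_measure u A = 0"
proof (cases "A = {}")
  case False
  have bd: "bounded A" using assms(2) False by (auto simp: upper_box_dim_def split: if_splits)
  have "Limsup (at_right 0) (\<lambda>\<delta>. ereal (ln (real (covering_number \<delta> A)) / ln (1 / \<delta>))) < ereal t"
    using assms(2) False bd by (simp add: upper_box_dim_def)
  then have "\<forall>\<^sub>F \<delta> in at_right 0. ereal (ln (real (covering_number \<delta> A)) / ln (1 / \<delta>)) < ereal t"
    by (rule Limsup_lessD)
  moreover have "\<forall>\<^sub>F \<delta>::real in at_right 0. 0 < \<delta> \<and> \<delta> < 1"
    by (auto simp: eventually_at_right_field intro: exI[of _ 1])
  ultimately have "\<forall>\<^sub>F \<delta> in at_right 0. \<exists>\<U>. finite \<U> \<and> A \<subseteq> \<Union>\<U> \<and>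
      (\<forall>U\<in>\<U>. bounded U \<and> diameter U \<le> \<delta>) \<and> real (card \<U>) \<le> 1 * \<delta> powr (-t)"
  proof eventually_elim
    case (elim \<delta>)
    obtain \<U> where U: "finite \<U>" "A \<subseteq> \<Union>\<U>" "\<And>U. U\<in>\<U> \<Longrightarrow> bounded U \<and> diameter U \<le> \<delta>"
      "card \<U> = covering_number \<delta> A"
      using covering_number_attained[OF bd] elim by blast
    have "\<U> \<noteq> {}" using False U by auto
    then have pos: "0 < card \<U>" using U(1) by (simp add: card_gt_0_iff)
    have "ln (real (card \<U>)) < t * ln (1/\<delta>)"
      using elim U(4) by (simp add: divide_less_eq)
    then have "real (card \<U>) < exp (t * ln (1/\<delta>))"
      using pos by (simp add: ln_less_cancel_iff[symmetric] del: ln_less_cancel_iff)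
    also have "\<dots> = \<delta> powr (-t)"
      using elim by (simp add: powr_def ln_div)
    finally show ?case using U by (intro exI[of _ \<U>]) auto
  qed
  then show ?thesis using assms by (intro hausdorff_measure_0_if_covering[of t u 1]) auto
qed simp

text \<open>A countable decomposition into pieces of small upper box dimension makes every piece
  null at some exponent below \<open>s\<close>, and null sets are closed under countable
  unions.\<close>

lemma packing_dim_ge_if_hausdorff_dim_ge:
  fixes A :: "'a::euclidean_space set"
  assumes "0 < s" "ereal s \<le> hausdorff_dim A"
  shows "ereal s \<le> packing_dim A"
  unfolding packing_dim_def
proof (rule INF_greatest, rule ccontr)
  fix C :: "nat \<Rightarrow> 'a set" assume "C \<in> {C. A = \<Union> (range C)}" and "\<not> ereal s \<le> (SUP i. upper_box_dim (C i))"
  \<comment> \<open>The maximum with 0 yields a positive exponent \<open>t\<close> even when all box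
    dimensions are 0 or -1.\<close>
  then have A: "A = (\<Union>i. C i)" and "max 0 (SUP i. upper_box_dim (C i)) < ereal s" using assms(1) by auto
  then obtain t where t: "max 0 (SUP i. upper_box_dim (C i)) < ereal t" "t < s"
    using ereal_dense2 by (metis less_ereal.simps(1))
  then obtain u where u: "t < u" "u < s" using dense by blast
  have "upper_box_dim (C i) < ereal t" for i
    using t(1) by (metis SUP_upper UNIV_I le_less_trans max_less_iff_conj)
  then have "hausdorff_measure u (C i) = 0" for i
    using t u by (intro hausdorff_measure_0_if_upper_box_dim_less[of t]) auto
  then have "hausdorff_measure u A \<le> 0"
    using hausdorff_measure_countable_subadditive[of u C] A by simp
  then have "hausdorff_dim A \<le> ereal u" using t u by (intro hausdorff_dim_le) auto
  then have "ereal s \<le> ereal u" using assms(2) by (rule order_trans[rotated])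
  then show False using u by simp
qed

section \<open>Packing premeasure and packing measure\<close>

lemma ball_packings_mono: "\<delta> \<le> \<delta>' \<Longrightarrow> A \<subseteq> B \<Longrightarrow> ball_packings \<delta> A \<subseteq> ball_packings \<delta>' B"
  unfolding ball_packings_def by (auto; meson order_trans subsetD)

lemma packing_premeasure_eq_INF:
  "packing_premeasure s A = (INF \<delta>\<in>{0<..}. SUP \<B> \<in> ball_packings \<delta> A. \<Sum>\<^sub>\<infinity>B\<in>\<B>. diam_pow s B)"
  unfolding packing_premeasure_def
  by (rule Lim_at_right_0_mono) (intro SUP_subset_mono ball_packings_mono; simp)

lemma packing_premeasure_mono: "A \<subseteq> B \<Longrightarrow> packing_premeasure s A \<le> packing_premeasure s B"
  unfolding packing_premeasure_eq_INF
  by (intro INF_superset_mono SUP_subset_mono ball_packings_mono order_refl)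

lemma packing_premeasure_empty [simp]: "packing_premeasure s ({} :: 'a::euclidean_space set) = 0"
proof -
  have "ball_packings \<delta> ({} :: 'a set) = {{}}" for \<delta> by (auto simp: ball_packings_def)
  then have "packing_premeasure s ({} :: 'a set) \<le> 0"
    unfolding packing_premeasure_eq_INF by (intro INF_lower2[of 1]) auto
  then show ?thesis by simp
qed

lemma packing_measure_mono: "A \<subseteq> B \<Longrightarrow> packing_measure s A \<le> packing_measure s B"
  unfolding packing_measure_def by (rule INF_superset_mono) auto

text \<open>Prepending \<open>B\<close> to a cover of \<open>A\<close> adds a term of premeasure 0,
  so the infimum does not grow.\<close>

lemma packing_measure_Un_null:
  fixes A B :: "'a::euclidean_space set"
  assumes "packing_premeasure s B = 0"
  shows "packing_measure s (A \<union> B) \<le> packing_measure s A"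
  unfolding packing_measure_def[of s A]
proof (rule INF_greatest)
  fix C :: "nat \<Rightarrow> 'a set" assume "C \<in> {C. A \<subseteq> \<Union> (range C)}"
  then have C: "A \<subseteq> (\<Union>i. C i)" by auto
  define D where "D i = (case i of 0 \<Rightarrow> B | Suc j \<Rightarrow> C j)" for i
  have "A \<union> B \<subseteq> (\<Union>i. D i)"
  proof -
    have "B \<subseteq> (\<Union>i. D i)"
      using UN_upper[of 0 UNIV D] by (simp add: D_def)
    moreover have "C i \<subseteq> (\<Union>i. D i)" for i
      using UN_upper[of "Suc i" UNIV D] by (simp add: D_def)
    then have "(\<Union>i. C i) \<subseteq> (\<Union>i. D i)" by (rule UN_least)
    ultimately show ?thesis using C by (meson Un_least order_trans)
  qed
  then have "packing_measure s (A \<union> B) \<le> (\<Sum>i. packing_premeasure s (D i))"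
    unfolding packing_measure_def by (intro INF_lower) auto
  also have "\<dots> = packing_premeasure s B + (\<Sum>i. packing_premeasure s (C i))"
    by (subst suminf_offset[of _ 1]) (auto simp: D_def)
  finally show "packing_measure s (A \<union> B) \<le> (\<Sum>i. packing_premeasure s (C i))"
    using assms by simp
qed

lemma packing_measure_le_premeasure:
  fixes A :: "'a::euclidean_space set"
  shows "packing_measure s A \<le> packing_premeasure s A"
proof -
  have "packing_measure s A \<le> (\<Sum>i::nat. packing_premeasure s (if i = 0 then A else {}))"
    unfolding packing_measure_def by (rule INF_lower) (auto intro: exI[of _ 0])
  also have "\<dots> = packing_premeasure s A"
    by (subst suminf_offset[of _ 1]) auto
  finally show ?thesis .
qed

section \<open>Ahlfors regular measures\<close>

text \<open>The random construction lives over this upper mass bound. The lower bound, added in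
  \<open>ahlfors_regular\<close>, supplies covering counts, the treatment of null sets and the
  density in the image.\<close>

locale frostman = prob_space \<mu> for \<mu> :: "'a::euclidean_space measure" +
  fixes K :: "'a set" and s C :: real
  assumes compact_K: "compact K" and s_pos: "0 < s"
    and sets_\<mu> [measurable_cong, simp]: "sets \<mu> = sets borel"
    and prob_K: "prob K = 1"
    and prob_cball_le: "\<And>x r. 0 < r \<Longrightarrow> prob (cball x r) \<le> C * r powr s"
begin

lemma space_\<mu> [simp]: "space \<mu> = UNIV"
  using sets_eq_imp_space_eq[OF sets_\<mu>] by simp

lemma K_ne: "K \<noteq> {}" using prob_K by auto

lemma C_pos: "0 < C"
proof -
  obtain r where r: "0 < r" "K \<subseteq> cball 0 r"
    using compact_K compact_imp_bounded[of K] by (metis bounded_pos mem_cball_0 subsetI)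
  have "1 \<le> prob (cball 0 r)" using finite_measure_mono[OF r(2)] prob_K by simp
  also have "\<dots> \<le> C * r powr s" using prob_cball_le r by blast
  finally show ?thesis using r by (metis less_le_not_le mult_nonpos_nonneg not_less powr_ge_zero zero_less_one order_trans linorder_not_le)
qed

lemma prob_Int_K: "E \<in> sets borel \<Longrightarrow> prob (E \<inter> K) = prob E"
  using prob_K compact_K by (subst measure_space_inter) (auto simp: borel_compact prob_space[unfolded space_\<mu>])

lemma prob_mono_K:
  assumes "E \<in> sets borel" "E \<inter> K \<subseteq> D" "D \<in> sets borel"
  shows "prob E \<le> prob D"
  using finite_measure_mono[of "E \<inter> K" D] assms prob_Int_K[of E] by simp

text \<open>The case \<open>r = 0\<close> says that there are no atoms; here \<open>0 powr s = 0\<close>.\<close>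

lemma prob_cball_le_0:
  assumes "0 \<le> r" shows "prob (cball x r) \<le> C * r powr s"
proof (cases "r = 0")
  case True
  have "prob (cball x 0) \<le> C * 0"
  proof (rule tendsto_lowerbound)
    show "((\<lambda>r. C * r powr s) \<longlongrightarrow> C * 0) (at_right 0)"
      using s_pos by (intro tendsto_mult tendsto_const) (auto intro!: tendsto_eq_intros eventually_at_right_less simp: eventually_at_filter)
    show "\<forall>\<^sub>F r in at_right 0. prob (cball x 0) \<le> C * r powr s"
      unfolding eventually_at_right_field
    proof (intro exI[of _ 1] conjI allI impI)
      fix y :: real assume "0 < y"
      then have "prob (cball x 0) \<le> prob (cball x y)" by (intro finite_measure_mono) auto
      then show "prob (cball x 0) \<le> C * y powr s" using prob_cball_le[OF \<open>0 < y\<close>] by (rule order_trans)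
    qed simp
  qed simp
  then show ?thesis using True by simp
qed (use assms prob_cball_le in auto)

lemma prob_cball_le_diam_pow:
  assumes "bounded A" "x \<in> A"
  shows "emeasure \<mu> (cball x (diameter A)) \<le> ennreal C * diam_pow s A"
  using assms prob_cball_le_0[of "diameter A" x] s_pos diameter_ge_0[of A] C_pos
  by (auto simp: emeasure_eq_measure diam_pow_def ennreal_mult[symmetric] intro!: ennreal_leI)

text \<open>The mass distribution principle: a set of a cover lies in the ball about one of its
  points with its diameter as radius, so its mass is at most \<open>C\<close> times its cost.
  Singletons give radius 0, where the absence of atoms is used.\<close>

lemma mass_distribution: "1 \<le> ennreal C * hausdorff_measure s K"
proof -
  have "1 / ennreal C \<le> hausdorff_premeasure s 1 K"
    unfolding hausdorff_premeasure_def
  proof (rule INF_greatest)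
    fix A :: "nat \<Rightarrow> _" assume "A \<in> {C. K \<subseteq> \<Union> (range C) \<and> (\<forall>i. bounded (C i) \<and> diameter (C i) \<le> 1)}"
    then have A: "K \<subseteq> (\<Union>i. A i)" "\<And>i. bounded (A i)" by auto
    define D where "D i = (if A i = {} then {} else cball (SOME x. x \<in> A i) (diameter (A i)))" for i
    have some: "(SOME x. x \<in> A i) \<in> A i" if "A i \<noteq> {}" for i using that by (simp add: some_in_eq)
    have AD: "A i \<subseteq> D i" for i
      using diameter_bounded_bound[OF A(2)[of i] some[of i]]
      by (cases "A i = {}") (auto simp: D_def simp del: some_in_eq)
    have Dm: "D i \<in> sets \<mu>" for i by (auto simp: D_def)
    have "1 = emeasure \<mu> K" using prob_K by (simp add: emeasure_eq_measure)
    also have "\<dots> \<le> emeasure \<mu> (\<Union>i. D i)" using A(1) AD Dm by (intro emeasure_mono) blast+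
    also have "\<dots> \<le> (\<Sum>i. emeasure \<mu> (D i))" using Dm by (intro emeasure_subadditive_countably) auto
    also have "\<dots> \<le> (\<Sum>i. ennreal C * diam_pow s (A i))"
      using prob_cball_le_diam_pow[OF A(2) some] by (intro suminf_le) (auto simp: D_def)
    also have "\<dots> = ennreal C * (\<Sum>i. diam_pow s (A i))" by simp
    finally show "1 / ennreal C \<le> (\<Sum>i. diam_pow s (A i))"
      using C_pos by (subst divide_le_posI_ennreal) (auto simp: mult.commute)
  qed
  also have "\<dots> \<le> hausdorff_measure s K" by (rule hausdorff_premeasure_le_measure) simp
  finally have "ennreal C * (1 / ennreal C) \<le> ennreal C * hausdorff_measure s K" by (rule mult_left_mono) simp
  then show ?thesis using C_pos by (simp add: ennreal_times_divide divide_eq_1_ennreal)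
qed

lemma hausdorff_measure_pos: "0 < hausdorff_measure s K"
  using mass_distribution by (metis mult_zero_right not_gr_zero not_one_le_zero)

end

locale ahlfors_regular = frostman +
  fixes c :: real
  assumes c_pos: "0 < c"
    and prob_cball_ge: "\<And>x r. x \<in> K \<Longrightarrow> 0 < r \<Longrightarrow> r \<le> 1 \<Longrightarrow> c * r powr s \<le> prob (cball x r)"
begin

lemma card_separated_le:
  assumes "finite N" "N \<subseteq> K" "pairwise (\<lambda>x y. 2 * \<delta> < dist x y) N" "0 < \<delta>" "\<delta> \<le> 1"
  shows "card N * (c * \<delta> powr s) \<le> prob (\<Union>x\<in>N. cball x \<delta>)"
proof -
  have "card N * (c * \<delta> powr s) = (\<Sum>x\<in>N. c * \<delta> powr s)" by simp
  also have "\<dots> \<le> (\<Sum>x\<in>N. prob (cball x \<delta>))"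
    using assms by (intro sum_mono prob_cball_ge) auto
  also have "\<dots> = prob (\<Union>x\<in>N. cball x \<delta>)"
  proof (rule finite_measure_finite_Union[symmetric])
    show "disjoint_family_on (\<lambda>x. cball x \<delta>) N"
      unfolding disjoint_family_on_def
    proof safe
      fix x y z assume "x \<in> N" "y \<in> N" "x \<noteq> y" "z \<in> cball x \<delta>" "z \<in> cball y \<delta>"
      then show "z \<in> {}" using assms(3) dist_triangle2[of x y z]
        by (auto simp: pairwise_def)
          (metis dist_commute dist_triangle_le le_less_trans less_irrefl mult_2 add_mono order_trans not_less)
    qed
  qed (use assms in auto)
  finally show ?thesis .
qed

text \<open>A separated set of maximal cardinality is a net, as a point far from it could be added.
  Cardinalities are bounded because the disjoint balls about a separated set share total mass
  1.\<close>

lemma separated_net: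
  assumes "E \<subseteq> K" "0 < \<delta>" "\<delta> \<le> 1"
  obtains N where "finite N" "N \<subseteq> E" "pairwise (\<lambda>x y. 2 * \<delta> < dist x y) N"
    "E \<subseteq> (\<Union>x\<in>N. cball x (2 * \<delta>))"
proof -
  let ?P = "\<lambda>N. finite N \<and> N \<subseteq> E \<and> pairwise (\<lambda>x y. 2 * \<delta> < dist x y) N"
  have "card N \<le> nat \<lfloor>1 / (c * \<delta> powr s)\<rfloor>" if "?P N" for N
  proof -
    have "card N * (c * \<delta> powr s) \<le> 1"
      using card_separated_le[of N \<delta>] that assms
      by (intro order_trans[OF _ prob_le_1]) auto
    then have "card N \<le> 1 / (c * \<delta> powr s)" using assms c_pos by (simp add: field_simps)
    then show ?thesis by (simp add: le_nat_floor)
  qed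
  then obtain N where N: "?P N" "\<And>M. ?P M \<Longrightarrow> card M \<le> card N"
    using ex_has_greatest_nat[of ?P "{}" card "Suc (nat \<lfloor>1 / (c * \<delta> powr s)\<rfloor>)"] by (auto simp: less_Suc_eq_le)
  have "E \<subseteq> (\<Union>x\<in>N. cball x (2 * \<delta>))"
  proof (rule ccontr)
    assume "\<not> ?thesis"
    then obtain z where z: "z \<in> E" "\<And>x. x \<in> N \<Longrightarrow> 2 * \<delta> < dist x z"
      by (metis (no_types, lifting) UN_I mem_cball not_le subsetI)
    then have "?P (insert z N)" using N(1) by (auto simp: pairwise_insert dist_commute)
    moreover have "z \<notin> N" using z(2)[of z] assms by auto
    ultimately show False using N(2)[of "insert z N"] N(1) by simp
  qed
  then show ?thesis using N(1) that by blast
qed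

text \<open>For compact \<open>E\<close> these sets are closed and decrease to \<open>E\<close>, so
  a null \<open>E\<close> has thickenings of small mass. That mass bounds both the covers and the
  packings of \<open>E\<close> at scale \<open>\<delta>\<close>.\<close>

definition thick :: "'a set \<Rightarrow> real \<Rightarrow> 'a set" where "thick E \<delta> = (\<Union>x\<in>E. cball x \<delta>)"

lemma thick_UN: "finite N \<Longrightarrow> N \<subseteq> E \<Longrightarrow> (\<Union>x\<in>N. cball x \<delta>) \<subseteq> thick E \<delta>"
  by (auto simp: thick_def)

lemma closed_thick: "compact E \<Longrightarrow> closed (thick E \<delta>)"
  using compact_minkowski_sum_cball[of E \<delta>] by (auto simp: thick_def compact_imp_closed)

lemma thick_measurable: "compact E \<Longrightarrow> thick E \<delta> \<in> sets borel"
  by (simp add: closed_thick)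

lemma hausdorff_premeasure_le_separated:
  assumes "finite N" "E \<subseteq> (\<Union>x\<in>N. cball x (2 * \<delta>))" "0 < \<delta>"
  shows "hausdorff_premeasure s (4 * \<delta>) E \<le> ennreal (4 powr s * (card N * \<delta> powr s))"
proof -
  have "hausdorff_premeasure s (4 * \<delta>) E \<le> ennreal (real (card ((\<lambda>x. cball x (2 * \<delta>)) ` N)) * (4 * \<delta>) powr s)"
    using assms s_pos by (intro hausdorff_premeasure_le_card) auto
  also have "\<dots> \<le> ennreal (4 powr s * (card N * \<delta> powr s))"
    using assms card_image_le[OF assms(1)] by (intro ennreal_leI) (auto simp: powr_mult intro!: mult_right_mono)
  finally show ?thesis .
qed

lemma hausdorff_premeasure_le_thick:
  assumes "compact E" "E \<subseteq> K" "0 < \<delta>" "\<delta> \<le> 1"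
  shows "hausdorff_premeasure s (4 * \<delta>) E \<le> ennreal (4 powr s / c * prob (thick E \<delta>))"
proof -
  obtain N where N: "finite N" "N \<subseteq> E" "pairwise (\<lambda>x y. 2 * \<delta> < dist x y) N"
    "E \<subseteq> (\<Union>x\<in>N. cball x (2 * \<delta>))" using separated_net assms by metis
  have "card N * (c * \<delta> powr s) \<le> prob (\<Union>x\<in>N. cball x \<delta>)"
    using N assms by (intro card_separated_le) auto
  also have "\<dots> \<le> prob (thick E \<delta>)"
    using N assms by (intro finite_measure_mono thick_UN) (auto simp: thick_measurable)
  finally have "4 powr s * (card N * \<delta> powr s) \<le> 4 powr s / c * prob (thick E \<delta>)"
    using c_pos by (simp add: field_simps)
  then show ?thesis
    using hausdorff_premeasure_le_separated[OF N(1,4) assms(3)] ennreal_leI order_trans by blast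
qed

lemma hausdorff_measure_finite: "hausdorff_measure s K < \<infinity>"
proof -
  have "hausdorff_premeasure s d K \<le> ennreal (4 powr s / c)" if "0 < d" for d
  proof -
    define \<delta> where "\<delta> = min 1 (d / 4)"
    have \<delta>: "0 < \<delta>" "\<delta> \<le> 1" "4 * \<delta> \<le> d" using that by (auto simp: \<delta>_def)
    have "hausdorff_premeasure s d K \<le> hausdorff_premeasure s (4 * \<delta>) K"
      by (rule hausdorff_premeasure_antimono) (rule \<delta>)
    also have "\<dots> \<le> ennreal (4 powr s / c * prob (thick K \<delta>))"
      using \<delta> compact_K by (intro hausdorff_premeasure_le_thick) auto
    also have "\<dots> \<le> ennreal (4 powr s / c * 1)"
      using c_pos by (intro ennreal_leI mult_left_mono) auto
    finally show ?thesis by simp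
  qed
  then have "hausdorff_measure s K \<le> ennreal (4 powr s / c)"
    unfolding hausdorff_measure_eq_SUP by (intro SUP_least) auto
  then show ?thesis by (simp add: le_less_trans)
qed

lemma prob_thick_tendsto_0:
  assumes "compact E" "prob E = 0"
  shows "(\<lambda>n. prob (thick E (1 / Suc n))) \<longlonglongrightarrow> 0"
proof -
  have "(\<lambda>n. prob (thick E (1 / Suc n))) \<longlonglongrightarrow> prob (\<Inter>n. thick E (1 / Suc n))"
  proof (rule finite_Lim_measure_decseq)
    show "decseq (\<lambda>n. thick E (1 / Suc n))"
      unfolding decseq_def thick_def by (force simp: frac_le intro: order_trans)
  qed (use thick_measurable[OF assms(1)] in auto)
  moreover have "(\<Inter>n. thick E (1 / Suc n)) = E"
  proof
    show "E \<subseteq> (\<Inter>n. thick E (1 / Suc n))" by (auto simp: thick_def intro!: bexI)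
    show "(\<Inter>n. thick E (1 / Suc n)) \<subseteq> E"
    proof
      fix x assume x: "x \<in> (\<Inter>n. thick E (1 / Suc n))"
      have "\<exists>y\<in>E. dist y x < e" if "0 < e" for e
      proof -
        obtain n where "1 / Suc n < e" using \<open>0 < e\<close> nat_approx_posE by metis
        moreover have "x \<in> thick E (1 / Suc n)" using x by blast
        ultimately show ?thesis by (force simp: thick_def)
      qed
      then have "x \<in> closure E" by (simp add: closure_approachable)
      then show "x \<in> E" using assms by (simp add: compact_imp_closed)
    qed
  qed
  ultimately show ?thesis using assms by simp
qed

lemma hausdorff_measure_null:
  assumes "compact E" "E \<subseteq> K" "prob E = 0"
  shows "hausdorff_measure s E = 0"
proof -
  have lim: "(\<lambda>n. ennreal (4 powr s / c * prob (thick E (1 / Suc n)))) \<longlonglongrightarrow> 0"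
    using tendsto_ennrealI[OF tendsto_mult_right_zero[OF prob_thick_tendsto_0[OF assms(1,3)]]]
    by (simp only: ennreal_0)
  have "hausdorff_premeasure s d E \<le> 0" if "0 < d" for d
  proof (rule tendsto_lowerbound[OF lim])
    obtain n0 where n0: "1 / Suc n0 < d / 4" using \<open>0 < d\<close> nat_approx_posE[of "d/4"] by auto
    show "\<forall>\<^sub>F n in sequentially. hausdorff_premeasure s d E \<le> ennreal (4 powr s / c * prob (thick E (1 / Suc n)))"
    proof (rule eventually_sequentiallyI[of n0])
      fix n assume "n0 \<le> n"
      then have "1 / Suc n \<le> 1 / Suc n0" by (simp add: frac_le)
      then have "4 * (1 / Suc n) \<le> d" using n0 by linarith
      then have "hausdorff_premeasure s d E \<le> hausdorff_premeasure s (4 * (1 / Suc n)) E"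
        by (rule hausdorff_premeasure_antimono)
      also have "\<dots> \<le> ennreal (4 powr s / c * prob (thick E (1 / Suc n)))"
        using assms by (intro hausdorff_premeasure_le_thick) auto
      finally show "hausdorff_premeasure s d E \<le> ennreal (4 powr s / c * prob (thick E (1 / Suc n)))" .
    qed
  qed simp
  then have "hausdorff_measure s E \<le> 0"
    unfolding hausdorff_measure_eq_SUP by (intro SUP_least) auto
  then show ?thesis by simp
qed

text \<open>The disjoint balls are centered in \<open>E\<close> and lie in
  \<open>thick E \<delta>\<close>; the lower mass bound converts their radii into mass. The diameter
  \<open>2 * r\<close> is the source of \<open>2 powr s\<close>.\<close>

lemma packing_sum_le_thick:
  assumes "compact E" "E \<subseteq> K" "\<delta> \<le> 1" "\<B> \<in> ball_packings \<delta> E"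
  shows "(\<Sum>\<^sub>\<infinity>B\<in>\<B>. diam_pow s B) \<le> ennreal (2 powr s / c * prob (thick E \<delta>))"
proof -
  have "(\<Sum>B\<in>F. diam_pow s B) \<le> ennreal (2 powr s / c * prob (thick E \<delta>))"
    if F: "finite F" "F \<subseteq> \<B>" for F
  proof -
    have ball: "\<exists>x\<in>E. \<exists>r. 0 < r \<and> r \<le> \<delta> \<and> B = cball x r" if "B \<in> F" for B
      using assms(4) F that by (auto simp: ball_packings_def)
    have disj: "disjoint F"
    proof -
      have "disjoint \<B>" using assms(4) by (simp add: ball_packings_def)
      then show ?thesis using F(2) unfolding disjoint_def by (meson subsetD)
    qed
    have sub: "B \<subseteq> thick E \<delta>" if "B \<in> F" for B
      using ball[OF that] unfolding thick_def by force
    have meas: "B \<in> sets \<mu>" if "B \<in> F" for B using ball[OF that] by auto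
    have "diam_pow s B \<le> ennreal (2 powr s / c * prob B)" if "B \<in> F" for B
    proof -
      obtain x r where B: "x \<in> E" "0 < r" "r \<le> \<delta>" "B = cball x r" using ball[OF \<open>B \<in> F\<close>] by auto
      have "c * r powr s \<le> prob B" using B assms by (auto intro!: prob_cball_ge)
      then have "(2 * r) powr s \<le> 2 powr s / c * prob B" using c_pos B by (simp add: field_simps powr_mult)
      then show ?thesis using B s_pos by (auto simp: diam_pow_def intro!: ennreal_leI)
    qed
    then have "(\<Sum>B\<in>F. diam_pow s B) \<le> (\<Sum>B\<in>F. ennreal (2 powr s / c * prob B))" by (rule sum_mono)
    also have "\<dots> = ennreal (2 powr s / c * (\<Sum>B\<in>F. prob B))"
      using c_pos by (subst sum_ennreal) (auto simp: sum_distrib_left)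
    also have "(\<Sum>B\<in>F. prob B) = prob (\<Union>B\<in>F. B)"
      using F meas disj by (intro finite_measure_finite_Union[symmetric]) (auto simp: disjoint_family_on_def disjoint_def pairwise_def disjnt_def)
    also have "ennreal (2 powr s / c * prob (\<Union>B\<in>F. B)) \<le> ennreal (2 powr s / c * prob (thick E \<delta>))"
      using c_pos sub thick_measurable[OF assms(1)]
      by (intro ennreal_leI mult_left_mono finite_measure_mono) auto
    finally show ?thesis .
  qed
  then show ?thesis
    by (subst nonneg_infsum_complete) (auto intro!: SUP_least)
qed

lemma packing_premeasure_le_thick:
  assumes "compact E" "E \<subseteq> K" "0 < \<delta>" "\<delta> \<le> 1"
  shows "packing_premeasure s E \<le> ennreal (2 powr s / c * prob (thick E \<delta>))"
  unfolding packing_premeasure_eq_INF using assms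
  by (intro INF_lower2[of \<delta>] SUP_least packing_sum_le_thick) auto

lemma packing_measure_finite: "packing_measure s K < \<infinity>"
proof -
  have "packing_measure s K \<le> ennreal (2 powr s / c * prob (thick K 1))"
    using packing_measure_le_premeasure packing_premeasure_le_thick[of K 1] compact_K
    by (auto intro: order_trans)
  then show ?thesis by (simp add: le_less_trans)
qed

lemma packing_premeasure_null:
  assumes "compact E" "E \<subseteq> K" "prob E = 0"
  shows "packing_premeasure s E = 0"
proof -
  have "(\<lambda>n. ennreal (2 powr s / c * prob (thick E (1 / Suc n)))) \<longlonglongrightarrow> 0"
    using tendsto_ennrealI[OF tendsto_mult_right_zero[OF prob_thick_tendsto_0[OF assms(1,3)]]]
    by (simp only: ennreal_0)
  then have "packing_premeasure s E \<le> 0"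
    by (rule tendsto_lowerbound) (use assms packing_premeasure_le_thick in \<open>auto intro!: always_eventually\<close>)
  then show ?thesis by simp
qed

text \<open>The balls of radius \<open>\<delta>\<close> about a separated net form a packing, those
  of radius \<open>2 * \<delta>\<close> a cover. The quotient 2 of the diameters gives the
  constant.\<close>

lemma hausdorff_measure_le_packing_premeasure:
  assumes "E \<subseteq> K"
  shows "hausdorff_measure s E \<le> ennreal (2 powr s) * packing_premeasure s E"
proof -
  have le: "hausdorff_premeasure s d E \<le> ennreal (2 powr s) * (SUP \<B> \<in> ball_packings d' E. \<Sum>\<^sub>\<infinity>B\<in>\<B>. diam_pow s B)"
    if "0 < d" "0 < d'" for d d'
  proof -
    define \<delta> where "\<delta> = min 1 (min d' (d / 4))"
    have \<delta>: "0 < \<delta>" "\<delta> \<le> 1" "4 * \<delta> \<le> d" "\<delta> \<le> d'" using that by (auto simp: \<delta>_def)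
    obtain N where N: "finite N" "N \<subseteq> E" "pairwise (\<lambda>x y. 2 * \<delta> < dist x y) N"
      "E \<subseteq> (\<Union>x\<in>N. cball x (2 * \<delta>))" using separated_net[OF assms] \<delta> by metis
    define \<B> where "\<B> = (\<lambda>x. cball x \<delta>) ` N"
    have disj: "cball x \<delta> \<inter> cball y \<delta> = {}" if "x \<in> N" "y \<in> N" "x \<noteq> y" for x y
    proof -
      have "2 * \<delta> < dist x y" using N(3) that by (auto simp: pairwise_def)
      then show ?thesis by (simp add: disjoint_cballI)
    qed
    have inj: "inj_on (\<lambda>x. cball x \<delta>) N"
      using disj \<delta> by (intro inj_onI) (metis centre_in_cball empty_iff Int_iff less_imp_le)
    have "\<B> \<in> ball_packings d' E"
      using N \<delta> disj by (fastforce simp: ball_packings_def \<B>_def disjoint_def intro: countable_finite)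
    have "hausdorff_premeasure s d E \<le> hausdorff_premeasure s (4 * \<delta>) E"
      by (rule hausdorff_premeasure_antimono) (rule \<delta>)
    also have "\<dots> \<le> ennreal (4 powr s * (card N * \<delta> powr s))"
      by (rule hausdorff_premeasure_le_separated[OF N(1,4) \<delta>(1)])
    also have "4 powr s * (card N * \<delta> powr s) = 2 powr s * (card N * (2 * \<delta>) powr s)"
      using \<delta> powr_mult[of 2 2 s] by (simp add: powr_mult)
    also have "ennreal \<dots> = ennreal (2 powr s) * (\<Sum>x\<in>N. diam_pow s (cball x \<delta>))"
      using \<delta> s_pos by (simp add: diam_pow_def ennreal_mult ennreal_of_nat_eq_real_of_nat)
    also have "(\<Sum>x\<in>N. diam_pow s (cball x \<delta>)) = (\<Sum>\<^sub>\<infinity>B\<in>\<B>. diam_pow s B)"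
      unfolding \<B>_def using N(1) inj by (simp add: sum.reindex)
    also have "ennreal (2 powr s) * \<dots> \<le> ennreal (2 powr s) * (SUP \<B> \<in> ball_packings d' E. \<Sum>\<^sub>\<infinity>B\<in>\<B>. diam_pow s B)"
      using \<open>\<B> \<in> _\<close> by (intro mult_left_mono SUP_upper) auto
    finally show ?thesis .
  qed
  have "hausdorff_measure s E / ennreal (2 powr s) \<le> packing_premeasure s E"
    unfolding packing_premeasure_eq_INF hausdorff_measure_eq_SUP
    by (intro INF_greatest divide_le_posI_ennreal SUP_least) (use le in \<open>auto simp: mult.commute\<close>)
  then have "ennreal (2 powr s) * (hausdorff_measure s E / ennreal (2 powr s)) \<le> ennreal (2 powr s) * packing_premeasure s E"
    by (rule mult_left_mono) simp
  then show ?thesis by (simp add: ennreal_times_divide ennreal_mult_divide_eq mult.commute)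
qed

text \<open>The packing premeasure is not countably subadditive, so its positivity on
  \<open>K\<close> would not suffice. The Hausdorff measure is subadditive and is bounded by the
  premeasure on every piece inside \<open>K\<close>, and so carries the estimate through an
  arbitrary cover.\<close>

lemma packing_measure_pos: "0 < packing_measure s K"
proof (rule ccontr)
  assume "\<not> ?thesis"
  then have "packing_measure s K < hausdorff_measure s K / ennreal (2 powr s)"
    using hausdorff_measure_pos hausdorff_measure_finite by (auto simp: ennreal_zero_less_divide)
  then obtain A :: "nat \<Rightarrow> _" where A: "K \<subseteq> (\<Union>i. A i)"
    "(\<Sum>i. packing_premeasure s (A i)) < hausdorff_measure s K / ennreal (2 powr s)"
    unfolding packing_measure_def INF_less_iff by auto
  have "hausdorff_measure s K \<le> hausdorff_measure s (\<Union>i. A i \<inter> K)"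
    using A(1) by (intro hausdorff_measure_mono) auto
  also have "\<dots> \<le> (\<Sum>i. hausdorff_measure s (A i \<inter> K))"
    by (rule hausdorff_measure_countable_subadditive)
  also have "\<dots> \<le> (\<Sum>i. ennreal (2 powr s) * packing_premeasure s (A i))"
    by (intro suminf_le order_trans[OF hausdorff_measure_le_packing_premeasure] mult_left_mono packing_premeasure_mono) auto
  also have "\<dots> = ennreal (2 powr s) * (\<Sum>i. packing_premeasure s (A i))" by simp
  also have "\<dots> < ennreal (2 powr s) * (hausdorff_measure s K / ennreal (2 powr s))"
    using A(2) by (intro ennreal_mult_strict_left_mono) auto
  also have "\<dots> = hausdorff_measure s K" by (simp add: ennreal_times_divide ennreal_mult_divide_eq mult.commute)
  finally show False by simp
qed

lemma covering_number_le_powr: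
  assumes "A \<subseteq> K" "0 < \<delta>" "\<delta> \<le> 1"
  obtains \<U> where "finite \<U>" "A \<subseteq> \<Union>\<U>" "\<forall>U\<in>\<U>. bounded U \<and> diameter U \<le> \<delta>"
    "real (card \<U>) \<le> 4 powr s / c * \<delta> powr (-s)"
proof -
  obtain N where N: "finite N" "N \<subseteq> A" "pairwise (\<lambda>x y. 2 * (\<delta>/4) < dist x y) N"
    "A \<subseteq> (\<Union>x\<in>N. cball x (2 * (\<delta>/4)))" using separated_net[of A "\<delta>/4"] assms by auto
  have "card N * (c * (\<delta>/4) powr s) \<le> 1"
    using card_separated_le[of N "\<delta>/4"] N assms
    by (intro order_trans[OF _ prob_le_1]) auto
  then have "card N \<le> 4 powr s / c * \<delta> powr (-s)"
    using c_pos assms by (simp add: powr_divide powr_minus field_simps)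
  moreover have "card ((\<lambda>x. cball x (2 * (\<delta>/4))) ` N) \<le> card N" using N(1) by (rule card_image_le)
  ultimately show ?thesis
    using N assms by (intro that[of "(\<lambda>x. cball x (2 * (\<delta>/4))) ` N"]) auto
qed

lemma hausdorff_measure_0_above:
  assumes "A \<subseteq> K" "s < t" shows "hausdorff_measure t A = 0"
proof (rule hausdorff_measure_0_if_covering)
  show "\<forall>\<^sub>F \<delta> in at_right 0. \<exists>\<U>. finite \<U> \<and> A \<subseteq> \<Union>\<U> \<and>
      (\<forall>U\<in>\<U>. bounded U \<and> diameter U \<le> \<delta>) \<and> real (card \<U>) \<le> 4 powr s / c * \<delta> powr (-s)"
    unfolding eventually_at_right_field
    by (intro exI[of _ 1]) (metis covering_number_le_powr[OF assms(1)] less_imp_le zero_less_one)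
qed (use assms s_pos c_pos in auto)

lemma hausdorff_dim_le_s:
  assumes "A \<subseteq> K" shows "hausdorff_dim A \<le> ereal s"
proof (rule ereal_le_epsilon2[rule_format])
  fix e :: real assume "0 < e"
  then show "hausdorff_dim A \<le> ereal s + ereal e"
    using hausdorff_dim_le[OF _ hausdorff_measure_0_above[OF assms, of "s + e"]] s_pos by simp
qed

lemma packing_dim_le_s:
  assumes "A \<subseteq> K" "A \<noteq> {}" shows "packing_dim A \<le> ereal s"
proof -
  have bd: "bounded A" using assms compact_K compact_imp_bounded bounded_subset by blast
  \<comment> \<open>The absolute value keeps the estimate below nonnegative, so that it also covers
    the case of covering number 0 with \<open>ln 0 = 0\<close>.\<close>
  define b where "b = \<bar>ln (4 powr s / c)\<bar>"
  have "packing_dim A \<le> (SUP i::nat. upper_box_dim A)"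
    unfolding packing_dim_def by (rule INF_lower) auto
  also have "\<dots> = Limsup (at_right 0) (\<lambda>\<delta>. ereal (ln (real (covering_number \<delta> A)) / ln (1 / \<delta>)))"
    using assms bd by (simp add: upper_box_dim_def)
  also have "\<dots> \<le> Limsup (at_right 0) (\<lambda>\<delta>. ereal (b / ln (1 / \<delta>) + s))"
  proof (rule Limsup_mono)
    have "\<forall>\<^sub>F \<delta>::real in at_right 0. 0 < \<delta> \<and> \<delta> < 1"
      by (auto simp: eventually_at_right_field intro: exI[of _ 1])
    then show "\<forall>\<^sub>F \<delta> in at_right 0. ereal (ln (real (covering_number \<delta> A)) / ln (1 / \<delta>)) \<le> ereal (b / ln (1 / \<delta>) + s)"
    proof eventually_elim
      case (elim \<delta>)
      obtain \<U> where U: "finite \<U>" "A \<subseteq> \<Union>\<U>" "\<forall>U\<in>\<U>. bounded U \<and> diameter U \<le> \<delta>"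
        "real (card \<U>) \<le> 4 powr s / c * \<delta> powr (-s)"
        using covering_number_le_powr[OF assms(1), of \<delta>] elim by auto
      have le: "real (covering_number \<delta> A) \<le> 4 powr s / c * \<delta> powr (-s)"
        using covering_number_le[of \<U> A \<delta>] U by (meson of_nat_mono order_trans)
      have "ln (real (covering_number \<delta> A)) \<le> b + s * ln (1 / \<delta>)"
      proof (cases "covering_number \<delta> A = 0")
        case True
        moreover have "0 \<le> s * ln (1 / \<delta>)" using elim s_pos by simp
        ultimately show ?thesis by (simp add: b_def)
      next
        case False
        then have "ln (real (covering_number \<delta> A)) \<le> ln (4 powr s / c * \<delta> powr (-s))"
          using le by (subst ln_le_cancel_iff) (use c_pos elim in auto)
        also have "\<dots> = ln (4 powr s / c) + s * ln (1 / \<delta>)"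
          using c_pos elim by (simp add: ln_mult ln_powr ln_div)
        finally show ?thesis by (simp add: b_def)
      qed
      then show ?case using elim by (simp add: field_simps)
    qed
  qed
  also have "\<dots> = ereal s"
  proof (rule lim_imp_Limsup)
    have "((\<lambda>\<delta>::real. b / ln (1 / \<delta>) + s) \<longlongrightarrow> 0 + s) (at_right 0)"
    proof (intro tendsto_add tendsto_const)
      have "filterlim (\<lambda>\<delta>::real. ln (1/\<delta>)) at_top (at_right 0)"
        by (rule filterlim_compose[OF ln_at_top]) (use filterlim_inverse_at_top_right in \<open>simp add: inverse_eq_divide\<close>)
      then show "((\<lambda>\<delta>::real. b / ln (1 / \<delta>)) \<longlongrightarrow> 0) (at_right 0)"
        by (rule real_tendsto_divide_at_top[OF tendsto_const])
    qed
    then show "((\<lambda>\<delta>. ereal (b / ln (1 / \<delta>) + s)) \<longlongrightarrow> ereal s) (at_right 0)" by simp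
  qed simp
  finally show ?thesis .
qed

text \<open>For \<open>t < s\<close> a set of diameter at most 1 costs at least as much at exponent
  \<open>t\<close> as at \<open>s\<close>, so a null \<open>t\<close>-dimensional measure would
  contradict the positive \<open>s\<close>-dimensional one.\<close>

lemma hausdorff_dim_K: "hausdorff_dim K = ereal s"
proof (rule antisym[OF hausdorff_dim_le_s])
  show "ereal s \<le> hausdorff_dim K"
  proof (rule hausdorff_dim_ge[OF K_ne])
    fix t assume t: "0 \<le> t" "t < s"
    show "hausdorff_measure t K \<noteq> 0"
    proof
      assume 0: "hausdorff_measure t K = 0"
      have "hausdorff_measure s K \<le> hausdorff_measure t K"
        unfolding hausdorff_measure_eq_SUP
      proof (rule SUP_least)
        fix d :: real assume d: "d \<in> {0<..}"
        have "hausdorff_premeasure s d K \<le> hausdorff_premeasure s (min 1 d) K"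
          by (rule hausdorff_premeasure_antimono) simp
        also have "\<dots> \<le> hausdorff_premeasure t (min 1 d) K"
          unfolding hausdorff_premeasure_def
        proof (rule INF_mono, rule bexI, rule suminf_le)
          fix A :: "nat \<Rightarrow> 'a set" and n
          assume A: "A \<in> {C. K \<subseteq> \<Union> (range C) \<and> (\<forall>i. bounded (C i) \<and> diameter (C i) \<le> min 1 d)}"
          then have "0 \<le> diameter (A n)" "diameter (A n) \<le> 1" by (auto simp: diameter_ge_0)
          then show "diam_pow s (A n) \<le> diam_pow t (A n)"
            using t s_pos powr_mono'[of t s "diameter (A n)"] by (auto simp: diam_pow_def powr_le1 intro!: ennreal_leI)
        qed auto
        also have "\<dots> \<le> (SUP \<delta>\<in>{0<..}. hausdorff_premeasure t \<delta> K)" using d by (intro SUP_upper) auto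
        finally show "hausdorff_premeasure s d K \<le> (SUP \<delta>\<in>{0<..}. hausdorff_premeasure t \<delta> K)" .
      qed
      then show False using 0 hausdorff_measure_pos by simp
    qed
  qed
qed simp

lemma packing_dim_eq_s:
  assumes "A \<subseteq> K" "ereal s \<le> hausdorff_dim A"
  shows "packing_dim A = ereal s"
proof -
  have "A \<noteq> {}" using assms s_pos by (auto simp: hausdorff_dim_def one_ereal_def)
  then show ?thesis
    using packing_dim_le_s assms s_pos packing_dim_ge_if_hausdorff_dim_ge by (auto intro!: antisym)
qed

end

section \<open>Random perturbations of occupation densities\<close>

definition hat :: "real \<Rightarrow> real" where "hat t = max 0 (1 - \<bar>t\<bar>)"

lemma hat_nonneg: "0 \<le> hat t" and hat_le_1: "hat t \<le> 1"
  by (auto simp: hat_def)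

lemma hat_lipschitz: "\<bar>hat t - hat u\<bar> \<le> \<bar>t - u\<bar>"
  by (auto simp: hat_def max_def abs_if)

text \<open>The two-scale relation with coefficients 1/2, 1, 1/2. Halved, these are the
  probabilities 1/4, 1/2, 1/4 of \<open>coin_diff\<close>; the factor 2 is the growth of the
  normalization of each coordinate from \<open>psi j\<close> to \<open>psi (Suc j)\<close>.\<close>

lemma hat_refine: "hat (t / 2) = (1/2) * hat (t + 1) + hat t + (1/2) * hat (t - 1)"
  by (auto simp: hat_def max_def abs_if field_simps split: if_splits)

text \<open>The tensor product hat function at scale \<open>2 ^ -j\<close>, normalized to integral
  1.\<close>

definition psi :: "nat \<Rightarrow> 'b::euclidean_space \<Rightarrow> real" where
  "psi j v = (\<Prod>i\<in>Basis. 2 ^ j * hat (2 ^ j * (v \<bullet> i)))"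

lemma psi_eq: "psi j (v::'b::euclidean_space) = 2 ^ (j * DIM('b)) * (\<Prod>i\<in>Basis. hat (2 ^ j * (v \<bullet> i)))"
  by (simp add: psi_def prod.distrib power_mult)

lemma psi_nonneg: "0 \<le> psi j v"
  by (auto simp: psi_def hat_nonneg intro!: prod_nonneg)

lemma psi_le: "psi j (v::'b::euclidean_space) \<le> 2 ^ (j * DIM('b))"
proof -
  have "(\<Prod>i\<in>Basis. hat (2 ^ j * (v \<bullet> i))) \<le> 1"
    by (rule prod_le_1) (auto simp: hat_nonneg hat_le_1)
  then show ?thesis unfolding psi_eq by simp
qed

lemma psi_lipschitz:
  "\<bar>psi j u - psi j (v::'b::euclidean_space)\<bar> \<le> 2 ^ (j * DIM('b)) * 2 ^ j * DIM('b) * norm (u - v)"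
proof -
  have "\<bar>(\<Prod>i\<in>Basis. hat (2 ^ j * (u \<bullet> i))) - (\<Prod>i\<in>Basis. hat (2 ^ j * (v \<bullet> i)))\<bar>
      \<le> (\<Sum>i\<in>Basis. \<bar>hat (2 ^ j * (u \<bullet> i)) - hat (2 ^ j * (v \<bullet> i))\<bar>)"
    using norm_prod_diff[of Basis "\<lambda>i. hat (2 ^ j * (u \<bullet> i))" "\<lambda>i. hat (2 ^ j * (v \<bullet> i))"]
    by (auto simp: hat_nonneg hat_le_1)
  also have "\<dots> \<le> (\<Sum>i\<in>(Basis::'b set). 2 ^ j * norm (u - v))"
  proof (rule sum_mono)
    fix i :: 'b assume "i \<in> Basis"
    then have "\<bar>(u - v) \<bullet> i\<bar> \<le> norm (u - v)" by (rule Basis_le_norm)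
    moreover have "\<bar>hat (2 ^ j * (u \<bullet> i)) - hat (2 ^ j * (v \<bullet> i))\<bar> \<le> \<bar>2 ^ j * (u \<bullet> i) - 2 ^ j * (v \<bullet> i)\<bar>"
      by (rule hat_lipschitz)
    moreover have "\<bar>2 ^ j * (u \<bullet> i) - 2 ^ j * (v \<bullet> i)\<bar> = 2 ^ j * \<bar>(u - v) \<bullet> i\<bar>"
      by (simp add: inner_diff_left right_diff_distrib[symmetric] abs_mult)
    ultimately show "\<bar>hat (2 ^ j * (u \<bullet> i)) - hat (2 ^ j * (v \<bullet> i))\<bar> \<le> 2 ^ j * norm (u - v)"
      using mult_left_mono[of "\<bar>(u - v) \<bullet> i\<bar>" "norm (u - v)" "2 ^ j :: real"] zero_le_power[of "2::real" j]
      by linarith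
  qed
  also have "\<dots> = 2 ^ j * DIM('b) * norm (u - v)" by simp
  finally have "2 ^ (j * DIM('b)) * \<bar>(\<Prod>i\<in>Basis. hat (2 ^ j * (u \<bullet> i))) - (\<Prod>i\<in>Basis. hat (2 ^ j * (v \<bullet> i)))\<bar>
    \<le> 2 ^ (j * DIM('b)) * (2 ^ j * DIM('b) * norm (u - v))" by (rule mult_left_mono) simp
  then show ?thesis unfolding psi_eq by (simp add: right_diff_distrib[symmetric] abs_mult)
qed

lemma psi_nonzero:
  assumes "psi j (v::'b::euclidean_space) \<noteq> 0"
  shows "norm v \<le> DIM('b) * (1/2) ^ j"
proof -
  have "\<bar>v \<bullet> i\<bar> \<le> (1/2) ^ j" if "i \<in> Basis" for i
  proof -
    have "hat (2 ^ j * (v \<bullet> i)) \<noteq> 0" using assms that by (auto simp: psi_def)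
    then have "\<bar>2 ^ j * (v \<bullet> i)\<bar> < 1" by (auto simp: hat_def split: if_splits)
    then show ?thesis by (simp add: abs_mult power_divide field_simps)
  qed
  then have "(\<Sum>i\<in>Basis. \<bar>v \<bullet> i\<bar>) \<le> (\<Sum>i\<in>(Basis::'b set). (1/2) ^ j)" by (intro sum_mono) auto
  then show ?thesis using norm_le_l1[of v] by simp
qed

lemma continuous_psi: "continuous_on UNIV (psi j)"
  unfolding psi_def hat_def by (intro continuous_intros)

lemma psi_measurable [measurable]: "psi j \<in> borel_measurable borel"
  using continuous_psi by (rule borel_measurable_continuous_onI)

text \<open>With this step distribution \<open>psi j\<close> is the average of the translates of \<open>psi (Suc j)\<close>, so
  that the densities \<open>dens\<close> below form exact martingales.\<close>

definition coin_diff :: "real pmf" where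
  "coin_diff = map_pmf (\<lambda>(a, b). of_bool a + of_bool b - 1) (pmf_of_set (UNIV :: (bool \<times> bool) set))"

lemma expectation_coin_diff:
  "measure_pmf.expectation coin_diff f = (f (-1) + 2 * f 0 + f 1 :: real) / 4"
proof -
  have "(\<Sum>x\<in>(UNIV::(bool\<times>bool) set). f (case x of (a, b) \<Rightarrow> of_bool a + of_bool b - 1)) = f (-1) + 2 * f 0 + f 1"
    by (simp add: UNIV_Times_UNIV[symmetric] UNIV_bool sum.cartesian_product[symmetric] del: UNIV_Times_UNIV)
  moreover have "card (UNIV::(bool\<times>bool) set) = 4"
    by (simp add: UNIV_Times_UNIV[symmetric] card_cartesian_product del: UNIV_Times_UNIV)
  ultimately show ?thesis
    unfolding coin_diff_def by (simp add: integral_pmf_of_set)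
qed

lemma set_pmf_coin_diff: "set_pmf coin_diff \<subseteq> {-1, 0, 1}"
  unfolding coin_diff_def by (auto simp: of_bool_def split: prod.splits if_splits)

text \<open>The step size \<open>(1/2) ^ Suc j\<close> is the spacing of the translates of
  \<open>psi (Suc j)\<close> in the refinement equation.\<close>

definition step_pmf :: "nat \<Rightarrow> 'b::euclidean_space pmf" where
  "step_pmf j = map_pmf (\<lambda>k. (1/2) ^ Suc j *\<^sub>R (\<Sum>i\<in>Basis. k i *\<^sub>R i)) (Pi_pmf Basis 0 (\<lambda>_. coin_diff))"

lemma finite_set_step_pmf: "finite (set_pmf (step_pmf j))"
proof -
  have "finite (set_pmf (Pi_pmf (Basis::'a set) 0 (\<lambda>_. coin_diff)))"
    using finite_subset[OF set_pmf_coin_diff] by (simp add: set_Pi_pmf finite_PiE_dflt)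
  then show ?thesis by (simp add: step_pmf_def)
qed

lemma step_pmf_norm_le:
  assumes "a \<in> set_pmf (step_pmf j :: 'b::euclidean_space pmf)"
  shows "norm a \<le> DIM('b) * (1/2) ^ Suc j"
proof -
  obtain k where k: "k \<in> set_pmf (Pi_pmf (Basis::'b set) 0 (\<lambda>_. coin_diff))"
    "a = (1/2) ^ Suc j *\<^sub>R (\<Sum>i\<in>Basis. k i *\<^sub>R i)" using assms by (auto simp: step_pmf_def)
  have "\<bar>k i\<bar> \<le> 1" if "i \<in> Basis" for i
    using k(1) that set_pmf_coin_diff by (auto simp: set_Pi_pmf PiE_dflt_def)
  then have "norm (\<Sum>i\<in>Basis. k i *\<^sub>R (i::'b)) \<le> (\<Sum>i\<in>(Basis::'b set). 1)"
    by (intro order_trans[OF norm_sum] sum_mono) auto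
  then show ?thesis unfolding k(2) by (simp add: field_simps)
qed

text \<open>The coordinates of the step are independent and \<open>psi\<close> is a product, so the
  expectation factors, and each factor is an instance of \<open>hat_refine\<close>.\<close>

lemma expectation_psi_step_pmf:
  "measure_pmf.expectation (step_pmf j) (\<lambda>a. psi (Suc j) (v - a)) = psi j (v :: 'b::euclidean_space)"
proof -
  let ?t = "\<lambda>i. 2 ^ Suc j * (v \<bullet> i)"
  have inner: "2 ^ Suc j * ((v - (1/2) ^ Suc j *\<^sub>R (\<Sum>b\<in>Basis. k b *\<^sub>R b)) \<bullet> i) = ?t i - k i"
    if "i \<in> Basis" for k and i :: 'b
    using that by (simp add: inner_diff_left inner_sum_left inner_Basis if_distrib sum.delta power_divide field_simps cong: if_cong)
  have "measure_pmf.expectation (step_pmf j) (\<lambda>a. psi (Suc j) (v - a)) =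
     measure_pmf.expectation (Pi_pmf (Basis::'b set) 0 (\<lambda>_. coin_diff)) (\<lambda>k. \<Prod>i\<in>Basis. 2 ^ Suc j * hat (?t i - k i))"
    unfolding step_pmf_def integral_map_pmf psi_def by (intro Bochner_Integration.integral_cong refl prod.cong) (simp only: inner)
  also have "\<dots> = (\<Prod>i\<in>(Basis::'b set). measure_pmf.expectation coin_diff (\<lambda>k. 2 ^ Suc j * hat (?t i - k)))"
    by (rule expectation_prod_Pi_pmf)
       (auto intro!: integrable_measure_pmf_finite finite_subset[OF set_pmf_coin_diff] simp: hat_nonneg)
  also have "\<dots> = psi j v"
    unfolding psi_def
  proof (intro prod.cong refl)
    fix i :: 'b
    have "hat (2 ^ j * (v \<bullet> i)) = hat (?t i / 2)" by simp
    also have "\<dots> = (1/2) * hat (?t i + 1) + hat (?t i) + (1/2) * hat (?t i - 1)" by (rule hat_refine)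
    finally have eq: "hat (2 ^ j * (v \<bullet> i)) = (1/2) * hat (?t i + 1) + hat (?t i) + (1/2) * hat (?t i - 1)" .
    show "measure_pmf.expectation coin_diff (\<lambda>k. 2 ^ Suc j * hat (?t i - k)) = 2 ^ j * hat (2 ^ j * (v \<bullet> i))"
      unfolding expectation_coin_diff eq by (simp only: power_Suc diff_minus_eq_add diff_0_right) (simp add: algebra_simps)
  qed
  finally show ?thesis .
qed

text \<open>Hoeffding's inequality for independent summands in \<open>[0, b c]\<close>, weakened by
  \<open>exp (- z) \<le> 1 / z\<close> to a bound that is linear in \<open>V\<close>, from which the
  required size of the cells can be solved directly.\<close>

lemma Pi_pmf_sum_deviation:
  fixes p :: "'b pmf" and w :: "nat \<Rightarrow> 'b \<Rightarrow> real"
  assumes "0 < t" and w: "\<And>c a. c < n \<Longrightarrow> 0 \<le> w c a \<and> w c a \<le> b c"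
    and V: "(\<Sum>c<n. (b c)\<^sup>2) \<le> V"
  shows "measure_pmf.prob (Pi_pmf {..<n} d (\<lambda>_. p))
     {\<alpha>. \<bar>(\<Sum>c<n. w c (\<alpha> c)) - (\<Sum>c<n. measure_pmf.expectation p (w c))\<bar> \<ge> t} \<le> V / t\<^sup>2"
proof -
  let ?M = "Pi_pmf {..<n} d (\<lambda>_. p)"
  have comp: "map_pmf (\<lambda>f. f c) ?M = p" if "c < n" for c
    using that by (subst Pi_pmf_component) auto
  have ex: "measure_pmf.expectation ?M (\<lambda>\<alpha>. w c (\<alpha> c)) = measure_pmf.expectation p (w c)" if "c < n" for c
    using comp[OF that] by (metis integral_map_pmf)
  interpret Hoeffding_ineq "measure_pmf ?M" "{..<n}" "\<lambda>c \<alpha>. w c (\<alpha> c)" "\<lambda>_. 0" b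
    "(\<Sum>c<n. measure_pmf.expectation ?M (\<lambda>\<alpha>. w c (\<alpha> c)))"
  proof unfold_locales
    have "prob_space.indep_vars (measure_pmf ?M) (\<lambda>_. borel) (\<lambda>c. w c \<circ> (\<lambda>f. f c)) {..<n}"
      by (rule prob_space.indep_vars_compose[OF measure_pmf.prob_space_axioms indep_vars_Pi_pmf]) auto
    then show "prob_space.indep_vars (measure_pmf ?M) (\<lambda>_. borel) (\<lambda>c \<alpha>. w c (\<alpha> c)) {..<n}"
      by (simp add: comp_def)
  qed (use w in auto)
  let ?S = "\<Sum>c<n. (b c)\<^sup>2"
  show ?thesis
  proof (cases "0 < ?S")
    case True
    have "measure_pmf.prob ?M {\<alpha>. \<bar>(\<Sum>c<n. w c (\<alpha> c)) - (\<Sum>c<n. measure_pmf.expectation p (w c))\<bar> \<ge> t}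
      \<le> 2 * exp (-2 * t\<^sup>2 / ?S)"
      using Hoeffding_ineq_abs_ge[of t] True assms(1) by (simp add: ex)
    also have "\<dots> \<le> ?S / t\<^sup>2"
    proof -
      define z where "z = 2 * t\<^sup>2 / ?S"
      have z: "0 < z" using True assms(1) by (simp add: z_def)
      have "z \<le> exp z" using exp_ge_add_one_self[of z] by linarith
      then have "exp (-z) \<le> 1 / z" using z by (simp add: exp_minus field_simps)
      then show ?thesis by (simp add: z_def)
    qed
    also have "\<dots> \<le> V / t\<^sup>2" by (intro divide_right_mono V) auto
    finally show ?thesis .
  next
    \<comment> \<open>Hoeffding's bound divides by the sum of squares. If that vanishes, all
      summands are 0 and there is no deviation.\<close>
    case False
    then have "?S = 0" by (simp add: sum_nonneg order_antisym not_less)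
    then have b: "b c = 0" if "c < n" for c using that by (auto simp: sum_nonneg_eq_0_iff)
    have w0: "w c a = 0" if "c < n" for c a using w[OF that, of a] b[OF that] by simp
    then have "(\<Sum>c<n. w c (\<alpha> c)) = 0" "(\<Sum>c<n. measure_pmf.expectation p (w c)) = 0" for \<alpha>
      by (auto intro!: sum.neutral integral_eq_zero_AE)
    then have "{\<alpha>. \<bar>(\<Sum>c<n. w c (\<alpha> c)) - (\<Sum>c<n. measure_pmf.expectation p (w c))\<bar> \<ge> t} = {}"
      using assms(1) by auto
    moreover have "0 \<le> V" using \<open>?S = 0\<close> V by simp
    ultimately show ?thesis by simp
  qed
qed

section \<open>Smoothed occupation densities and one random level\<close>

context frostman
begin

text \<open>The image under \<open>F\<close> of \<open>\<mu>\<close> restricted to \<open>E\<close>,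
  convolved with \<open>psi j\<close>: the occupation density of \<open>F\<close> on
  \<open>E\<close> at resolution \<open>2 ^ -j\<close>.\<close>

definition dens :: "nat \<Rightarrow> 'a set \<Rightarrow> ('a \<Rightarrow> 'b::euclidean_space) \<Rightarrow> 'b \<Rightarrow> real" where
  "dens j E F y = (\<integral>x. indicator E x * psi j (y - F x) \<partial>\<mu>)"

lemma dens_integrable:
  fixes F :: "'a \<Rightarrow> 'b::euclidean_space"
  assumes [measurable]: "E \<in> sets borel" "F \<in> borel_measurable borel"
  shows "integrable \<mu> (\<lambda>x. indicator E x * psi j (y - F x))"
proof (rule integrable_const_bound)
  show "AE x in \<mu>. norm (indicator E x * psi j (y - F x)) \<le> 2 ^ (j * DIM('b))"
    by (intro AE_I2) (auto simp: indicator_def psi_nonneg psi_le)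
qed simp

lemma dens_nonneg: "0 \<le> dens j E F y"
  unfolding dens_def by (intro integral_nonneg_AE AE_I2) (simp add: psi_nonneg)

lemma dens_le:
  fixes F :: "'a \<Rightarrow> 'b::euclidean_space"
  assumes [measurable]: "E \<in> sets borel" "F \<in> borel_measurable borel"
  shows "dens j E F y \<le> 2 ^ (j * DIM('b)) * prob E"
proof -
  have "dens j E F y \<le> (\<integral>x. 2 ^ (j * DIM('b)) * indicator E x \<partial>\<mu>)"
    unfolding dens_def
  proof (rule integral_mono)
    show "integrable \<mu> (\<lambda>x. 2 ^ (j * DIM('b)) * indicator E x :: real)"
      by (intro integrable_mult_right integrable_const_bound[of _ 1]) (auto simp: indicator_def)
  qed (simp_all add: dens_integrable psi_le split: split_indicator)
  then show ?thesis by simp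
qed

lemma dens_mono:
  assumes "E \<subseteq> D" "E \<in> sets borel" "D \<in> sets borel" "F \<in> borel_measurable borel"
  shows "dens j E F y \<le> dens j D F y"
  unfolding dens_def using assms
  by (intro integral_mono dens_integrable) (auto simp: indicator_def psi_nonneg)

definition dens_lip :: "nat \<Rightarrow> nat \<Rightarrow> real" where
  "dens_lip d j = 2 ^ (j * d) * 2 ^ j * real d"

lemma dens_lipschitz:
  fixes F :: "'a \<Rightarrow> 'b::euclidean_space"
  assumes "E \<in> sets borel" "F \<in> borel_measurable borel"
  shows "\<bar>dens j E F y - dens j E F z\<bar> \<le> dens_lip DIM('b) j * norm (y - z)" (is "_ \<le> ?L")
proof -
  have "\<bar>dens j E F y - dens j E F z\<bar> = \<bar>\<integral>x. indicator E x * psi j (y - F x) - indicator E x * psi j (z - F x) \<partial>\<mu>\<bar>"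
    unfolding dens_def by (subst Bochner_Integration.integral_diff) (auto simp: dens_integrable assms)
  also have "\<dots> \<le> (\<integral>x. \<bar>indicator E x * psi j (y - F x) - indicator E x * psi j (z - F x)\<bar> \<partial>\<mu>)"
    by (rule integral_abs_bound)
  also have "\<dots> \<le> (\<integral>x. ?L \<partial>\<mu>)"
  proof (rule integral_mono)
    fix x
    have "\<bar>psi j (y - F x) - psi j (z - F x)\<bar> \<le> ?L"
      using psi_lipschitz[of j "y - F x" "z - F x"] by (simp add: dens_lip_def)
    then show "\<bar>indicator E x * psi j (y - F x) - indicator E x * psi j (z - F x)\<bar> \<le> ?L"
      by (auto simp: indicator_def)
  qed (auto intro!: dens_integrable assms)
  also have "\<dots> = ?L" using prob_space by simp
  finally show ?thesis .
qed

lemma dens_split: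
  fixes n :: nat
  assumes "\<And>c. c < n \<Longrightarrow> P c \<in> sets borel" "disjoint_family_on P {..<n}" "E \<in> sets borel" "F \<in> borel_measurable borel"
  shows "dens j E F y = (\<Sum>c<n. dens j (E \<inter> P c) F y) + dens j (E - (\<Union>c<n. P c)) F y"
proof -
  have ind: "indicator E x = (\<Sum>c<n. indicator (E \<inter> P c) x) + (indicator (E - (\<Union>c<n. P c)) x :: real)" for x
  proof -
    have "(\<Sum>c<n. indicator (E \<inter> P c) x) = (\<Sum>c<n. indicator E x * indicator (P c) x :: real)"
      by (simp add: indicator_inter_arith)
    also have "\<dots> = indicator E x * (\<Sum>c<n. indicator (P c) x)" by (simp add: sum_distrib_left)
    also have "(\<Sum>c<n. indicator (P c) x) = (indicator (\<Union>c<n. P c) x :: real)"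
      using assms(2) by (intro indicator_UN_disjoint[symmetric]) auto
    finally show ?thesis by (auto simp: indicator_def)
  qed
  have [measurable]: "(\<Union>c<n. P c) \<in> sets borel" using assms(1) by auto
  have "dens j E F y = (\<integral>x. (\<Sum>c<n. indicator (E \<inter> P c) x * psi j (y - F x)) + indicator (E - (\<Union>c<n. P c)) x * psi j (y - F x) \<partial>\<mu>)"
    unfolding dens_def by (simp only: ind[of] distrib_right sum_distrib_right)
  also have "\<dots> = (\<Sum>c<n. dens j (E \<inter> P c) F y) + dens j (E - (\<Union>c<n. P c)) F y"
  proof -
    have int: "integrable \<mu> (\<lambda>x. indicator (E \<inter> P c) x * psi j (y - F x))" if "c \<in> {..<n}" for c
      using that assms by (intro dens_integrable) auto
    have "integrable \<mu> (\<lambda>x. indicator (E - (\<Union>c<n. P c)) x * psi j (y - F x))"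
      using assms by (intro dens_integrable) auto
    moreover have "integrable \<mu> (\<lambda>x. \<Sum>c<n. indicator (E \<inter> P c) x * psi j (y - F x))"
      by (rule Bochner_Integration.integrable_sum) (rule int)
    moreover have "(\<integral>x. (\<Sum>c<n. indicator (E \<inter> P c) x * psi j (y - F x)) \<partial>\<mu>) = (\<Sum>c<n. dens j (E \<inter> P c) F y)"
      unfolding dens_def by (rule Bochner_Integration.integral_sum) (rule int)
    ultimately show ?thesis by (simp only: Bochner_Integration.integral_add dens_def)
  qed
  finally show ?thesis .
qed

text \<open>The exact martingale step, for one random constant added on all of \<open>E\<close>.
  Perturbations that are constant on cells allow its use cell by cell.\<close>

lemma dens_expectation:
  fixes F :: "'a \<Rightarrow> 'b::euclidean_space"
  assumes "E \<in> sets borel" "F \<in> borel_measurable borel"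
  shows "measure_pmf.expectation (step_pmf j) (\<lambda>a. dens (Suc j) E (\<lambda>x. F x + a) y) = dens j E F y"
proof -
  let ?A = "set_pmf (step_pmf j :: 'b pmf)"
  have "measure_pmf.expectation (step_pmf j) (\<lambda>a. dens (Suc j) E (\<lambda>x. F x + a) y) =
      (\<Sum>a\<in>?A. pmf (step_pmf j) a * dens (Suc j) E (\<lambda>x. F x + a) y)"
    by (subst integral_measure_pmf[of ?A]) (auto simp: finite_set_step_pmf)
  also have "\<dots> = (\<integral>x. (\<Sum>a\<in>?A. pmf (step_pmf j) a * (indicator E x * psi (Suc j) (y - (F x + a)))) \<partial>\<mu>)"
    unfolding dens_def
    by (subst Bochner_Integration.integral_sum) (auto intro!: integrable_mult_right dens_integrable assms borel_measurable_add)
  also have "\<dots> = (\<integral>x. indicator E x * psi j (y - F x) \<partial>\<mu>)"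
  proof (rule Bochner_Integration.integral_cong[OF refl])
    fix x
    have "psi j (y - F x) = (\<Sum>a\<in>?A. pmf (step_pmf j) a * psi (Suc j) (y - F x - a))"
      using expectation_psi_step_pmf[of j "y - F x"] finite_set_step_pmf
      by (subst (asm) integral_measure_pmf[of ?A]) auto
    then show "(\<Sum>a\<in>?A. pmf (step_pmf j) a * (indicator E x * psi (Suc j) (y - (F x + a)))) = indicator E x * psi j (y - F x)"
      by (simp add: sum_distrib_left algebra_simps)
  qed
  finally show ?thesis unfolding dens_def .
qed

text \<open>Small balls that cover \<open>K\<close> are made disjoint and then shrunk to compact
  sets by inner regularity. Compactness lets a continuous map take arbitrary constants on the cells,
  at the price of a small uncovered rest.\<close>

lemma small_cells:
  assumes "0 < \<theta>" "0 < \<epsilon>"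
  obtains n :: nat and P where "\<And>c. c < n \<Longrightarrow> compact (P c)" "\<And>c. c < n \<Longrightarrow> prob (P c) \<le> \<theta>"
    "disjoint_family_on P {..<n}" "prob (UNIV - (\<Union>c<n. P c)) \<le> \<epsilon>"
proof -
  \<comment> \<open>With this radius the upper mass bound \<open>C * r powr s\<close> equals
    \<open>\<theta>\<close>.\<close>
  define r where "r = (\<theta> / C) powr (1/s)"
  have r: "0 < r" using assms C_pos by (simp add: r_def)
  have Cr: "C * r powr s = \<theta>" using assms C_pos s_pos by (simp add: r_def powr_powr)
  obtain X where X: "finite X" "K \<subseteq> (\<Union>x\<in>X. ball x r)"
    using compact_K r compact_eq_totally_bounded[of K] by blast
  obtain e where e: "bij_betw e {..<card X} X"
    using X(1) by (metis atLeast0LessThan ex_bij_betw_nat_finite)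
  define n where "n = card X"
  have "X \<noteq> {}" using X(2) K_ne by auto
  then have n: "0 < n" using X(1) by (simp add: n_def card_gt_0_iff)
  define A where "A = disjointed (\<lambda>i. if i < n then ball (e i) r else {})"
  have Am: "A c \<in> sets borel" for c
    unfolding A_def disjointed_def by auto
  \<comment> \<open>Each of the \<open>n\<close> cells may lose \<open>\<epsilon> / n\<close>, so
    the total loss is at most \<open>\<epsilon>\<close>.\<close>
  have "\<exists>Q\<subseteq>A c. compact Q \<and> prob (A c) \<le> prob Q + \<epsilon> / n" for c
  proof (rule ccontr)
    assume "\<not> ?thesis"
    then have lt: "prob Q < prob (A c) - \<epsilon> / n" if "Q \<subseteq> A c" "compact Q" for Q using that by force
    have "ennreal (prob (A c)) = (SUP Q \<in> {Q. Q \<subseteq> A c \<and> compact Q}. emeasure \<mu> Q)"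
      using inner_regular[of \<mu> "A c"] Am by (simp add: emeasure_eq_measure)
    also have "\<dots> \<le> ennreal (prob (A c) - \<epsilon> / n)"
    proof (rule SUP_least)
      fix Q assume "Q \<in> {Q. Q \<subseteq> A c \<and> compact Q}"
      then show "emeasure \<mu> Q \<le> ennreal (prob (A c) - \<epsilon> / n)"
        using lt[of Q] unfolding emeasure_eq_measure by (intro ennreal_leI) simp
    qed
    finally have "prob (A c) \<le> prob (A c) - \<epsilon> / n"
      using lt[of "{}"] by (subst (asm) ennreal_le_iff) simp_all
    then show False using assms n by (simp add: field_simps)
  qed
  then obtain P where P: "\<And>c. P c \<subseteq> A c" "\<And>c. compact (P c)" "\<And>c. prob (A c) \<le> prob (P c) + \<epsilon> / n"
    by metis
  have disjA: "disjoint_family A" unfolding A_def by (rule disjoint_family_disjointed)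
  have UA: "(\<Union>c<n. A c) \<supseteq> K"
  proof
    fix x assume "x \<in> K"
    then obtain z where "z \<in> X" "x \<in> ball z r" using X by auto
    then obtain i where "i < n" "x \<in> ball (e i) r" using e by (metis bij_betw_def imageE lessThan_iff n_def)
    then have "x \<in> (\<Union>i. if i < n then ball (e i) r else {})" by (auto intro!: exI[of _ i])
    then have "x \<in> (\<Union>i. A i)" unfolding A_def by (simp only: UN_disjointed_eq)
    then obtain j where j: "x \<in> A j" by blast
    then have "j < n" unfolding A_def disjointed_def by (auto split: if_splits)
    then show "x \<in> (\<Union>c<n. A c)" using j by auto
  qed
  show thesis
  proof (rule that[of n P])
    fix c assume c: "c < n"
    show "compact (P c)" by (rule P)
    have "P c \<subseteq> cball (e c) r" using P(1)[of c] c unfolding A_def disjointed_def by auto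
    then have "prob (P c) \<le> prob (cball (e c) r)" by (intro finite_measure_mono) auto
    then show "prob (P c) \<le> \<theta>" using prob_cball_le[OF r, of "e c"] Cr by simp
  next
    show "disjoint_family_on P {..<n}"
      unfolding disjoint_family_on_def
    proof (intro ballI impI)
      fix c c' :: nat assume "c \<noteq> c'"
      then have "A c \<inter> A c' = {}" using disjA by (auto simp: disjoint_family_on_def)
      then show "P c \<inter> P c' = {}" using P(1)[of c] P(1)[of c'] by blast
    qed
    have Pm: "P c \<in> sets borel" for c using P(2) by (simp add: borel_compact)
    have "UNIV - (\<Union>c<n. P c) \<subseteq> (UNIV - K) \<union> (\<Union>c<n. A c - P c)" using UA by auto
    then have "prob (UNIV - (\<Union>c<n. P c)) \<le> prob ((UNIV - K) \<union> (\<Union>c<n. A c - P c))"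
      using Am Pm compact_K by (intro finite_measure_mono) (auto intro!: sets.Un sets.finite_UN simp: borel_compact)
    also have "\<dots> \<le> prob (UNIV - K) + prob (\<Union>c<n. A c - P c)"
      using Am Pm compact_K by (intro measure_Un_le) (auto simp: borel_compact)
    also have "prob (UNIV - K) = 0"
      using prob_compl[of K] compact_K prob_K by (simp add: borel_compact)
    also have "prob (\<Union>c<n. A c - P c) \<le> (\<Sum>c<n. prob (A c - P c))"
      using Am Pm by (intro finite_measure_subadditive_finite) auto
    also have "\<dots> \<le> (\<Sum>c<n. \<epsilon> / n)"
    proof (rule sum_mono)
      fix c
      have "prob (A c - P c) = prob (A c) - prob (P c)" using Am Pm P by (intro finite_measure_Diff) auto
      then show "prob (A c - P c) \<le> \<epsilon> / n" using P(3)[of c] by simp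
    qed
    also have "\<dots> = \<epsilon>" using n by simp
    finally show "prob (UNIV - (\<Union>c<n. P c)) \<le> \<epsilon>" by simp
  qed
qed

text \<open>\<open>\<Gamma>\<close> is chosen before \<open>F\<close>, \<open>E\<close> and
  \<open>y\<close>. One choice serves all of them because the mean is exact for every drift and the
  fluctuation is controlled by the masses of the cells alone.\<close>

lemma level_exists:
  assumes "0 < t" "0 < T"
  shows "\<exists>\<Gamma> :: ('a \<Rightarrow> 'b::euclidean_space) pmf. finite (set_pmf \<Gamma>) \<and>
    (\<forall>g\<in>set_pmf \<Gamma>. continuous_on UNIV g \<and> (\<forall>x. norm (g x) \<le> DIM('b) * (1/2) ^ Suc j)) \<and>
    (\<forall>F E y. F \<in> borel_measurable borel \<longrightarrow> E \<in> sets borel \<longrightarrow>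
      measure_pmf.prob \<Gamma> {g. t < \<bar>dens (Suc j) E (\<lambda>x. F x + g x) y - dens j E F y\<bar>} \<le> T)"
proof -
  define B :: real where "B = 2 ^ (Suc j * DIM('b))"
  have B: "0 < B" by (simp add: B_def)
  \<comment> \<open>\<open>B\<close> bounds \<open>psi (Suc j)\<close>. This
    \<open>\<epsilon>\<close> limits the density of the uncovered rest to \<open>t / 2\<close>, and
    \<open>\<theta>\<close> below makes the deviation bound
    \<open>B\<^sup>2 * \<theta> / (t / 2)\<^sup>2\<close> equal to \<open>T\<close>.\<close>
  define \<epsilon> where "\<epsilon> = t / (2 * B)"
  define \<theta> where "\<theta> = T * (t/2)\<^sup>2 / B\<^sup>2"
  have "0 < \<epsilon>" and "0 < \<theta>" using assms B by (auto simp: \<epsilon>_def \<theta>_def)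
  from \<open>0 < \<theta>\<close> \<open>0 < \<epsilon>\<close> obtain n :: nat and P where P: "\<And>c. c < n \<Longrightarrow> compact (P c)" "\<And>c. c < n \<Longrightarrow> prob (P c) \<le> \<theta>"
    "disjoint_family_on P {..<n}" "prob (UNIV - (\<Union>c<n. P c)) \<le> \<epsilon>" by (rule small_cells) (rule that)
  have Pm: "P c \<in> sets borel" if "c < n" for c using P(1)[OF that] by (simp add: borel_compact)
  let ?p = "step_pmf j :: 'b pmf"
  define \<Omega> where "\<Omega> = Pi_pmf {..<n} 0 (\<lambda>_. ?p)"
  have \<Omega>: "finite (set_pmf \<Omega>)"
    unfolding \<Omega>_def by (simp add: set_Pi_pmf finite_PiE_dflt finite_set_step_pmf)
  \<comment> \<open>Prescribed constants on disjoint closed cells form a continuous map, and the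
    Tietze theorem extends it to the whole space within the same norm bound.\<close>
  have "\<exists>g. continuous_on UNIV g \<and> (\<forall>x. norm (g x) \<le> DIM('b) * (1/2) ^ Suc j) \<and> (\<forall>c<n. \<forall>x\<in>P c. g x = \<alpha> c)"
    if "\<alpha> \<in> set_pmf \<Omega>" for \<alpha>
  proof -
    have na: "norm (\<alpha> c) \<le> DIM('b) * (1/2) ^ Suc j" if "c < n" for c
      using that \<open>\<alpha> \<in> set_pmf \<Omega>\<close> step_pmf_norm_le by (auto simp: \<Omega>_def set_Pi_pmf PiE_dflt_def simp del: power_Suc)
    define h where "h x = \<alpha> (THE c. c < n \<and> x \<in> P c)" for x
    have h: "h x = \<alpha> c" if "c < n" "x \<in> P c" for c x
    proof -
      have "(THE c. c < n \<and> x \<in> P c) = c" using that P(3) by (intro the_equality) (auto simp: disjoint_family_on_def)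
      then show ?thesis by (simp add: h_def)
    qed
    have "continuous_on (\<Union>c\<in>{..<n}. P c) h"
      by (rule continuous_on_closed_Union)
         (use P(1) in \<open>auto simp: compact_imp_closed h intro: continuous_on_eq[OF continuous_on_const]\<close>)
    moreover have "closedin (top_of_set UNIV) (\<Union>c\<in>{..<n}. P c)"
      using P(1) by (auto intro!: closed_UN simp: compact_imp_closed)
    moreover have "0 \<le> DIM('b) * (1/2::real) ^ Suc j" by simp
    moreover have "norm (h x) \<le> DIM('b) * (1/2) ^ Suc j" if "x \<in> (\<Union>c\<in>{..<n}. P c)" for x
      using that h na by (metis UN_E lessThan_iff)
    ultimately obtain g where g: "continuous_on UNIV g" "\<And>x. x \<in> (\<Union>c\<in>{..<n}. P c) \<Longrightarrow> g x = h x"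
      "\<And>x. x \<in> UNIV \<Longrightarrow> norm (g x) \<le> DIM('b) * (1/2) ^ Suc j"
      by (rule Tietze) (assumption, rule that)
    have "g x = \<alpha> c" if "c < n" "x \<in> P c" for c x
      using g(2)[of x] h[OF that] that by auto
    then show ?thesis using g(1,3) by blast
  qed
  then obtain G where G: "\<And>\<alpha>. \<alpha> \<in> set_pmf \<Omega> \<Longrightarrow> continuous_on UNIV (G \<alpha>)"
    "\<And>\<alpha> x. \<alpha> \<in> set_pmf \<Omega> \<Longrightarrow> norm (G \<alpha> x) \<le> DIM('b) * (1/2) ^ Suc j"
    "\<And>\<alpha> c x. \<alpha> \<in> set_pmf \<Omega> \<Longrightarrow> c < n \<Longrightarrow> x \<in> P c \<Longrightarrow> G \<alpha> x = \<alpha> c"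
    by metis
  have main: "measure_pmf.prob (map_pmf G \<Omega>) {g. t < \<bar>dens (Suc j) E (\<lambda>x. F x + g x) y - dens j E F y\<bar>} \<le> T"
    if F[measurable]: "F \<in> borel_measurable borel" and E[measurable]: "E \<in> sets borel" for F E y
  proof -
    define w where "w c a = dens (Suc j) (E \<inter> P c) (\<lambda>x. F x + a) y" for c a
    have wb: "0 \<le> w c a \<and> w c a \<le> B * prob (P c)" if "c < n" for c a
    proof -
      have "w c a \<le> B * prob (E \<inter> P c)" unfolding w_def B_def using Pm[OF that] by (intro dens_le) auto
      also have "\<dots> \<le> B * prob (P c)" using B Pm[OF that] by (intro mult_left_mono finite_measure_mono) auto
      finally show ?thesis by (simp add: w_def dens_nonneg)
    qed
    \<comment> \<open>A sum of squares is at most the largest mass times the total mass, so it is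
      small with \<open>\<theta>\<close>.\<close>
    have "(\<Sum>c<n. (B * prob (P c))\<^sup>2) \<le> (\<Sum>c<n. B\<^sup>2 * \<theta> * prob (P c))"
    proof (rule sum_mono)
      fix c assume "c \<in> {..<n}"
      then have "prob (P c) * prob (P c) \<le> \<theta> * prob (P c)" using P(2) by (intro mult_right_mono) auto
      then have "B\<^sup>2 * (prob (P c) * prob (P c)) \<le> B\<^sup>2 * (\<theta> * prob (P c))" by (rule mult_left_mono) simp
      then show "(B * prob (P c))\<^sup>2 \<le> B\<^sup>2 * \<theta> * prob (P c)" by (simp add: power2_eq_square algebra_simps)
    qed
    also have "\<dots> = B\<^sup>2 * \<theta> * prob (\<Union>c<n. P c)"
      using Pm P(3) by (subst finite_measure_finite_Union) (auto simp: sum_distrib_left)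
    also have "\<dots> \<le> B\<^sup>2 * \<theta> * 1" using \<open>0 < \<theta>\<close> by (intro mult_left_mono) auto
    finally have V: "(\<Sum>c<n. (B * prob (P c))\<^sup>2) \<le> B\<^sup>2 * \<theta>" by simp
    let ?R = "E - (\<Union>c<n. P c)"
    have [measurable]: "?R \<in> sets borel" using Pm E by auto
    have R: "B * prob ?R \<le> t / 2"
    proof -
      have "prob ?R \<le> prob (UNIV - (\<Union>c<n. P c))" using Pm E by (intro finite_measure_mono) auto
      then have "B * prob ?R \<le> B * \<epsilon>" using P(4) B by (intro mult_left_mono) auto
      then show ?thesis using B by (simp add: \<epsilon>_def)
    qed
    have ew: "(\<Sum>c<n. measure_pmf.expectation ?p (w c)) = (\<Sum>c<n. dens j (E \<inter> P c) F y)"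
      unfolding w_def using Pm E F by (intro sum.cong refl dens_expectation) auto
    \<comment> \<open>The rest contributes between 0 and \<open>t / 2\<close> to each of the two
      densities, hence at most \<open>t / 2\<close> to their difference, and at least
      \<open>t / 2\<close> is left for the cells.\<close>
    have dev: "t / 2 \<le> \<bar>(\<Sum>c<n. w c (\<alpha> c)) - (\<Sum>c<n. measure_pmf.expectation ?p (w c))\<bar>"
      if \<alpha>: "\<alpha> \<in> set_pmf \<Omega>" and big: "t < \<bar>dens (Suc j) E (\<lambda>x. F x + G \<alpha> x) y - dens j E F y\<bar>" for \<alpha>
    proof -
      have Gm[measurable]: "G \<alpha> \<in> borel_measurable borel" using G(1)[OF \<alpha>] by (rule borel_measurable_continuous_onI)
      have "dens (Suc j) E (\<lambda>x. F x + G \<alpha> x) y = (\<Sum>c<n. dens (Suc j) (E \<inter> P c) (\<lambda>x. F x + G \<alpha> x) y) + dens (Suc j) ?R (\<lambda>x. F x + G \<alpha> x) y"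
        using Pm by (intro dens_split P) auto
      also have "(\<Sum>c<n. dens (Suc j) (E \<inter> P c) (\<lambda>x. F x + G \<alpha> x) y) = (\<Sum>c<n. w c (\<alpha> c))"
        unfolding w_def dens_def using G(3)[OF \<alpha>]
        by (intro sum.cong refl Bochner_Integration.integral_cong) (auto simp: indicator_def)
      finally have 1: "dens (Suc j) E (\<lambda>x. F x + G \<alpha> x) y = (\<Sum>c<n. w c (\<alpha> c)) + dens (Suc j) ?R (\<lambda>x. F x + G \<alpha> x) y" .
      have 2: "dens j E F y = (\<Sum>c<n. measure_pmf.expectation ?p (w c)) + dens j ?R F y"
        unfolding ew using Pm by (intro dens_split P) auto
      have "dens (Suc j) ?R (\<lambda>x. F x + G \<alpha> x) y \<le> B * prob ?R" unfolding B_def by (rule dens_le) auto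
      moreover have "dens j ?R F y \<le> 2 ^ (j * DIM('b)) * prob ?R" by (rule dens_le) auto
      moreover have "2 ^ (j * DIM('b)) * prob ?R \<le> B * prob ?R"
        unfolding B_def by (intro mult_right_mono power_increasing) auto
      ultimately show ?thesis
        using big R 1 2 dens_nonneg[of "Suc j" ?R "\<lambda>x. F x + G \<alpha> x" y] dens_nonneg[of j ?R F y] by linarith
    qed
    have "measure_pmf.prob (map_pmf G \<Omega>) {g. t < \<bar>dens (Suc j) E (\<lambda>x. F x + g x) y - dens j E F y\<bar>}
      = measure_pmf.prob \<Omega> {\<alpha>. t < \<bar>dens (Suc j) E (\<lambda>x. F x + G \<alpha> x) y - dens j E F y\<bar>}"
      by (simp add: vimage_def)
    also have "\<dots> \<le> measure_pmf.prob \<Omega> {\<alpha>. \<bar>(\<Sum>c<n. w c (\<alpha> c)) - (\<Sum>c<n. measure_pmf.expectation ?p (w c))\<bar> \<ge> t/2}"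
      by (rule measure_pmf.finite_measure_mono_AE) (auto simp: AE_measure_pmf_iff dest: dev)
    also have "\<dots> \<le> B\<^sup>2 * \<theta> / (t/2)\<^sup>2"
      unfolding \<Omega>_def using wb V assms by (intro Pi_pmf_sum_deviation) auto
    also have "\<dots> = T" using B assms by (simp add: \<theta>_def)
    finally show ?thesis .
  qed
  show ?thesis
    by (rule exI[of _ "map_pmf G \<Omega>"]) (use G(1,2) \<Omega> main in \<open>auto simp del: power_Suc\<close>)
qed

end

section \<open>Maps with large fibers\<close>

text \<open>Openness in terms of pointwise distances on \<open>K\<close>, so that later arguments
  need not mention the metric of the function space. Halving the radius keeps the supremum of the
  distances strictly below \<open>r\<close>.\<close>

lemma openin_C_top:
  fixes K :: "'a::euclidean_space set" and U :: "('a \<Rightarrow> 'b::euclidean_space) set"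
  assumes "compact K" "K \<noteq> {}"
  shows "openin (C_top K) U \<longleftrightarrow> U \<subseteq> topspace (C_top K) \<and>
    (\<forall>f\<in>U. \<exists>r>0. \<forall>g\<in>topspace (C_top K). (\<forall>x\<in>K. dist (f x) (g x) < r) \<longrightarrow> g \<in> U)"
proof -
  let ?m = "cfunspace (top_of_set K) (euclidean_metric :: 'b metric)"
  interpret M: Metric_space "mspace ?m" "mdist ?m" by (rule Metric_space_mspace_mdist)
  have top: "C_top K = M.mtopology" by (simp add: C_top_def mtopology_of_def)
  have tsp: "topspace (C_top K) = mspace ?m" unfolding top by (rule M.topspace_mtopology)
  have cpt: "compactin (top_of_set K) (topspace (top_of_set K))"
    using assms by (simp add: compactin_subtopology)
  have lt: "mdist ?m f g < r \<Longrightarrow> x \<in> K \<Longrightarrow> dist (f x) (g x) < r"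
    if "f \<in> mspace ?m" "g \<in> mspace ?m" for f g r x
    using cfunspace_mdist_lt[OF cpt that, of r x] by simp
  have le: "mdist ?m f g \<le> r" if "\<And>x. x \<in> K \<Longrightarrow> dist (f x) (g x) \<le> r" "0 \<le> r" for f g r
    using that by (intro mdist_cfunspace_le) auto
  show ?thesis
    unfolding tsp
  proof (rule iffI)
    assume "openin (C_top K) U"
    then have U: "U \<subseteq> mspace ?m" "\<And>f. f \<in> U \<Longrightarrow> \<exists>r>0. M.mball f r \<subseteq> U"
      unfolding top M.openin_mtopology by auto
    have "\<exists>r>0. \<forall>g\<in>mspace ?m. (\<forall>x\<in>K. dist (f x) (g x) < r) \<longrightarrow> g \<in> U" if f: "f \<in> U" for f
    proof -
      obtain r where r: "0 < r" "M.mball f r \<subseteq> U" using U(2) f by blast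
      have "g \<in> U" if "g \<in> mspace ?m" "\<forall>x\<in>K. dist (f x) (g x) < r / 2" for g
      proof -
        have "mdist ?m f g \<le> r / 2" using that(2) r(1) by (intro le) (auto intro: less_imp_le)
        then have "g \<in> M.mball f r" using r(1) U(1) f that(1) by (auto simp del: mspace_cfunspace)
        then show ?thesis using r(2) by blast
      qed
      then show ?thesis using r(1) by (intro exI[of _ "r / 2"]) (auto simp del: mspace_cfunspace)
    qed
    then show "U \<subseteq> mspace ?m \<and> (\<forall>f\<in>U. \<exists>r>0. \<forall>g\<in>mspace ?m. (\<forall>x\<in>K. dist (f x) (g x) < r) \<longrightarrow> g \<in> U)"
      using U(1) by blast
  next
    assume U: "U \<subseteq> mspace ?m \<and> (\<forall>f\<in>U. \<exists>r>0. \<forall>g\<in>mspace ?m. (\<forall>x\<in>K. dist (f x) (g x) < r) \<longrightarrow> g \<in> U)"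
    show "openin (C_top K) U"
      unfolding top M.openin_mtopology
    proof (intro conjI allI impI)
      show "U \<subseteq> mspace ?m" using U by blast
      fix f assume f: "f \<in> U"
      then obtain r where r: "0 < r" "\<And>g. g \<in> mspace ?m \<Longrightarrow> (\<forall>x\<in>K. dist (f x) (g x) < r) \<Longrightarrow> g \<in> U"
        using U by (meson subsetD)
      have "M.mball f r \<subseteq> U"
      proof
        fix g assume "g \<in> M.mball f r"
        then have "g \<in> mspace ?m" "f \<in> mspace ?m" "mdist ?m f g < r" by (auto simp del: mspace_cfunspace)
        then show "g \<in> U" using r(2) lt by blast
      qed
      then show "\<exists>r>0. M.mball f r \<subseteq> U" using r(1) by blast
    qed
  qed
qed

lemma C_topI:
  assumes "compact K" "f \<in> extensional K" "continuous_on K f"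
  shows "f \<in> topspace (C_top K)"
  using assms by (simp add: topspace_C_top)

lemma closedin_C_topI:
  fixes S :: "('a::euclidean_space \<Rightarrow> 'b::euclidean_space) set"
  assumes "compact K" "K \<noteq> {}" "S \<subseteq> topspace (C_top K)"
    and S: "\<And>f \<sigma>. f \<in> topspace (C_top K) \<Longrightarrow> (\<And>n. \<sigma> n \<in> S) \<Longrightarrow>
      (\<And>n x. x \<in> K \<Longrightarrow> dist (f x) (\<sigma> n x) < 1 / Suc n) \<Longrightarrow> f \<in> S"
  shows "closedin (C_top K) S"
  unfolding closedin_def openin_C_top[OF assms(1,2)]
proof (intro conjI ballI)
  fix f assume f: "f \<in> topspace (C_top K) - S"
  show "\<exists>r>0. \<forall>g\<in>topspace (C_top K). (\<forall>x\<in>K. dist (f x) (g x) < r) \<longrightarrow> g \<in> topspace (C_top K) - S"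
  proof (rule ccontr)
    assume "\<not> ?thesis"
    then have "\<exists>g\<in>S. \<forall>x\<in>K. dist (f x) (g x) < 1 / Suc n" for n
      by (metis Diff_iff of_nat_0_less_iff zero_less_Suc zero_less_divide_1_iff)
    then obtain \<sigma> where "\<And>n. \<sigma> n \<in> S" "\<And>n x. x \<in> K \<Longrightarrow> dist (f x) (\<sigma> n x) < 1 / Suc n" by metis
    then show False using S f by blast
  qed
qed (use assms in auto)

section \<open>Borel sets of a topology\<close>

lemma space_borel_of [simp]: "space (borel_of T) = topspace T"
  unfolding borel_of_def by (simp add: openin_subset space_measure_of_conv)

lemma sets_borel_of: "sets (borel_of T) = sigma_sets (topspace T) {U. openin T U}"
  unfolding borel_of_def by (rule sets_measure_of) (auto dest: openin_subset)

lemma openin_in_borel_of: "openin T U \<Longrightarrow> U \<in> sets (borel_of T)"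
  by (simp add: sets_borel_of)

lemma closedin_in_borel_of: "closedin T S \<Longrightarrow> S \<in> sets (borel_of T)"
  using sets.compl_sets[OF openin_in_borel_of, of T "topspace T - S"]
  by (simp add: closedin_def double_diff)

lemma measurable_borel_ofI:
  assumes "\<And>U. openin T U \<Longrightarrow> f -` U \<inter> space M \<in> sets M" "f \<in> space M \<rightarrow> topspace T"
  shows "f \<in> measurable M (borel_of T)"
  unfolding borel_of_def by (rule measurable_measure_of) (use assms in \<open>auto dest: openin_subset\<close>)

text \<open>The second factor is the trivial density bound \<open>2 ^ (j * d)\<close> at the level
  \<open>j\<close> about \<open>sqrt (log 2 (1 / r))\<close>, where balls of radius \<open>r\<close>
  begin to be tested.\<close>

definition dim_gauge :: "real \<Rightarrow> real \<Rightarrow> real \<Rightarrow> real" where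
  "dim_gauge s d r = r powr s * 2 powr (d * sqrt (log 2 (1 / r)))"

lemma dim_gauge_nonneg: "0 \<le> dim_gauge s d r"
  by (simp add: dim_gauge_def)

text \<open>For \<open>r = 2 powr (- q\<^sup>2)\<close> the quotient of the gauge by
  \<open>r powr t\<close> has exponent \<open>d * q - (s - t) * q\<^sup>2\<close>, and completing
  the square gives its maximum.\<close>

lemma dim_gauge_le_powr:
  assumes "0 < r" "r \<le> 1" "t < s"
  shows "dim_gauge s d r \<le> 2 powr (d\<^sup>2 / (4 * (s - t))) * r powr t"
proof -
  define q where "q = sqrt (log 2 (1 / r))"
  have "0 \<le> log 2 (1 / r)" using assms by simp
  then have q: "log 2 (1 / r) = q\<^sup>2" by (simp add: q_def)
  have r: "r = 2 powr (- q\<^sup>2)"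
    using assms q[symmetric] by (simp add: powr_minus log_divide)
  have "u * (q - d / (2 * u))\<^sup>2 = u * q\<^sup>2 - d * q + d\<^sup>2 / (4 * u)" if "u \<noteq> 0" for u
    using that by (simp add: power2_eq_square field_simps)
  from this[of "s - t"] have "(s - t) * q\<^sup>2 - d * q + d\<^sup>2 / (4 * (s - t)) = (s - t) * (q - d / (2 * (s - t)))\<^sup>2"
    using assms by simp
  also have "0 \<le> \<dots>" using assms by simp
  finally have "- (q\<^sup>2 * s) + d * q \<le> d\<^sup>2 / (4 * (s - t)) - q\<^sup>2 * t" by (simp add: algebra_simps)
  then have "2 powr (- (q\<^sup>2 * s) + d * q) \<le> 2 powr (d\<^sup>2 / (4 * (s - t)) - q\<^sup>2 * t)" by simp
  moreover have "dim_gauge s d r = 2 powr (- (q\<^sup>2 * s) + d * q)"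
    unfolding dim_gauge_def q_def[symmetric] by (subst r) (simp add: powr_powr powr_add[symmetric])
  moreover have "2 powr (d\<^sup>2 / (4 * (s - t)) - q\<^sup>2 * t) = 2 powr (d\<^sup>2 / (4 * (s - t))) * r powr t"
  proof -
    have "r powr t = 2 powr (- (q\<^sup>2 * t))" by (subst r) (simp add: powr_powr)
    then show ?thesis by (simp add: powr_add[symmetric])
  qed
  ultimately show ?thesis by metis
qed

lemma powr_add_le:
  assumes "0 \<le> a" "0 \<le> b" "0 < t"
  shows "(a + b) powr t \<le> (2 * a) powr t + (2 * b) powr (t::real)"
proof (cases "a \<le> b")
  case True
  then have "(a + b) powr t \<le> (2 * b) powr t" using assms by (intro powr_mono2) auto
  then show ?thesis by (metis add_increasing powr_ge_zero)
next
  case False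
  then have "(a + b) powr t \<le> (2 * a) powr t" using assms by (intro powr_mono2) auto
  then show ?thesis by (metis add_increasing2 powr_ge_zero)
qed

text \<open>Largeness of a fiber is expressed by the Hausdorff content with respect to a gauge that is
  smaller than every power \<open>r\<^sup>t\<close> with \<open>t < s\<close>; such a lower bound passes to uniform limits.\<close>

definition fat :: "'a::euclidean_space set \<Rightarrow> real \<Rightarrow> real \<Rightarrow> ('a \<Rightarrow> 'b::euclidean_space) \<Rightarrow> 'b \<Rightarrow> bool" where
  "fat K s \<kappa> F y \<longleftrightarrow> (\<forall>P. finite P \<longrightarrow> P \<subseteq> K \<times> {0<..1} \<longrightarrow>
     {x\<in>K. F x = y} \<subseteq> (\<Union>(x, r)\<in>P. ball x r) \<longrightarrow> \<kappa> \<le> (\<Sum>(x, r)\<in>P. dim_gauge s DIM('b) r))"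

text \<open>By compactness \<open>F\<close> stays away from \<open>y\<close> outside a neighborhood
  of the fiber. Hence the fibers of uniformly close maps remain in the same neighborhood.\<close>

lemma fiber_gap:
  fixes F :: "'a::euclidean_space \<Rightarrow> 'b::euclidean_space"
  assumes "compact K" "continuous_on K F" "open W" "{x \<in> K. F x = y} \<subseteq> W"
  obtains \<delta> where "0 < \<delta>" "\<And>x. x \<in> K - W \<Longrightarrow> \<delta> \<le> dist (F x) y"
proof (cases "K - W = {}")
  case True
  then show ?thesis using that[of 1] by auto
next
  case False
  have "compact (K - W)" using assms by (intro compact_diff)
  moreover have "continuous_on (K - W) (\<lambda>x. dist (F x) y)"
    by (intro continuous_intros continuous_on_subset[OF assms(2)]) auto
  ultimately obtain z where z: "z \<in> K - W" "\<And>x. x \<in> K - W \<Longrightarrow> dist (F z) y \<le> dist (F x) y"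
    using False continuous_attains_inf[of "K - W" "\<lambda>x. dist (F x) y"] by blast
  have "F z \<noteq> y" using z(1) assms(4) by blast
  then show ?thesis using that[of "dist (F z) y"] z by auto
qed

text \<open>Upper semicontinuity of the content: a finite open cover of the fiber of the limit also
  covers the fibers of close maps. Asking for infinitely many \<open>n\<close> only is what suits
  the limsup of sets in \<open>closedin_good_pts\<close>.\<close>

lemma fat_limit:
  fixes F :: "'a::euclidean_space \<Rightarrow> 'b::euclidean_space"
  assumes K: "compact K" and F: "continuous_on K F"
    and \<sigma>: "\<And>n x. x \<in> K \<Longrightarrow> dist (F x) (\<sigma> n x) < 1 / Suc n"
    and inf: "\<exists>\<^sub>\<infinity>n. fat K s \<kappa> (\<sigma> n) y"
  shows "fat K s \<kappa> F y"
  unfolding fat_def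
proof (intro allI impI)
  fix P assume P: "finite P" "P \<subseteq> K \<times> {0<..1}" "{x \<in> K. F x = y} \<subseteq> (\<Union>(x, r)\<in>P. ball x r)"
  define W where "W = (\<Union>(x, r)\<in>P. ball x r)"
  have W: "open W" by (auto simp: W_def intro!: open_UN)
  have sub: "{x \<in> K. F x = y} \<subseteq> W" using P(3) by (simp add: W_def)
  obtain \<delta> where \<delta>: "0 < \<delta>" "\<And>x. x \<in> K - W \<Longrightarrow> \<delta> \<le> dist (F x) y"
    using fiber_gap[OF K F W sub] by blast
  obtain N where N: "1 / Suc N < \<delta>" using \<delta>(1) nat_approx_posE by metis
  obtain n where n: "N \<le> n" "fat K s \<kappa> (\<sigma> n) y" using inf by (auto simp: INFM_nat_le)
  have "{x \<in> K. \<sigma> n x = y} \<subseteq> W"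
  proof (rule ccontr)
    assume "\<not> ?thesis"
    then obtain x where x: "x \<in> K - W" "\<sigma> n x = y" by blast
    have "1 / Suc n \<le> 1 / Suc N" using n(1) by (simp add: frac_le)
    then show False using \<sigma>[of x n] \<delta>(2)[OF x(1)] x N by auto
  qed
  then show "\<kappa> \<le> (\<Sum>(x, r)\<in>P. dim_gauge s DIM('b) r)" using n(2) P(1,2) unfolding fat_def W_def by blast
qed

text \<open>If the \<open>t\<close>-dimensional measure vanished, a cover of small cost could be
  enlarged to open balls centered in the fiber and reduced to a finite one by compactness. Its gauge
  sum would then be below the content bound.\<close>

lemma hausdorff_dim_ge_if_fat:
  fixes F :: "'a::euclidean_space \<Rightarrow> 'b::euclidean_space"
  assumes K: "compact K" and F: "continuous_on K F" and "0 < \<kappa>" and fat: "fat K s \<kappa> F y"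
  shows "ereal s \<le> hausdorff_dim {x\<in>K. F x = y}" (is "_ \<le> hausdorff_dim ?A")
proof (rule hausdorff_dim_ge)
  show ne: "?A \<noteq> {}"
  proof
    assume "?A = {}"
    then have "\<kappa> \<le> 0" using fat unfolding fat_def by (metis (no_types, lifting) empty_subsetI finite.emptyI sum.empty)
    then show False using \<open>0 < \<kappa>\<close> by simp
  qed
  fix t assume t: "0 \<le> t" "t < s"
  show "hausdorff_measure t ?A \<noteq> 0"
  proof
    assume H0: "hausdorff_measure t ?A = 0"
    then have "t \<noteq> 0" using hausdorff_measure_0_ge_1[OF ne] by auto
    then have t: "0 < t" "t < s" using t by auto
    define c where "c = 2 powr ((real DIM('b))\<^sup>2 / (4 * (s - t)))"
    have c: "0 < c" by (simp add: c_def)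
    \<comment> \<open>The gauge sum will be at most \<open>c * (2 powr t + 1) * e\<close>, which is
      \<open>\<kappa> / 2\<close> for this \<open>e\<close>.\<close>
    define e where "e = \<kappa> / (2 * c * (2 powr t + 1))"
    have e: "0 < e" using \<open>0 < \<kappa>\<close> c unfolding e_def by (intro divide_pos_pos mult_pos_pos) (auto intro: add_pos_pos)
    \<comment> \<open>Diameters up to 1/4, enlarged by at most 1/4, keep the radii within the range
      \<open>{0<..1}\<close> of \<open>fat\<close>.\<close>
    have "hausdorff_premeasure t (1/4) ?A < ennreal e"
      using hausdorff_premeasure_le_measure[of "1/4" t ?A] H0 e by simp
    then obtain D where D: "?A \<subseteq> (\<Union>i. D i)" "\<And>i. bounded (D i)" "\<And>i. diameter (D i) \<le> 1/4"
      "(\<Sum>i::nat. diam_pow t (D i)) < ennreal e"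
      by (rule hausdorff_premeasure_cover) (rule that)
    \<comment> \<open>The increment makes each ball an open neighborhood of its set, even of a
      single point, and the powers \<open>(2 * \<epsilon> i) powr t\<close> sum to at most
      \<open>e\<close>.\<close>
    define \<epsilon> where "\<epsilon> i = min (1/4) ((e * (1/2) ^ Suc i) powr (1/t) / 2)" for i :: nat
    have \<epsilon>: "0 < \<epsilon> i" "\<epsilon> i \<le> 1/4" for i using e by (auto simp: \<epsilon>_def)
    have \<epsilon>t: "(2 * \<epsilon> i) powr t \<le> e * (1/2) ^ Suc i" for i
    proof -
      have "(2 * \<epsilon> i) powr t \<le> ((e * (1/2) ^ Suc i) powr (1/t)) powr t"
        using t \<epsilon>[of i] by (intro powr_mono2) (auto simp: \<epsilon>_def)
      also have "\<dots> = e * (1/2) ^ Suc i" using t e by (simp add: powr_powr)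
      finally show ?thesis .
    qed
    define r where "r i = diameter (D i) + \<epsilon> i" for i
    have dia: "0 \<le> diameter (D i)" for i using D(2) by (rule diameter_ge_0)
    have r: "0 < r i" "r i \<le> 1" for i using dia[of i] D(3)[of i] \<epsilon>[of i] by (auto simp: r_def)
    define I where "I = {i. D i \<inter> ?A \<noteq> {}}"
    have "\<exists>x. x \<in> D i \<inter> ?A" if "i \<in> I" for i using that by (auto simp: I_def)
    then obtain z where z: "\<And>i. i \<in> I \<Longrightarrow> z i \<in> D i \<inter> ?A" by metis
    have "closed ?A" using continuous_closed_preimage_constant[OF F compact_imp_closed[OF K], of y] by simp
    then have "compact (K \<inter> ?A)" using K by blast
    moreover have "K \<inter> ?A = ?A" by auto
    ultimately have "compact ?A" by simp
    moreover have "?A \<subseteq> (\<Union>i\<in>I. ball (z i) (r i))"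
    proof
      fix x assume x: "x \<in> ?A"
      then obtain i where i: "x \<in> D i" using D(1) by blast
      then have "i \<in> I" using x by (auto simp: I_def)
      moreover have "dist (z i) x < r i"
        using diameter_bounded_bound[OF D(2), of "z i" i x] z[OF \<open>i \<in> I\<close>] i \<epsilon>[of i] by (auto simp: r_def)
      ultimately show "x \<in> (\<Union>i\<in>I. ball (z i) (r i))" by auto
    qed
    ultimately obtain J where J: "J \<subseteq> I" "finite J" "?A \<subseteq> (\<Union>i\<in>J. ball (z i) (r i))"
      using compactE_image[of ?A I "\<lambda>i. ball (z i) (r i)"] by (metis (no_types, lifting) open_ball)
    define P where "P = (\<lambda>i. (z i, r i)) ` J"
    have "finite P" "P \<subseteq> K \<times> {0<..1}" "?A \<subseteq> (\<Union>(x, r)\<in>P. ball x r)"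
      using J z r by (auto simp: P_def)
    then have "\<kappa> \<le> (\<Sum>(x, r)\<in>P. dim_gauge s DIM('b) r)" using fat unfolding fat_def by blast
    also have "\<dots> \<le> (\<Sum>i\<in>J. dim_gauge s DIM('b) (r i))"
      unfolding P_def using sum_image_le[OF J(2), of "\<lambda>(x, r). dim_gauge s DIM('b) r" "\<lambda>i. (z i, r i)"]
      by (simp add: dim_gauge_nonneg comp_def)
    also have "\<dots> \<le> (\<Sum>i\<in>J. c * (2 powr t * diameter (D i) powr t + e * (1/2) ^ Suc i))"
    proof (rule sum_mono)
      fix i
      have "dim_gauge s DIM('b) (r i) \<le> c * r i powr t" unfolding c_def using r t by (intro dim_gauge_le_powr) auto
      also have "r i powr t \<le> (2 * diameter (D i)) powr t + (2 * \<epsilon> i) powr t"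
        unfolding r_def using dia \<epsilon>(1)[of i] t by (intro powr_add_le) auto
      also have "\<dots> \<le> 2 powr t * diameter (D i) powr t + e * (1/2) ^ Suc i"
        using \<epsilon>t[of i] dia[of i] by (simp add: powr_mult)
      finally show "dim_gauge s DIM('b) (r i) \<le> c * (2 powr t * diameter (D i) powr t + e * (1/2) ^ Suc i)"
        using c by (simp del: power_Suc)
    qed
    also have "\<dots> = c * (2 powr t * (\<Sum>i\<in>J. diameter (D i) powr t) + (\<Sum>i\<in>J. e * (1/2) ^ Suc i))"
      by (simp add: sum_distrib_left sum.distrib distrib_left)
    also have "(\<Sum>i\<in>J. diameter (D i) powr t) \<le> e"
    proof -
      have "ennreal (\<Sum>i\<in>J. diameter (D i) powr t) = (\<Sum>i\<in>J. diam_pow t (D i))"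
      proof -
        have "diam_pow t (D i) = ennreal (diameter (D i) powr t)" if "i \<in> J" for i
          using that J(1) t by (auto simp: diam_pow_def I_def)
        then show ?thesis by simp
      qed
      also have "\<dots> \<le> (\<Sum>i. diam_pow t (D i))" using J(2) by (intro sum_le_suminf) auto
      also have "\<dots> \<le> ennreal e" using D(4) by simp
      finally show ?thesis using e by simp
    qed
    also have "(\<Sum>i\<in>J. e * (1/2) ^ Suc i) \<le> e"
    proof -
      have "(\<lambda>i. e * (1/2) ^ Suc i) sums (e * 1)" by (intro sums_mult power_half_series)
      then show ?thesis using sum_le_suminf[of "\<lambda>i. e * (1/2) ^ Suc i" J] J(2) e by (simp add: sums_iff)
    qed
    finally have "\<kappa> \<le> c * (2 powr t * e + e)"
      using c by (simp add: mult_left_mono)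
    also have "\<dots> = c * (2 powr t + 1) * e" by (simp add: algebra_simps)
    also have "\<dots> = \<kappa> / 2"
      unfolding e_def using c by (simp add: field_simps add_pos_pos[THEN less_imp_neq, symmetric])
    finally show False using \<open>0 < \<kappa>\<close> by simp
  qed
qed

section \<open>Good maps as a Borel set\<close>

context frostman
begin

text \<open>The strict inequality for \<open>y\<close> survives small changes of \<open>x\<close>
  and of \<open>F\<close>; this makes the condition stable under limits in both.\<close>

definition good_pts :: "nat \<Rightarrow> ('a \<Rightarrow> 'b::euclidean_space) \<Rightarrow> 'a set" where
  "good_pts m F = {x\<in>K. \<forall>y. dist y (F x) < 1 / Suc m \<longrightarrow> fat K s (1 / Suc m) F y}"

text \<open>A quantitative form chosen for measurability: for fixed \<open>e\<close> and
  \<open>m\<close> the condition on \<open>F\<close> is closed, and only countable operations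
  remain.\<close>

definition good_maps :: "('a \<Rightarrow> 'b::euclidean_space) set" where
  "good_maps = {F \<in> topspace (C_top K). \<forall>e::nat. \<exists>m. 1 - 1 / Suc e \<le> prob (good_pts m F)}"

lemma good_pts_closed:
  fixes F :: "'a \<Rightarrow> 'b::euclidean_space"
  assumes "continuous_on K F"
  shows "closed (good_pts m F)"
  unfolding closed_sequential_limits
proof (intro allI impI, elim conjE)
  fix x l assume x: "\<forall>n. x n \<in> good_pts m F" and l: "x \<longlonglongrightarrow> l"
  have xK: "x n \<in> K" for n using x by (auto simp: good_pts_def)
  have lK: "l \<in> K" using closed_sequentially[OF compact_imp_closed[OF compact_K] _ l] xK by blast
  have lim: "(\<lambda>n. F (x n)) \<longlonglongrightarrow> F l"
    using continuous_on_tendsto_compose[OF assms l lK] xK by auto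
  have "fat K s (1 / Suc m) F y" if "dist y (F l) < 1 / Suc m" for y
  proof -
    have "(\<lambda>n. dist y (F (x n))) \<longlonglongrightarrow> dist y (F l)" by (intro tendsto_intros lim)
    then have "\<forall>\<^sub>F n in sequentially. dist y (F (x n)) < 1 / Suc m" using that by (rule order_tendstoD)
    from eventually_happens'[OF sequentially_bot this] obtain n where "dist y (F (x n)) < 1 / Suc m" ..
    then show ?thesis using x by (auto simp: good_pts_def)
  qed
  then show "l \<in> good_pts m F" using lK by (simp add: good_pts_def)
qed

lemma good_pts_sets: "continuous_on K F \<Longrightarrow> good_pts m F \<in> sets borel"
  by (simp add: good_pts_closed)

text \<open>A point that is good for infinitely many \<open>\<sigma> n\<close> is good for their
  uniform limit, and a limsup of sets of mass at least \<open>a\<close> has mass at least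
  \<open>a\<close>.\<close>

lemma closedin_good_pts:
  "closedin (C_top K) {F \<in> topspace (C_top K). a \<le> prob (good_pts m (F :: 'a \<Rightarrow> 'b::euclidean_space))}"
proof (rule closedin_C_topI[OF compact_K K_ne])
  fix F :: "'a \<Rightarrow> 'b" and \<sigma>
  assume F: "F \<in> topspace (C_top K)"
    and S: "\<And>n. \<sigma> n \<in> {F \<in> topspace (C_top K). a \<le> prob (good_pts m F)}"
    and \<sigma>: "\<And>n x. x \<in> K \<Longrightarrow> dist (F x) (\<sigma> n x) < 1 / Suc n"
  have cont: "continuous_on K F" "continuous_on K (\<sigma> n)" for n
    using F S[of n] by (auto simp: topspace_C_top compact_K)
  define A where "A n = good_pts m (\<sigma> n)" for n
  define L where "L N = (\<Union>n\<in>{N..}. A n)" for N :: nat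
  have Am: "A n \<in> sets borel" for n unfolding A_def by (rule good_pts_sets[OF cont(2)])
  have Lm: "L N \<in> sets borel" for N unfolding L_def using Am by (intro sets.countable_UN') auto
  have "(\<Inter>N. L N) \<subseteq> good_pts m F"
  proof
    fix x assume x: "x \<in> (\<Inter>N. L N)"
    then have inf: "\<exists>\<^sub>\<infinity>n. x \<in> A n" by (auto simp: L_def INFM_nat_le)
    then have xK: "x \<in> K" by (auto simp: A_def good_pts_def INFM_nat_le)
    have "fat K s (1 / Suc m) F y" if y: "dist y (F x) < 1 / Suc m" for y
    proof (rule fat_limit[OF compact_K cont(1) \<sigma>])
      obtain N where N: "1 / Suc N < 1 / Suc m - dist y (F x)" using y nat_approx_posE[of "1 / Suc m - dist y (F x)"] by auto
      have "dist y (\<sigma> n x) < 1 / Suc m" if "N \<le> n" for n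
      proof -
        have "1 / Suc n \<le> 1 / Suc N" using that by (simp add: frac_le)
        then show ?thesis using dist_triangle[of y "\<sigma> n x" "F x"] \<sigma>[OF xK, of n] N by linarith
      qed
      then have "fat K s (1 / Suc m) (\<sigma> n) y" if "N \<le> n" "x \<in> A n" for n
        using that by (auto simp: A_def good_pts_def)
      then show "\<exists>\<^sub>\<infinity>n. fat K s (1 / Suc m) (\<sigma> n) y"
        using inf unfolding INFM_nat_le by (metis linear order_trans)
    qed
    then show "x \<in> good_pts m F" using xK by (simp add: good_pts_def)
  qed
  then have le: "prob (\<Inter>N. L N) \<le> prob (good_pts m F)"
    by (intro finite_measure_mono) (auto simp: good_pts_sets cont)
  have "(\<lambda>N. prob (L N)) \<longlonglongrightarrow> prob (\<Inter>N. L N)"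

  proof (rule finite_Lim_measure_decseq)
    show "decseq L" unfolding decseq_def L_def by (intro allI impI UN_mono) auto
  qed (use Lm in auto)
  moreover have "a \<le> prob (L N)" for N
  proof -
    have "a \<le> prob (A N)" using S[of N] by (simp add: A_def)
    also have "\<dots> \<le> prob (L N)" using Lm by (intro finite_measure_mono) (auto simp: L_def)
    finally show ?thesis .
  qed
  ultimately have "a \<le> prob (\<Inter>N. L N)" by (intro LIMSEQ_le_const) auto
  then show "F \<in> {F \<in> topspace (C_top K). a \<le> prob (good_pts m F)}" using le F by simp
qed auto

lemma good_maps_borel: "(good_maps :: ('a \<Rightarrow> 'b::euclidean_space) set) \<in> sets (borel_of (C_top K))"
proof -
  have "good_maps = (\<Inter>e::nat. \<Union>m. {F \<in> topspace (C_top K). 1 - 1 / Suc e \<le> prob (good_pts m (F :: 'a \<Rightarrow> 'b))})"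
    unfolding good_maps_def by auto
  also have "\<dots> \<in> sets (borel_of (C_top K))"
  proof (rule sets.countable_INT, rule image_subsetI, rule sets.countable_UN, rule image_subsetI)
    show "{F \<in> topspace (C_top K). 1 - 1 / Suc e \<le> prob (good_pts m (F :: 'a \<Rightarrow> 'b))} \<in> sets (borel_of (C_top K))"
      for e m :: nat
      by (rule closedin_in_borel_of[OF closedin_good_pts])
  qed simp
  finally show ?thesis .
qed

text \<open>\<open>U\<close> is the interior of the set of values with large fibers. Every good
  point is mapped into it, since a whole ball about its image consists of such values.\<close>

lemma good_maps_open_set:
  fixes F :: "'a \<Rightarrow> 'b::euclidean_space"
  assumes "F \<in> good_maps"
  obtains U where "open U" "prob (K \<inter> F -` U) = 1" "closed (K - F -` U)"
    "\<And>y. y \<in> U \<Longrightarrow> ereal s \<le> hausdorff_dim {x\<in>K. F x = y}"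
proof -
  have cont: "continuous_on K F" using assms by (auto simp: good_maps_def topspace_C_top compact_K)
  define U where "U = interior {y. ereal s \<le> hausdorff_dim {x\<in>K. F x = y}}"
  have "open U" by (simp add: U_def)
  have "closed (K \<inter> F -` (- U))"
    using cont compact_K \<open>open U\<close> by (intro continuous_closed_preimage) (auto simp: compact_imp_closed)
  moreover have "K \<inter> F -` (- U) = K - F -` U" by auto
  ultimately have cl: "closed (K - F -` U)" by simp
  have "K \<inter> F -` U = K - (K - F -` U)" by auto
  then have meas: "K \<inter> F -` U \<in> sets borel" using cl compact_K by (metis borel_closed borel_compact sets.Diff)
  have sub: "good_pts m F \<subseteq> K \<inter> F -` U" for m
  proof
    fix x assume x: "x \<in> good_pts m F"
    have "ball (F x) (1 / Suc m) \<subseteq> {y. ereal s \<le> hausdorff_dim {x\<in>K. F x = y}}"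
    proof
      fix y assume "y \<in> ball (F x) (1 / Suc m)"
      then have "fat K s (1 / Suc m) F y" using x by (auto simp: good_pts_def dist_commute)
      from hausdorff_dim_ge_if_fat[OF compact_K cont _ this]
      show "y \<in> {y. ereal s \<le> hausdorff_dim {x\<in>K. F x = y}}" by simp
    qed
    then have "F x \<in> U" unfolding U_def by (rule interiorI[rotated 2]) auto
    then show "x \<in> K \<inter> F -` U" using x by (simp add: good_pts_def)
  qed
  have "1 - 1 / Suc e \<le> prob (K \<inter> F -` U)" for e :: nat
  proof -
    obtain m where "1 - 1 / Suc e \<le> prob (good_pts m F)" using assms by (auto simp: good_maps_def)
    also have "\<dots> \<le> prob (K \<inter> F -` U)" using sub meas by (intro finite_measure_mono) auto
    finally show ?thesis .
  qed
  moreover have "(\<lambda>e::nat. 1 - 1 / Suc e) \<longlonglongrightarrow> 1 - 0"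
    using tendsto_diff[OF tendsto_const LIMSEQ_inverse_real_of_nat] by (simp only: inverse_eq_divide)
  ultimately have "1 \<le> prob (K \<inter> F -` U)" by (intro LIMSEQ_le_const2[of _ 1]) auto
  then have "prob (K \<inter> F -` U) = 1" by (simp add: order_antisym)
  then show ?thesis
  proof (rule that[OF \<open>open U\<close> _ cl])
    fix y assume "y \<in> U"
    then show "ereal s \<le> hausdorff_dim {x\<in>K. F x = y}" using interior_subset unfolding U_def by blast
  qed
qed

end

section \<open>Convergence of the occupation densities\<close>

lemma psi_ge:
  fixes v :: "'b::euclidean_space"
  assumes "\<And>b. b \<in> Basis \<Longrightarrow> \<bar>v \<bullet> b\<bar> \<le> (1/2) ^ Suc i"
  shows "2 ^ (i * DIM('b)) / 2 ^ DIM('b) \<le> psi i v"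
proof -
  have "(\<Prod>b\<in>(Basis::'b set). 1/2) \<le> (\<Prod>b\<in>Basis. hat (2 ^ i * (v \<bullet> b)))"
  proof (rule prod_mono, safe)
    fix b :: 'b assume "b \<in> Basis"
    then have "2 ^ i * \<bar>v \<bullet> b\<bar> \<le> 2 ^ i * (1/2) ^ Suc i" using assms by (intro mult_left_mono) auto
    also have "2 ^ i * (1/2) ^ Suc i = (1/2 :: real)" by (simp add: power_divide)
    finally have "\<bar>2 ^ i * (v \<bullet> b)\<bar> \<le> 1/2" by (simp add: abs_mult)
    then show "1/2 \<le> hat (2 ^ i * (v \<bullet> b))" by (auto simp: hat_def)
  qed simp
  then have "2 ^ (i * DIM('b)) * (1/2) ^ DIM('b) \<le> psi i v" unfolding psi_eq by (intro mult_left_mono) auto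
  then show ?thesis by (simp add: power_divide)
qed

text \<open>The points have coordinates in the multiples of \<open>2 ^ -i\<close>, and rounding
  moves a coordinate by at most half the spacing. The order \<open>2 ^ (i * d)\<close> of the
  cardinality later cancels the mass bound per cube.\<close>

lemma lattice_cover:
  fixes B :: real
  assumes "0 \<le> B"
  obtains Y :: "'b::euclidean_space set" where "finite Y" "card Y \<le> (2 ^ i * (2 * B + 3)) ^ DIM('b)"
    "\<And>z. norm z \<le> B \<Longrightarrow> \<exists>y\<in>Y. \<forall>b\<in>Basis. \<bar>(y - z) \<bullet> b\<bar> \<le> (1/2) ^ Suc i"
proof -
  define R where "R = \<lceil>B * 2 ^ i\<rceil>"
  have R: "0 \<le> R" "B * 2 ^ i \<le> R" "R < B * 2 ^ i + 1"
  proof -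
    have "0 \<le> B * 2 ^ i" using assms by simp
    then show "0 \<le> R" "B * 2 ^ i \<le> R" "R < B * 2 ^ i + 1"
      using ceiling_correct[of "B * 2 ^ i"] unfolding R_def by linarith+
  qed
  define pt where "pt k = (\<Sum>b\<in>Basis. (of_int (k b) / 2 ^ i) *\<^sub>R b)" for k :: "'b \<Rightarrow> int"
  define Y where "Y = pt ` (Basis \<rightarrow>\<^sub>E {-R..R})"
  have fin: "finite (Basis \<rightarrow>\<^sub>E {-R..R} :: ('b \<Rightarrow> int) set)" by (intro finite_PiE) auto
  have "card Y \<le> card (Basis \<rightarrow>\<^sub>E {-R..R} :: ('b \<Rightarrow> int) set)" unfolding Y_def by (rule card_image_le[OF fin])
  also have "\<dots> = nat (2 * R + 1) ^ DIM('b)" by (simp add: card_PiE)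
  finally have "real (card Y) \<le> real (nat (2 * R + 1)) ^ DIM('b)" by (metis of_nat_le_iff of_nat_power)
  also have "\<dots> \<le> (2 ^ i * (2 * B + 3)) ^ DIM('b)"
  proof (rule power_mono)
    have "real (nat (2 * R + 1)) = 2 * of_int R + 1" using R by simp
    also have "\<dots> \<le> 2 * (B * 2 ^ i) + 3" using R by simp
    also have "\<dots> \<le> 2 * (B * 2 ^ i) + 3 * 2 ^ i" by simp
    finally show "real (nat (2 * R + 1)) \<le> 2 ^ i * (2 * B + 3)" by (simp add: algebra_simps)
  qed simp
  finally have card: "real (card Y) \<le> (2 ^ i * (2 * B + 3)) ^ DIM('b)" .
  have "\<exists>y\<in>Y. \<forall>b\<in>Basis. \<bar>(y - z) \<bullet> b\<bar> \<le> (1/2) ^ Suc i" if z: "norm z \<le> B" for z :: 'b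
  proof
    define k where "k = restrict (\<lambda>b. round (2 ^ i * (z \<bullet> b))) Basis"
    have "k b \<in> {-R..R}" if "b \<in> Basis" for b
    proof -
      have "\<bar>z \<bullet> b\<bar> \<le> B" using Basis_le_norm[OF that, of z] z by simp
      then have "2 ^ i * \<bar>z \<bullet> b\<bar> \<le> 2 ^ i * B" by (intro mult_left_mono) auto
      moreover have "\<bar>2 ^ i * (z \<bullet> b)\<bar> = 2 ^ i * \<bar>z \<bullet> b\<bar>" by (simp add: abs_mult)
      moreover have "2 ^ i * B = B * 2 ^ i" by (rule mult.commute)
      ultimately have "\<bar>2 ^ i * (z \<bullet> b)\<bar> \<le> of_int R" using R(2) by linarith
      then have *: "- of_int R \<le> 2 ^ i * (z \<bullet> b)" "2 ^ i * (z \<bullet> b) \<le> of_int R" by auto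
      note round_mono[OF *(1)] round_mono[OF *(2)]
      then show ?thesis using that round_of_int[of "-R", where 'a = real] by (simp add: k_def)
    qed
    then show "pt k \<in> Y" unfolding Y_def by (intro imageI) (auto simp: k_def)
    show "\<forall>b\<in>Basis. \<bar>(pt k - z) \<bullet> b\<bar> \<le> (1/2) ^ Suc i"
    proof
      fix b :: 'b assume b: "b \<in> Basis"
      have "pt k \<bullet> b = of_int (k b) / 2 ^ i"
        using b by (simp add: pt_def inner_sum_left inner_Basis if_distrib sum.delta cong: if_cong)
      then have "(pt k - z) \<bullet> b = (of_int (round (2 ^ i * (z \<bullet> b))) - 2 ^ i * (z \<bullet> b)) / 2 ^ i"
        using b by (simp add: k_def inner_diff_left field_simps)
      also have "\<bar>\<dots>\<bar> \<le> (1/2) / 2 ^ i"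
      proof -
        have "\<bar>of_int (round (2 ^ i * (z \<bullet> b))) - 2 ^ i * (z \<bullet> b)\<bar> \<le> 1/2" by (rule of_int_round_abs_le)
        from divide_right_mono[OF this, of "2 ^ i"] show ?thesis by (simp only: abs_divide power_abs abs_numeral zero_le_power zero_le_numeral)
      qed
      finally show "\<bar>(pt k - z) \<bullet> b\<bar> \<le> (1/2) ^ Suc i" by (simp add: power_divide)
    qed
  qed
  then show ?thesis using that[of Y] fin card by (auto simp: Y_def)
qed

lemma suminf_tail_norm_le:
  fixes g :: "nat \<Rightarrow> 'b::euclidean_space"
  assumes "\<And>j. norm (g j) \<le> D * (1/2) ^ Suc j"
  shows "summable g" "norm (suminf g - (\<Sum>i<j. g i)) \<le> D * (1/2) ^ j"
proof -
  have sm: "summable (\<lambda>j. D * (1/2) ^ Suc j)" using power_half_series by (intro summable_mult) (rule sums_summable)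
  show s: "summable g" by (rule summable_comparison_test'[OF sm, of 0]) (use assms in auto)
  have half: "(\<lambda>i. D * (1/2) ^ j * (1/2) ^ Suc i) sums (D * (1/2) ^ j * 1)" by (rule sums_mult) (rule power_half_series)
  have "suminf g - (\<Sum>i<j. g i) = (\<Sum>i. g (i + j))" using suminf_split_initial_segment[OF s, of j] by simp
  also have "norm \<dots> \<le> (\<Sum>i. D * (1/2) ^ j * (1/2) ^ Suc i)"
  proof (rule norm_suminf_le)
    show "norm (g (i + j)) \<le> D * (1/2) ^ j * (1/2) ^ Suc i" for i
      using assms[of "i + j"] by (simp add: power_add algebra_simps)
  qed (use half in \<open>auto simp: sums_iff\<close>)
  finally show "norm (suminf g - (\<Sum>i<j. g i)) \<le> D * (1/2) ^ j" using half by (simp add: sums_iff)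
qed

lemma norm_sum_half_pow_le:
  fixes g :: "nat \<Rightarrow> 'b::real_normed_vector"
  assumes "\<And>j. norm (g j) \<le> D * (1/2) ^ Suc j" "0 \<le> D"
  shows "norm (\<Sum>i<j. g i) \<le> D"
proof -
  have "norm (\<Sum>i<j. g i) \<le> (\<Sum>i<j. D * (1/2) ^ Suc i)"
    by (intro order_trans[OF norm_sum] sum_mono assms)
  also have "\<dots> \<le> D * 1"
    using sum_le_suminf[OF sums_summable[OF power_half_series], of "{..<j}"] power_half_series assms(2)
    unfolding sum_distrib_left[symmetric] by (intro mult_left_mono) (auto simp: sums_iff)
  finally show ?thesis by simp
qed

lemma continuous_on_suminf_half_pow:
  fixes g :: "nat \<Rightarrow> 'a::topological_space \<Rightarrow> 'b::euclidean_space"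
  assumes "\<And>j. continuous_on UNIV (g j)" "\<And>j x. norm (g j x) \<le> D * (1/2) ^ Suc j"
  shows "continuous_on UNIV (\<lambda>x. \<Sum>j. g j x)"
proof (rule uniform_limit_theorem)
  have "summable (\<lambda>j. D * (1/2) ^ Suc j)" by (intro summable_mult sums_summable[OF power_half_series])
  then show "uniform_limit UNIV (\<lambda>n x. \<Sum>j<n. g j x) (\<lambda>x. \<Sum>j. g j x) sequentially"
    by (rule Weierstrass_m_test[OF assms(2)])
  show "\<forall>\<^sub>F n in sequentially. continuous_on UNIV (\<lambda>x. \<Sum>j<n. g j x)"
    by (intro always_eventually allI continuous_on_sum assms(1))
qed simp

lemma half_pow_less:
  assumes "0 < (e::real)"
  shows "\<exists>n. \<forall>j\<ge>n. c * (1/2) ^ j < e"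
proof -
  have "(\<lambda>j. c * (1/2 :: real) ^ j) \<longlonglongrightarrow> 0" by (intro tendsto_mult_right_zero LIMSEQ_realpow_zero) auto
  from order_tendstoD(2)[OF this assms] show ?thesis by (simp only: eventually_sequentially)
qed

section \<open>Test sets and tolerances\<close>

context frostman
begin

definition net :: "nat \<Rightarrow> 'a set" where
  "net i = (SOME X. finite X \<and> K \<subseteq> (\<Union>x\<in>X. ball x ((1/2) ^ i)))"

lemma net: "finite (net i)" "K \<subseteq> (\<Union>x\<in>net i. ball x ((1/2) ^ i))"
proof -
  have "\<exists>X. finite X \<and> K \<subseteq> (\<Union>x\<in>X. ball x ((1/2) ^ i))"
    using compact_K compact_eq_totally_bounded[of K] by (metis half_gt_zero_iff zero_less_one zero_less_power divide_pos_pos zero_less_numeral)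
  from someI_ex[OF this] show "finite (net i)" "K \<subseteq> (\<Union>x\<in>net i. ball x ((1/2) ^ i))"
    unfolding net_def by auto
qed

text \<open>Sets of diameter about \<open>2 ^ -i\<close> are tested from level \<open>sqrt i\<close> on, so that the trivial bound
  \<open>2 ^ (j * d) * prob E\<close> at that level costs only a subpolynomial factor.\<close>

definition tests :: "nat \<Rightarrow> 'a set set" where
  "tests j = insert UNIV (\<Union>i\<in>{..j\<^sup>2}. (\<lambda>e. cball e (2 * (1/2) ^ i)) ` net i)"

lemma finite_tests: "finite (tests j)" and tests_borel: "E \<in> tests j \<Longrightarrow> E \<in> sets borel"
  using net(1) by (auto simp: tests_def)

lemma tests_mono:
  assumes "i \<le> j" shows "tests i \<subseteq> tests j"
proof -
  define X where "X i = (\<lambda>e. cball e (2 * (1/2 :: real) ^ i)) ` net i" for i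
  have tests: "tests k = insert UNIV (\<Union>i\<in>{..k\<^sup>2}. X i)" for k by (simp add: tests_def X_def)
  have "i\<^sup>2 \<le> j\<^sup>2" using assms by (rule power_mono) simp
  show ?thesis
  proof
    fix E assume "E \<in> tests i"
    then consider "E = UNIV" | k where "k \<le> i\<^sup>2" "E \<in> X k" unfolding tests by auto
    then show "E \<in> tests j"
    proof cases
      case 2
      then have "k \<le> j\<^sup>2" using \<open>i\<^sup>2 \<le> j\<^sup>2\<close> by (rule_tac order_trans)
      then show ?thesis using 2 unfolding tests by blast
    qed (simp add: tests)
  qed
qed

text \<open>The first factor is summable. The second has the order of the mass bound for the
  smallest test balls of level \<open>j\<close>, so that the accumulated error does not exceed what
  such a ball is allowed.\<close>

definition tol :: "nat \<Rightarrow> real" where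
  "tol j = (1/2) ^ Suc j * 2 powr (- (real j)\<^sup>2 * s)"

lemma tol_pos: "0 < tol j" by (simp add: tol_def)

end

text \<open>One outcome of the random series, with the closeness of successive densities from level
  \<open>J\<close> on as an assumption; all arguments here are deterministic.\<close>

locale frostman_series = frostman \<mu> K s C for \<mu> :: "'a::euclidean_space measure" and K s C +
  fixes f :: "'a \<Rightarrow> 'b::euclidean_space" and g :: "nat \<Rightarrow> 'a \<Rightarrow> 'b" and J :: nat
  assumes cont_f: "continuous_on UNIV f" and cont_g: "\<And>j. continuous_on UNIV (g j)"
    and norm_g: "\<And>j x. norm (g j x) \<le> DIM('b) * (1/2) ^ Suc j"
    and step: "\<And>j E y. J \<le> j \<Longrightarrow> E \<in> tests j \<Longrightarrow>
      \<bar>dens (Suc j) E (\<lambda>x. f x + (\<Sum>i<Suc j. g i x)) y - dens j E (\<lambda>x. f x + (\<Sum>i<j. g i x)) y\<bar> \<le> tol j"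
begin

definition partial :: "nat \<Rightarrow> 'a \<Rightarrow> 'b" where "partial j x = f x + (\<Sum>i<j. g i x)"

definition limit_map :: "'a \<Rightarrow> 'b" where "limit_map x = f x + (\<Sum>i. g i x)"

lemma continuous_partial: "continuous_on UNIV (partial j)"
  unfolding partial_def by (intro continuous_intros cont_f cont_g)

lemma partial_measurable [measurable]: "partial j \<in> borel_measurable borel"
  by (rule borel_measurable_continuous_onI[OF continuous_partial])

lemma limit_map_partial: "norm (limit_map x - partial j x) \<le> DIM('b) * (1/2) ^ j"
  using suminf_tail_norm_le(2)[of "\<lambda>i. g i x" "DIM('b)" j] norm_g by (simp add: limit_map_def partial_def)

lemma continuous_limit_map: "continuous_on UNIV limit_map"
  unfolding limit_map_def by (intro continuous_on_add cont_f continuous_on_suminf_half_pow[OF cont_g norm_g])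

lemma step_partial:
  "J \<le> j \<Longrightarrow> E \<in> tests j \<Longrightarrow> \<bar>dens (Suc j) E (partial (Suc j)) y - dens j E (partial j) y\<bar> \<le> tol j"
  using step unfolding partial_def by blast

text \<open>A test stays a test at later levels, so the tolerances add up. The subtracted
  \<open>(1/2) ^ j\<close> is the tail not yet used, which makes the induction work.\<close>

lemma dens_telescope:
  assumes "J \<le> i" "E \<in> tests i" "i \<le> j"
  shows "\<bar>dens j E (partial j) y - dens i E (partial i) y\<bar> \<le> 2 powr (- (real i)\<^sup>2 * s) * ((1/2) ^ i - (1/2) ^ j)"
  using assms(3)
proof (induction j rule: dec_induct)
  case (step j)
  have "\<bar>dens (Suc j) E (partial (Suc j)) y - dens j E (partial j) y\<bar> \<le> tol j"
    using step assms tests_mono by (intro step_partial) auto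
  also have "\<dots> \<le> (1/2) ^ Suc j * 2 powr (- (real i)\<^sup>2 * s)"
    unfolding tol_def using step s_pos by (intro mult_left_mono) (auto intro!: mult_right_mono power_mono)
  finally have "\<bar>dens (Suc j) E (partial (Suc j)) y - dens i E (partial i) y\<bar>
      \<le> (1/2) ^ Suc j * 2 powr (- (real i)\<^sup>2 * s) + 2 powr (- (real i)\<^sup>2 * s) * ((1/2) ^ i - (1/2) ^ j)"
    using step.IH by linarith
  also have "\<dots> = 2 powr (- (real i)\<^sup>2 * s) * ((1/2) ^ i - (1/2) ^ Suc j)" by (simp add: algebra_simps)
  finally show ?case .
qed simp

lemma dens_telescope':
  assumes "J \<le> i" "E \<in> tests i" "i \<le> j"
  shows "\<bar>dens j E (partial j) y - dens i E (partial i) y\<bar> \<le> 2 powr (- (real i)\<^sup>2 * s) * (1/2) ^ i"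
  by (rule order_trans[OF dens_telescope[OF assms]]) (auto intro!: mult_left_mono)

text \<open>\<open>C * 4 powr s\<close> is due to a test ball of radius at most
  \<open>4 * r\<close>, the summand 1 to the telescoping error, and the power of 2 to starting no
  earlier than level \<open>J\<close> and to rounding up the square root.\<close>

definition M :: real where "M = (C * 4 powr s + 1) * 2 ^ (Suc J * DIM('b))"

lemma M_pos: "0 < M" unfolding M_def using C_pos by (intro mult_pos_pos add_nonneg_pos) auto

text \<open>The ball lies in a test ball \<open>E\<close> of comparable radius. At level
  \<open>i0\<close>, where \<open>E\<close> is already tested, its density is bounded through its
  mass; telescoping carries this to all later levels.\<close>

lemma dens_ball_le:
  assumes x: "x \<in> K" and r: "0 < r" "r \<le> 1"
  shows "\<exists>j0. \<forall>j\<ge>j0. \<forall>y. dens j (ball x r) (partial j) y \<le> M * dim_gauge s DIM('b) r"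
proof -
  define L where "L = log 2 (1 / r)"
  have L: "0 \<le> L" using r by (simp add: L_def)
  have rL: "r = 2 powr (- L)" using r by (simp add: L_def powr_minus log_divide)
  \<comment> \<open>Rounding up gives \<open>i \<le> L \<le> l\<^sup>2\<close> for the scale
    \<open>i\<close> below, so that \<open>E\<close> belongs to \<open>tests l\<close>.\<close>
  define l where "l = nat \<lceil>sqrt L\<rceil>"
  have l1: "sqrt L \<le> l" "l \<le> sqrt L + 1"
  proof -
    have "real l = of_int \<lceil>sqrt L\<rceil>" using L by (simp add: l_def)
    then show "sqrt L \<le> l" "l \<le> sqrt L + 1" using ceiling_correct[of "sqrt L"] by linarith+
  qed
  have "(sqrt L)\<^sup>2 \<le> (real l)\<^sup>2" using l1 L by (intro power_mono) auto
  then have l2: "L \<le> (real l)\<^sup>2" using L by simp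
  \<comment> \<open>The dyadic scale of the ball:
    \<open>r \<le> (1/2) ^ i \<le> 2 * r\<close>.\<close>
  define i where "i = nat \<lfloor>L\<rfloor>"
  have i: "i \<le> L" "L < i + 1" using L unfolding i_def by linarith+
  have "real i \<le> (real l)\<^sup>2" using i l2 by linarith
  then have il: "i \<le> l\<^sup>2" by (metis of_nat_le_iff of_nat_power)
  have half: "(1/2) ^ i = 2 powr (- real i)" by (simp add: powr_minus powr_realpow power_divide inverse_eq_divide)
  have ri: "r \<le> (1/2) ^ i" unfolding half rL using i by simp
  have "2 powr (- real i) \<le> 2 powr (1 - L)" using i by simp
  also have "\<dots> = 2 * r" unfolding rL by (simp add: powr_diff powr_minus divide_inverse)
  finally have ir: "(1/2) ^ i \<le> 2 * r" unfolding half .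
  obtain e where e: "e \<in> net i" "dist e x < (1/2) ^ i" using net(2)[of i] x by auto
  define E where "E = cball e (2 * (1/2) ^ i)"
  have sub: "ball x r \<subseteq> E"
  proof
    fix z assume "z \<in> ball x r"
    then show "z \<in> E" using dist_triangle[of e z x] e ri by (auto simp: E_def)
  qed
  define i0 where "i0 = max l J"
  have "l\<^sup>2 \<le> i0\<^sup>2" by (rule power_mono) (auto simp: i0_def)
  with il have "i \<le> i0\<^sup>2" by (rule order_trans)
  then have E: "E \<in> tests i0" using e unfolding tests_def E_def by auto
  have [measurable]: "E \<in> sets borel" by (rule tests_borel[OF E])
  have rs: "r powr s = 2 powr (- L * s)" by (subst rL) (simp add: powr_powr)
  have "(real l)\<^sup>2 \<le> (real i0)\<^sup>2" by (rule power_mono) (auto simp: i0_def)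
  with l2 have "L \<le> (real i0)\<^sup>2" by (rule order_trans)
  then have "L * s \<le> (real i0)\<^sup>2 * s" using s_pos by (rule_tac mult_right_mono) auto
  then have err: "2 powr (- (real i0)\<^sup>2 * s) * (1/2) ^ i0 \<le> r powr s"
    unfolding rs by (intro order_trans[OF mult_left_le]) (auto simp: power_le_one)
  \<comment> \<open>Here the subpolynomial factor of the gauge arises: \<open>i0\<close> exceeds
    \<open>sqrt L\<close> by at most \<open>Suc J\<close>.\<close>
  have G: "2 ^ (i0 * DIM('b)) * r powr s \<le> 2 ^ (Suc J * DIM('b)) * dim_gauge s DIM('b) r"
  proof -
    have "real i0 \<le> real (Suc J) + sqrt L" using l1 L by (auto simp: i0_def max_def)
    then have "real i0 * DIM('b) \<le> (real (Suc J) + sqrt L) * DIM('b)" by (rule mult_right_mono) simp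
    then have "2 powr (real i0 * DIM('b)) \<le> 2 powr (real (Suc J) * DIM('b) + DIM('b) * sqrt L)" by (simp add: algebra_simps)
    also have "\<dots> = 2 powr (real (Suc J) * DIM('b)) * 2 powr (DIM('b) * sqrt L)" by (rule powr_add)
    finally have "2 ^ (i0 * DIM('b)) \<le> 2 ^ (Suc J * DIM('b)) * 2 powr (DIM('b) * sqrt L)"
      using powr_realpow[of 2 "i0 * DIM('b)"] powr_realpow[of 2 "Suc J * DIM('b)"] by (simp only: of_nat_mult zero_less_numeral)
    then have "2 ^ (i0 * DIM('b)) * r powr s \<le> 2 ^ (Suc J * DIM('b)) * 2 powr (DIM('b) * sqrt L) * r powr s"
      by (rule mult_right_mono) simp
    then show ?thesis by (simp only: dim_gauge_def L_def[symmetric] mult.assoc mult.commute mult.left_commute)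
  qed
  have one: "1 \<le> (2::real) ^ (i0 * DIM('b))" by simp
  show ?thesis
  proof (intro exI[of _ i0] allI impI)
    fix j y assume j: "i0 \<le> j"
    have "dens j (ball x r) (partial j) y \<le> dens j E (partial j) y"
      using sub by (intro dens_mono) auto
    also have "\<dots> \<le> dens i0 E (partial i0) y + r powr s"
      using dens_telescope'[OF _ E j, of y] err by (auto simp: i0_def)
    also have "dens i0 E (partial i0) y \<le> 2 ^ (i0 * DIM('b)) * prob E" by (rule dens_le) auto
    also have "prob E \<le> C * (4 * r) powr s"
    proof -
      have "prob E \<le> C * (2 * (1/2) ^ i) powr s" unfolding E_def by (rule prob_cball_le) simp
      also have "\<dots> \<le> C * (4 * r) powr s" using C_pos ir s_pos by (intro mult_left_mono powr_mono2) auto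
      finally show ?thesis .
    qed
    also have "2 ^ (i0 * DIM('b)) * (C * (4 * r) powr s) + r powr s
       \<le> 2 ^ (i0 * DIM('b)) * (C * (4 * r) powr s) + 2 ^ (i0 * DIM('b)) * r powr s"
      using mult_right_mono[OF one, of "r powr s"] by simp
    also have "\<dots> = (C * 4 powr s + 1) * (2 ^ (i0 * DIM('b)) * r powr s)"
      using r by (simp add: powr_mult algebra_simps)
    also have "\<dots> \<le> (C * 4 powr s + 1) * (2 ^ (Suc J * DIM('b)) * dim_gauge s DIM('b) r)"
      using C_pos by (intro mult_left_mono G) auto
    also have "\<dots> = M * dim_gauge s DIM('b) r" by (simp add: M_def)
    finally show "dens j (ball x r) (partial j) y \<le> M * dim_gauge s DIM('b) r" by simp
  qed
qed

lemma AE_K: "AE x in \<mu>. x \<in> K"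
  using prob_K compact_K by (subst prob_eq_1[symmetric]) (auto simp: borel_compact)

text \<open>At a late level every point of \<open>K\<close> that contributes to the density at
  \<open>y\<close> is mapped close to \<open>y\<close> by the limit, hence lies in the given cover
  of the fiber. So the densities of the covering balls add up to at least \<open>\<kappa>\<close>,
  and each is bounded by the gauge.\<close>

lemma fat_limit_map:
  assumes \<kappa>: "\<And>j. j0 \<le> j \<Longrightarrow> \<kappa> \<le> dens j UNIV (partial j) y"
  shows "fat K s (\<kappa> / M) limit_map y"
  unfolding fat_def
proof (intro allI impI)
  fix P :: "('a \<times> real) set"
  assume P: "finite P" "P \<subseteq> K \<times> {0<..1}" "{x \<in> K. limit_map x = y} \<subseteq> (\<Union>(x, r)\<in>P. ball x r)"
  define W where "W = (\<Union>(x, r)\<in>P. ball x r)"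
  have 1: "open W" by (auto simp: W_def intro!: open_UN)
  have 2: "{x \<in> K. limit_map x = y} \<subseteq> W" using P(3) by (simp add: W_def)
  have 3: "continuous_on K limit_map" using continuous_limit_map by (rule continuous_on_subset) simp
  obtain \<delta> where \<delta>: "0 < \<delta>" "\<And>x. x \<in> K - W \<Longrightarrow> \<delta> \<le> dist (limit_map x) y"
    using fiber_gap[OF compact_K 3 1 2] by blast
  have "\<forall>p\<in>P. \<exists>j1. \<forall>j\<ge>j1. \<forall>y. dens j (ball (fst p) (snd p)) (partial j) y \<le> M * dim_gauge s DIM('b) (snd p)"
    using P(2) by (intro ballI dens_ball_le) auto
  from bchoice[OF this] obtain j1 where
    j1: "\<forall>p\<in>P. \<forall>j\<ge>j1 p. \<forall>y. dens j (ball (fst p) (snd p)) (partial j) y \<le> M * dim_gauge s DIM('b) (snd p)"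
    by blast
  \<comment> \<open>The factor 2 accounts for the support of \<open>psi j\<close> and for the
    distance of \<open>limit_map\<close> from \<open>partial j\<close>.\<close>
  obtain j2 where j2: "\<And>j. j2 \<le> j \<Longrightarrow> 2 * real DIM('b) * (1/2) ^ j < \<delta>"
    using half_pow_less[OF \<delta>(1)] by blast
  define j where "j = Max (insert j0 (insert j2 (j1 ` P)))"
  have j: "j0 \<le> j" "j2 \<le> j" "\<And>p. p \<in> P \<Longrightarrow> j1 p \<le> j"
    using P(1) Max_ge[of "insert j0 (insert j2 (j1 ` P))"] by (auto simp: j_def)
  have pt: "psi j (y - partial j x) \<le> (\<Sum>p\<in>P. indicator (ball (fst p) (snd p)) x * psi j (y - partial j x))" if "x \<in> K" for x
  proof (cases "psi j (y - partial j x) = 0")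
    case False
    then have "norm (y - partial j x) \<le> DIM('b) * (1/2) ^ j" by (rule psi_nonzero)
    moreover have "dist (limit_map x) y \<le> norm (limit_map x - partial j x) + norm (y - partial j x)"
      by (metis dist_norm dist_triangle2)
    ultimately have "dist (limit_map x) y < \<delta>" using limit_map_partial[of x j] j2[OF j(2)] by linarith
    then have "x \<in> W" using \<delta>(2)[of x] that by force
    then obtain p where p: "p \<in> P" "x \<in> ball (fst p) (snd p)" by (auto simp: W_def)
    then have "psi j (y - partial j x) = (\<Sum>p\<in>{p}. indicator (ball (fst p) (snd p)) x * psi j (y - partial j x))" by simp
    also have "\<dots> \<le> (\<Sum>p\<in>P. indicator (ball (fst p) (snd p)) x * psi j (y - partial j x))"
      using p P(1) by (intro sum_mono2) (auto simp: psi_nonneg)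
    finally show ?thesis .
  qed (simp add: sum_nonneg psi_nonneg)
  have int: "integrable \<mu> (\<lambda>x. indicator (ball (fst p) (snd p)) x * psi j (y - partial j x))" for p
    by (rule dens_integrable) auto
  have "\<kappa> \<le> dens j UNIV (partial j) y" using \<kappa> j by blast
  also have "\<dots> \<le> (\<integral>x. (\<Sum>p\<in>P. indicator (ball (fst p) (snd p)) x * psi j (y - partial j x)) \<partial>\<mu>)"
    unfolding dens_def
  proof (rule integral_mono_AE)
    show "AE x in \<mu>. indicator UNIV x * psi j (y - partial j x) \<le> (\<Sum>p\<in>P. indicator (ball (fst p) (snd p)) x * psi j (y - partial j x))"
      using AE_K by eventually_elim (use pt in simp)
  qed (use dens_integrable[of UNIV "partial j" j y] in \<open>auto intro!: Bochner_Integration.integrable_sum int\<close>)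
  also have "\<dots> = (\<Sum>p\<in>P. dens j (ball (fst p) (snd p)) (partial j) y)"
    unfolding dens_def by (rule Bochner_Integration.integral_sum) (rule int)
  also have "\<dots> \<le> (\<Sum>p\<in>P. M * dim_gauge s DIM('b) (snd p))" using j1 j by (intro sum_mono) auto
  also have "\<dots> = M * (\<Sum>(x, r)\<in>P. dim_gauge s DIM('b) r)" by (simp add: sum_distrib_left case_prod_unfold)
  finally show "\<kappa> / M \<le> (\<Sum>(x, r)\<in>P. dim_gauge s DIM('b) r)" using M_pos by (simp add: field_simps)
qed

lemma low_density_sets: "{x \<in> K. dens j UNIV (partial j) (limit_map x) < c} \<in> sets borel"
proof -
  define \<Lambda> where "\<Lambda> = dens_lip DIM('b) j"
  have "\<bar>dens j UNIV (partial j) y - dens j UNIV (partial j) z\<bar> \<le> \<Lambda> * norm (y - z)" for y z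
    using dens_lipschitz[of UNIV "partial j" j y z] by (simp add: \<Lambda>_def)
  moreover have "0 \<le> \<Lambda>" by (simp add: \<Lambda>_def dens_lip_def)
  ultimately have "continuous_on UNIV (dens j UNIV (partial j))"
    by (intro lipschitz_on_continuous_on[of \<Lambda>] lipschitz_onI) (auto simp: dist_norm)
  then have "continuous_on UNIV (\<lambda>x. dens j UNIV (partial j) (limit_map x))"
    using continuous_limit_map by (rule continuous_on_compose2) auto
  then have "open {x. dens j UNIV (partial j) (limit_map x) < c}"
    by (intro open_Collect_less) auto
  then have "K \<inter> {x. dens j UNIV (partial j) (limit_map x) < c} \<in> sets borel"
    using compact_K by (intro sets.Int) (auto simp: borel_compact)
  then show ?thesis by (simp add: Int_def)
qed

text \<open>Low density forces low mass: the images of the points in question meet few lattice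
  cubes, each receiving mass at most a constant times its volume times \<open>\<kappa>\<close>. The
  number of cubes is of the order of the inverse volume, so the fine level \<open>i\<close>
  disappears from the bound.\<close>

lemma low_density_prob:
  assumes B: "\<And>x. x \<in> K \<Longrightarrow> norm (f x) \<le> B" and j: "J \<le> j" "2 powr (- (real j)\<^sup>2 * s) * (1/2) ^ j \<le> \<kappa>" and "0 < \<kappa>"
  shows "prob {x \<in> K. dens j UNIV (partial j) (limit_map x) < 5 * \<kappa>} \<le> (2 * (2 * (B + DIM('b)) + 3)) ^ DIM('b) * (7 * \<kappa>)"
proof -
  define S where "S = {x \<in> K. dens j UNIV (partial j) (limit_map x) < 5 * \<kappa>}"
  define \<Lambda> where "\<Lambda> = dens_lip DIM('b) j"
  have lip: "\<bar>dens j UNIV (partial j) y - dens j UNIV (partial j) z\<bar> \<le> \<Lambda> * norm (y - z)" for y z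
    using dens_lipschitz[of UNIV "partial j" j y z] by (simp add: \<Lambda>_def)
  \<comment> \<open>The cubes must be so fine that the density of level \<open>j\<close>, despite
    its large Lipschitz constant, differs by less than \<open>\<kappa>\<close> between
    \<open>limit_map x\<close> and the lattice point of its cube.\<close>
  obtain i1 where i1: "\<And>i. i1 \<le> i \<Longrightarrow> \<Lambda> * (2 * real DIM('b)) * (1/2) ^ i < \<kappa>"
    using half_pow_less[OF \<open>0 < \<kappa>\<close>] by blast
  define i where "i = max i1 j"
  have i: "j \<le> i" "\<Lambda> * (2 * (DIM('b) * (1/2 :: real) ^ i)) < \<kappa>" using i1[of i] by (auto simp: i_def mult.assoc)
  have \<Lambda>: "0 \<le> \<Lambda>" by (simp add: \<Lambda>_def dens_lip_def)
  have np: "norm (partial i x) \<le> B + DIM('b)" if "x \<in> K" for x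
  proof -
    have "norm (\<Sum>l<i. g l x) \<le> DIM('b)" using norm_g by (intro norm_sum_half_pow_le) auto
    then show ?thesis unfolding partial_def using norm_triangle_ineq[of "f x" "\<Sum>l<i. g l x"] B[OF that] by linarith
  qed
  have B0: "0 \<le> B + DIM('b)" using np K_ne by (metis all_not_in_conv norm_ge_zero order_trans)
  obtain Y :: "'b set" where Y: "finite Y" "card Y \<le> (2 ^ i * (2 * (B + DIM('b)) + 3)) ^ DIM('b)"
    "\<And>z. norm z \<le> B + DIM('b) \<Longrightarrow> \<exists>y\<in>Y. \<forall>b\<in>Basis. \<bar>(y - z) \<bullet> b\<bar> \<le> (1/2) ^ Suc i"
    using lattice_cover[OF B0] by metis
  define A where "A y = {x. \<forall>b\<in>Basis. \<bar>(y - partial i x) \<bullet> b\<bar> \<le> (1/2) ^ Suc i}" for y :: 'b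
  have Am: "A y \<in> sets borel" for y
  proof -
    have "A y = (\<Inter>b\<in>Basis. {x. \<bar>(y - partial i x) \<bullet> b\<bar> \<le> (1/2) ^ Suc i})" by (auto simp: A_def)
    then have "closed (A y)"
      by (auto intro!: closed_INT closed_Collect_le continuous_intros continuous_partial)
    then show ?thesis by simp
  qed
  have Sm: "S \<in> sets borel" unfolding S_def by (rule low_density_sets)
  define Z where "Z = {y\<in>Y. S \<inter> A y \<noteq> {}}"
  have finZ: "finite Z" using Y(1) by (simp add: Z_def)
  \<comment> \<open>The reciprocal of the lower bound for \<open>psi i\<close> in
    \<open>psi_ge\<close>.\<close>
  define q where "q = (2::real) ^ DIM('b) / 2 ^ (i * DIM('b))"
  have q: "0 < q" by (simp add: q_def)
  have "prob (A y) \<le> q * (7 * \<kappa>)" if y: "y \<in> Z" for y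
  proof -
    obtain x where x: "x \<in> S" "x \<in> A y" using y by (auto simp: Z_def)
    have "norm (y - partial i x) \<le> DIM('b) * (1/2) ^ i"
    proof -
      have "norm (y - partial i x) \<le> (\<Sum>b\<in>Basis. \<bar>(y - partial i x) \<bullet> b\<bar>)" by (rule norm_le_l1)
      also have "\<dots> \<le> (\<Sum>b\<in>(Basis::'b set). (1/2) ^ i)"
      proof (rule sum_mono)
        fix b :: 'b assume "b \<in> Basis"
        then have "\<bar>(y - partial i x) \<bullet> b\<bar> \<le> (1/2) ^ Suc i" using x(2) by (simp add: A_def)
        also have "\<dots> \<le> (1/2) ^ i" by simp
        finally show "\<bar>(y - partial i x) \<bullet> b\<bar> \<le> (1/2) ^ i" .
      qed
      finally show ?thesis by simp
    qed
    then have "norm (y - limit_map x) \<le> 2 * (DIM('b) * (1/2) ^ i)"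
      using limit_map_partial[of x i] norm_triangle_ineq4[of "y - partial i x" "limit_map x - partial i x"] by simp
    \<comment> \<open>The bound grows from 5 to 6 multiples of \<open>\<kappa>\<close> by moving
      from \<open>limit_map x\<close> to \<open>y\<close>, and from 6 to 7 by telescoping from
      \<open>j\<close> to \<open>i\<close>.\<close>
    then have "\<Lambda> * norm (y - limit_map x) < \<kappa>" using i(2) \<Lambda> by (meson le_less_trans mult_left_mono)
    moreover have "dens j UNIV (partial j) (limit_map x) < 5 * \<kappa>" using x(1) by (simp add: S_def)
    ultimately have "dens j UNIV (partial j) y < 6 * \<kappa>" using lip[of y "limit_map x"] by linarith
    moreover have "UNIV \<in> tests j" by (simp add: tests_def)
    ultimately have d: "dens i UNIV (partial i) y \<le> 7 * \<kappa>"
      using dens_telescope'[OF j(1) _ i(1), of UNIV y] j(2) by linarith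
    have "prob (A y) / q = (\<integral>x. indicator (A y) x * (1 / q) \<partial>\<mu>)" using Am by simp
    also have "\<dots> \<le> dens i UNIV (partial i) y"
      unfolding dens_def
    proof (rule integral_mono)
      show "integrable \<mu> (\<lambda>x. indicator (A y) x * (1 / q) :: real)"
        using Am by (intro integrable_mult_left integrable_const_bound[of _ 1]) (auto simp: indicator_def)
      show "indicator (A y) x * (1 / q) \<le> indicator UNIV x * psi i (y - partial i x)" for x
        using psi_ge[of "y - partial i x" i] psi_nonneg by (auto simp: indicator_def A_def q_def)
    qed (use dens_integrable[of UNIV "partial i" i y] in auto)
    finally have "prob (A y) \<le> q * dens i UNIV (partial i) y" using q by (simp add: field_simps)
    also have "\<dots> \<le> q * (7 * \<kappa>)" using d q by (intro mult_left_mono) auto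
    finally show ?thesis .
  qed
  have "S \<subseteq> (\<Union>y\<in>Z. A y)"
  proof
    fix x assume x: "x \<in> S"
    then have "x \<in> K" by (simp add: S_def)
    then obtain y where "y \<in> Y" "x \<in> A y" using Y(3)[OF np] by (auto simp: A_def)
    then show "x \<in> (\<Union>y\<in>Z. A y)" using x by (auto simp: Z_def)
  qed
  then have "prob S \<le> prob (\<Union>y\<in>Z. A y)" using Am finZ by (intro finite_measure_mono) auto
  also have "\<dots> \<le> (\<Sum>y\<in>Z. prob (A y))" using Am finZ by (intro finite_measure_subadditive_finite) auto
  also have "\<dots> \<le> (\<Sum>y\<in>Z. q * (7 * \<kappa>))" by (rule sum_mono) fact
  also have "\<dots> = card Z * (q * (7 * \<kappa>))" by simp
  also have "\<dots> \<le> (2 ^ i * (2 * (B + DIM('b)) + 3)) ^ DIM('b) * (q * (7 * \<kappa>))"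
  proof (rule mult_right_mono)
    have "card Z \<le> card Y" using Y(1) by (intro card_mono) (auto simp: Z_def)
    then show "real (card Z) \<le> (2 ^ i * (2 * (B + DIM('b)) + 3)) ^ DIM('b)" using Y(2) by simp
  qed (use q \<open>0 < \<kappa>\<close> in auto)
  also have "\<dots> = (2 * (2 * (B + DIM('b)) + 3)) ^ DIM('b) * (7 * \<kappa>)"
    unfolding q_def power_mult_distrib by (simp add: power_mult)
  finally show ?thesis by (simp add: S_def)
qed

text \<open>Outside a small set the density at the image of a point is at least
  \<open>5 * \<kappa>\<close>. This margin survives the move to nearby values \<open>y\<close> and
  the passage to all later levels, so a whole ball of values has fat fibers.\<close>

lemma good_pts_limit_map:
  assumes "0 < e"
  shows "\<exists>m. 1 - e \<le> prob (good_pts m limit_map)"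
proof -
  obtain B where B: "\<And>x. x \<in> K \<Longrightarrow> norm (f x) \<le> B"
    using compact_imp_bounded[OF compact_continuous_image[OF continuous_on_subset[OF cont_f] compact_K]]
    by (force simp: bounded_iff)
  define V where "V = (2 * (2 * (B + DIM('b)) + 3)) ^ DIM('b)"
  have "0 \<le> B" using B K_ne by (metis all_not_in_conv norm_ge_zero order_trans)
  then have V: "0 < V" unfolding V_def by (intro zero_less_power) auto
  \<comment> \<open>Cancels the constant of \<open>low_density_prob\<close>, so that the exceptional
    set has mass at most \<open>e\<close>.\<close>
  define \<kappa> where "\<kappa> = e / (7 * V)"
  have \<kappa>: "0 < \<kappa>" using V assms by (simp add: \<kappa>_def)
  obtain j1 where j1: "(1/2 :: real) ^ j1 < \<kappa>" using real_arch_pow_inv[OF \<kappa>, of "1/2"] by auto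
  define j where "j = max J j1"
  have jt: "2 powr (- (real j)\<^sup>2 * s) * (1/2) ^ j \<le> \<kappa>"
  proof -
    have "2 powr (- (real j)\<^sup>2 * s) * (1/2) ^ j \<le> 1 * (1/2) ^ j"
    proof (rule mult_right_mono)
      have "2 powr (- (real j)\<^sup>2 * s) \<le> 2 powr 0" using s_pos by (intro powr_mono) auto
      then show "2 powr (- (real j)\<^sup>2 * s) \<le> 1" by simp
    qed simp
    also have "\<dots> \<le> (1/2) ^ j1" by (simp add: j_def power_decreasing)
    finally show ?thesis using j1 by simp
  qed
  have jJ: "J \<le> j" by (simp add: j_def)
  define S where "S = {x \<in> K. dens j UNIV (partial j) (limit_map x) < 5 * \<kappa>}"
  have S: "prob S \<le> e"
  proof -
    have "prob S \<le> V * (7 * \<kappa>)" unfolding S_def V_def using B jJ jt \<kappa> by (rule low_density_prob)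
    also have "\<dots> = e" using V by (simp add: \<kappa>_def)
    finally show ?thesis .
  qed
  define \<Lambda> where "\<Lambda> = dens_lip DIM('b) j"
  have \<Lambda>: "0 < \<Lambda>" by (simp add: \<Lambda>_def dens_lip_def)
  have lip: "\<bar>dens j UNIV (partial j) y - dens j UNIV (partial j) z\<bar> \<le> \<Lambda> * norm (y - z)" for y z
    using dens_lipschitz[of UNIV "partial j" j y z] by (simp add: \<Lambda>_def)
  have "0 < min (\<kappa> / \<Lambda>) (\<kappa> / M)" using \<kappa> \<Lambda> M_pos by simp
  \<comment> \<open>\<open>1 / Suc m\<close> serves in \<open>good_pts\<close> as a radius, hence
    the bound \<open>\<kappa> / \<Lambda>\<close>, and as a content, hence
    \<open>\<kappa> / M\<close>.\<close>
  then obtain m where m: "1 / Suc m < min (\<kappa> / \<Lambda>) (\<kappa> / M)" using nat_approx_posE by metis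
  have "K - S \<subseteq> good_pts m limit_map"
  proof
    fix x assume x: "x \<in> K - S"
    then have d: "5 * \<kappa> \<le> dens j UNIV (partial j) (limit_map x)" by (auto simp: S_def)
    have "fat K s (1 / Suc m) limit_map y" if y: "dist y (limit_map x) < 1 / Suc m" for y
    proof -
      have "norm (y - limit_map x) < \<kappa> / \<Lambda>" using y m by (simp add: dist_norm)
      then have "\<Lambda> * norm (y - limit_map x) < \<kappa>" using \<Lambda> by (simp add: field_simps)
      then have "4 * \<kappa> \<le> dens j UNIV (partial j) y" using lip[of y "limit_map x"] d by linarith
      then have "\<kappa> \<le> dens i UNIV (partial i) y" if "j \<le> i" for i
        using dens_telescope'[OF jJ _ that, of UNIV y] jt \<kappa> by (auto simp: tests_def)
      then have "fat K s (\<kappa> / M) limit_map y" by (rule fat_limit_map)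
      then show ?thesis using m unfolding fat_def by (meson less_imp_le min_less_iff_conj order_trans)
    qed
    then show "x \<in> good_pts m limit_map" using x by (simp add: good_pts_def)
  qed
  then have "K \<subseteq> good_pts m limit_map \<union> S" by auto
  moreover have "good_pts m limit_map \<in> sets borel" "S \<in> sets borel"
    unfolding S_def using continuous_on_subset[OF continuous_limit_map] by (auto simp: good_pts_sets low_density_sets)
  ultimately have "prob K \<le> prob (good_pts m limit_map) + prob S"
    by (intro order_trans[OF finite_measure_mono measure_Un_le]) auto
  then have "1 - e \<le> prob (good_pts m limit_map)" using S prob_K by linarith
  then show ?thesis by blast
qed

end

section \<open>The prevalence of large fibers\<close>

lemma space_PiM_pmf [simp]: "space (PiM UNIV (\<lambda>i. measure_pmf (p i))) = UNIV"
  by (simp add: space_PiM)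

text \<open>With countably many values per coordinate every function of an initial segment is
  measurable; the random map and the address map of a self-similar set are treated through such
  functions.\<close>

lemma measurable_initial_segment:
  fixes p :: "nat \<Rightarrow> 'c::countable pmf"
  shows "(\<lambda>\<omega>. map \<omega> [0..<n]) \<in> measurable (PiM UNIV (\<lambda>i. measure_pmf (p i))) (count_space UNIV)"
proof (subst measurable_count_space_eq_countable, simp, safe)
  fix xs :: "'c list"
  let ?P = "PiM UNIV (\<lambda>i. measure_pmf (p i))"
  have coord: "(\<lambda>\<omega>. \<omega> i) \<in> measurable ?P (count_space UNIV)" for i
    using measurable_component_singleton[of i UNIV "\<lambda>i. measure_pmf (p i)"]
    by (simp add: measurable_cong_sets[OF refl sets_measure_pmf_count_space])
  have "map \<omega> [0..<n] = xs \<longleftrightarrow> length xs = n \<and> (\<forall>i\<in>{..<n}. \<omega> i = xs ! i)" for \<omega>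
    by (subst list_eq_iff_nth_eq) auto
  then have "(\<lambda>\<omega>. map \<omega> [0..<n]) -` {xs} \<inter> space ?P =
      (if length xs = n then {\<omega>\<in>space ?P. \<forall>i\<in>{..<n}. \<omega> i = xs ! i} else {})"
    by auto
  also have "\<dots> \<in> sets ?P"
  proof -
    have "{\<omega>\<in>space ?P. \<omega> i = xs ! i} \<in> sets ?P" for i
      using measurable_sets[OF coord[of i], of "{xs ! i}"] by (simp add: vimage_def Int_def)
    then have "{\<omega>\<in>space ?P. \<forall>i\<in>{..<n}. \<omega> i = xs ! i} \<in> sets ?P"
      by (intro sets.sets_Collect_finite_All) auto
    then show ?thesis by (cases "length xs = n") (simp_all only: if_True if_False sets.empty_sets simp_thms)
  qed
  finally show "(\<lambda>\<omega>. map \<omega> [0..<n]) -` {xs} \<inter> space ?P \<in> sets ?P" .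
qed simp

section \<open>Construction of the random levels\<close>

context frostman
begin

text \<open>Densities are Lipschitz, so a deviation of at most \<open>tol j / 2\<close> on a finite
  set yields \<open>tol j\<close> on the whole ball of radius \<open>j\<close>.\<close>

lemma grid_exists:
  "\<exists>Y :: 'b::euclidean_space set. finite Y \<and> (\<forall>y. norm y \<le> real j \<longrightarrow>
     (\<exists>z\<in>Y. (dens_lip DIM('b) (Suc j) + dens_lip DIM('b) j) * norm (y - z) \<le> tol j / 2))"
proof -
  define L where "L = dens_lip DIM('b) (Suc j) + dens_lip DIM('b) j"
  have L: "0 < L" unfolding L_def dens_lip_def by (intro add_pos_pos) auto
  have "0 < tol j / 2 / L" using L tol_pos by simp
  then obtain Y where Y: "finite Y" "cball (0::'b) (real j) \<subseteq> (\<Union>z\<in>Y. ball z (tol j / 2 / L))"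
    using compact_cball[of "0::'b" "real j"] unfolding compact_eq_totally_bounded by blast
  have "\<exists>z\<in>Y. L * norm (y - z) \<le> tol j / 2" if "norm y \<le> real j" for y
  proof -
    have "y \<in> cball 0 (real j)" using that by simp
    then obtain z where "z \<in> Y" "dist z y < tol j / 2 / L" using Y(2) by (meson UN_E mem_ball subsetD)
    then show ?thesis using L by (intro bexI[of _ z]) (auto simp: dist_norm norm_minus_commute field_simps)
  qed
  then show ?thesis using Y(1) unfolding L_def by blast
qed

definition grid :: "nat \<Rightarrow> 'b::euclidean_space set" where
  "grid j = (SOME Y. finite Y \<and> (\<forall>y. norm y \<le> real j \<longrightarrow>
     (\<exists>z\<in>Y. (dens_lip DIM('b) (Suc j) + dens_lip DIM('b) j) * norm (y - z) \<le> tol j / 2)))"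

lemma grid:
  shows "finite (grid j :: 'b::euclidean_space set)"
    and "norm (y :: 'b) \<le> real j \<Longrightarrow> \<exists>z\<in>grid j. (dens_lip DIM('b) (Suc j) + dens_lip DIM('b) j) * norm (y - z) \<le> tol j / 2"
  using someI_ex[OF grid_exists[where 'b = 'b, of j], folded grid_def] by simp_all

definition deviates :: "nat \<Rightarrow> ('a \<Rightarrow> 'b::euclidean_space) \<Rightarrow> ('a \<Rightarrow> 'b) \<Rightarrow> bool" where
  "deviates j F g \<longleftrightarrow> (\<exists>E\<in>tests j. \<exists>y\<in>grid j. tol j / 2 < \<bar>dens (Suc j) E (\<lambda>x. F x + g x) y - dens j E F y\<bar>)"

text \<open>A union bound over the finitely many pasts, tests and grid points. The level depends on
  the possible pasts \<open>S\<close>, while \<open>f\<close> ranges over all Borel maps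
  afterwards.\<close>

lemma level_for_pasts:
  fixes S :: "('a \<Rightarrow> 'b::euclidean_space) set"
  assumes "finite S"
  shows "\<exists>\<Gamma> :: ('a \<Rightarrow> 'b) pmf. finite (set_pmf \<Gamma>) \<and>
    (\<forall>g\<in>set_pmf \<Gamma>. continuous_on UNIV g \<and> (\<forall>x. norm (g x) \<le> DIM('b) * (1/2) ^ Suc j)) \<and>
    (\<forall>f \<in> borel_measurable borel. S \<subseteq> borel_measurable borel \<longrightarrow>
      measure_pmf.prob \<Gamma> {g. \<exists>G\<in>S. deviates j (\<lambda>x. f x + G x) g} \<le> (1/2) ^ j)"
proof -
  define I where "I = S \<times> tests j \<times> (grid j :: 'b set)"
  have I: "finite I" unfolding I_def by (intro finite_cartesian_product assms finite_tests grid(1))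
  \<comment> \<open>The added 1 keeps the quotient meaningful when \<open>I\<close> is
    empty.\<close>
  define T where "T = (1/2) ^ j / (card I + 1 :: real)"
  have T: "0 < T" by (simp add: T_def add_nonneg_pos)
  have "0 < tol j / 2" using tol_pos by simp
  from level_exists[OF this T, of j, where 'b = 'b]
  obtain \<Gamma> :: "('a \<Rightarrow> 'b) pmf" where \<Gamma>: "finite (set_pmf \<Gamma>)"
    "\<forall>g\<in>set_pmf \<Gamma>. continuous_on UNIV g \<and> (\<forall>x. norm (g x) \<le> DIM('b) * (1/2) ^ Suc j)"
    "\<And>F E y. F \<in> borel_measurable borel \<Longrightarrow> E \<in> sets borel \<Longrightarrow>
      measure_pmf.prob \<Gamma> {g. tol j / 2 < \<bar>dens (Suc j) E (\<lambda>x. F x + g x) y - dens j E F y\<bar>} \<le> T"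
    by blast
  have "measure_pmf.prob \<Gamma> {g. \<exists>G\<in>S. deviates j (\<lambda>x. f x + G x) g} \<le> (1/2) ^ j"
    if f: "f \<in> borel_measurable borel" and S: "S \<subseteq> borel_measurable borel" for f
  proof -
    define A where "A = (\<lambda>(G, E, y). {g. tol j / 2 < \<bar>dens (Suc j) E (\<lambda>x. f x + G x + g x) y - dens j E (\<lambda>x. f x + G x) y\<bar>})"
    have "{g. \<exists>G\<in>S. deviates j (\<lambda>x. f x + G x) g} = (\<Union>i\<in>I. A i)"
      unfolding deviates_def I_def A_def by auto
    then have "measure_pmf.prob \<Gamma> {g. \<exists>G\<in>S. deviates j (\<lambda>x. f x + G x) g} \<le> (\<Sum>i\<in>I. measure_pmf.prob \<Gamma> (A i))"
      using measure_pmf.finite_measure_subadditive_finite[OF I, of A \<Gamma>] by simp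
    also have "\<dots> \<le> (\<Sum>i\<in>I. T)"
    proof (rule sum_mono)
      fix i assume i: "i \<in> I"
      obtain G E y where eq: "i = (G, E, y)" by (cases i)
      have "G \<in> borel_measurable borel" "E \<in> sets borel" using i eq S tests_borel by (auto simp: I_def)
      then show "measure_pmf.prob \<Gamma> (A i) \<le> T" unfolding A_def eq using f
        by (simp only: prod.case) (intro \<Gamma>(3) borel_measurable_add)
    qed
    also have "\<dots> = card I * T" by simp
    also have "\<dots> \<le> (card I + 1) * T" using T by simp
    also have "\<dots> = (1/2) ^ j" by (simp add: T_def add_nonneg_eq_0_iff)
    finally show ?thesis .
  qed
  then show ?thesis using \<Gamma>(1,2) by blast
qed

text \<open>The bad event asks for some admissible past instead of the actual one. It thus depends
  on the \<open>j\<close>-th coordinate alone, and its probability needs no conditioning.\<close>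

definition good_levels :: "(nat \<Rightarrow> ('a \<Rightarrow> 'b::euclidean_space) pmf) \<Rightarrow> bool" where
  "good_levels \<Gamma> \<longleftrightarrow> (\<forall>j. finite (set_pmf (\<Gamma> j))) \<and>
    (\<forall>j. \<forall>g\<in>set_pmf (\<Gamma> j). continuous_on UNIV g \<and> (\<forall>x. norm (g x) \<le> DIM('b) * (1/2) ^ Suc j)) \<and>
    (\<forall>j. \<forall>f \<in> borel_measurable borel. measure_pmf.prob (\<Gamma> j)
      {g. \<exists>h. (\<forall>i<j. h i \<in> set_pmf (\<Gamma> i)) \<and> deviates j (\<lambda>x. f x + (\<Sum>i<j. h i x)) g} \<le> (1/2) ^ j)"

text \<open>A recursion that carries the finite set of all sums that the earlier levels can produce,
  which is the set of pasts for the next level.\<close>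

lemma good_levels_exist: "\<exists>\<Gamma> :: nat \<Rightarrow> ('a \<Rightarrow> 'b::euclidean_space) pmf. good_levels \<Gamma>"
proof -
  define ok where "ok j S \<Gamma> \<longleftrightarrow> finite (set_pmf \<Gamma>) \<and>
    (\<forall>g\<in>set_pmf \<Gamma>. continuous_on UNIV g \<and> (\<forall>x. norm (g x) \<le> DIM('b) * (1/2) ^ Suc j)) \<and>
    (\<forall>f \<in> borel_measurable borel. S \<subseteq> borel_measurable borel \<longrightarrow>
      measure_pmf.prob \<Gamma> {g. \<exists>G\<in>S. deviates j (\<lambda>x. f x + G x) g} \<le> (1/2) ^ j)" for j S and \<Gamma> :: "('a \<Rightarrow> 'b) pmf"
  define lev where "lev j S = (SOME \<Gamma>. ok j S \<Gamma>)" for j S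
  have lev: "ok j S (lev j S)" if "finite S" for j S
    unfolding lev_def by (rule someI_ex) (use level_for_pasts[OF that, of j] in \<open>simp only: ok_def\<close>)
  define past where "past = rec_nat {\<lambda>_. 0} (\<lambda>j S. (\<lambda>(G, g) x. G x + g x) ` (S \<times> set_pmf (lev j S)))"
  have past0: "past 0 = {\<lambda>_. 0}" and
    pastS: "past (Suc j) = (\<lambda>(G, g) x. G x + g x) ` (past j \<times> set_pmf (lev j (past j)))" for j
    by (simp_all add: past_def)
  have fin: "finite (past j)" for j
    by (induction j) (use lev in \<open>auto simp: past0 pastS ok_def\<close>)
  define \<Gamma> where "\<Gamma> j = lev j (past j)" for j
  have meas: "past j \<subseteq> borel_measurable borel" for j
  proof (induction j)
    case (Suc j)
    have "g \<in> borel_measurable borel" if "g \<in> set_pmf (lev j (past j))" for g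
      using lev[OF fin, of j j] that by (intro borel_measurable_continuous_onI) (simp add: ok_def)
    then show ?case using Suc unfolding pastS by auto
  qed (simp add: past0)
  have sums: "(\<lambda>x. \<Sum>i<j. h i x) \<in> past j" if "\<forall>i<j. h i \<in> set_pmf (\<Gamma> i)" for h j
    using that
  proof (induction j)
    case (Suc j)
    then have "((\<lambda>x. \<Sum>i<j. h i x), h j) \<in> past j \<times> set_pmf (lev j (past j))" by (auto simp: \<Gamma>_def)
    then show ?case unfolding pastS by (rule rev_image_eqI) simp
  qed (simp add: past0)
  have "measure_pmf.prob (\<Gamma> j)
      {g. \<exists>h. (\<forall>i<j. h i \<in> set_pmf (\<Gamma> i)) \<and> deviates j (\<lambda>x. f x + (\<Sum>i<j. h i x)) g} \<le> (1/2) ^ j"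
    if "f \<in> borel_measurable borel" for f j
  proof -
    have "measure_pmf.prob (\<Gamma> j) {g. \<exists>h. (\<forall>i<j. h i \<in> set_pmf (\<Gamma> i)) \<and> deviates j (\<lambda>x. f x + (\<Sum>i<j. h i x)) g}
      \<le> measure_pmf.prob (\<Gamma> j) {g. \<exists>G\<in>past j. deviates j (\<lambda>x. f x + G x) g}"
    proof (rule measure_pmf.finite_measure_mono)
      show "{g. \<exists>h. (\<forall>i<j. h i \<in> set_pmf (\<Gamma> i)) \<and> deviates j (\<lambda>x. f x + (\<Sum>i<j. h i x)) g}
        \<subseteq> {g. \<exists>G\<in>past j. deviates j (\<lambda>x. f x + G x) g}"
      proof safe
        fix g h assume "\<forall>i<j. h i \<in> set_pmf (\<Gamma> i)" "deviates j (\<lambda>x. f x + (\<Sum>i<j. h i x)) g"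
        then show "\<exists>G\<in>past j. deviates j (\<lambda>x. f x + G x) g"
          by (intro bexI[of _ "\<lambda>x. \<Sum>i<j. h i x"] sums)
      qed
    qed simp
    also have "\<dots> \<le> (1/2) ^ j" using lev[OF fin, of j j] meas[of j] that by (simp add: \<Gamma>_def ok_def)
    finally show ?thesis .
  qed
  moreover have "finite (set_pmf (\<Gamma> j))" "\<forall>g\<in>set_pmf (\<Gamma> j). continuous_on UNIV g \<and> (\<forall>x. norm (g x) \<le> DIM('b) * (1/2) ^ Suc j)" for j
    using lev[OF fin, of j j] unfolding \<Gamma>_def ok_def by simp_all
  ultimately have "good_levels \<Gamma>" unfolding good_levels_def by simp
  then show ?thesis by blast
qed

lemma dens_eq_0:
  fixes F :: "'a \<Rightarrow> 'b::euclidean_space"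
  assumes "\<And>x. norm (F x) \<le> R" "R + DIM('b) < norm y"
  shows "dens j E F y = 0"
proof -
  have "psi j (y - F x) = 0" for x
  proof (rule ccontr)
    assume "psi j (y - F x) \<noteq> 0"
    then have "norm (y - F x) \<le> DIM('b) * (1/2) ^ j" by (rule psi_nonzero)
    also have "\<dots> \<le> DIM('b) * 1" by (subst of_nat_mult, intro mult_left_mono) (auto simp: power_le_one)
    finally show False using assms(1)[of x] assms(2) norm_triangle_ineq2[of y "F x"] by simp
  qed
  then show ?thesis by (simp add: dens_def)
qed

text \<open>In the ball of radius \<open>j\<close> the grid and the Lipschitz bounds apply. Outside
  it both densities vanish: the partial sums are bounded by \<open>B + DIM('b)\<close> and
  \<open>psi\<close> vanishes beyond norm \<open>DIM('b)\<close>, hence the bound on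
  \<open>J\<close>.\<close>

lemma frostman_series_if_not_deviates:
  fixes f :: "'a \<Rightarrow> 'b::euclidean_space" and B :: real
  assumes f: "continuous_on UNIV f" "\<And>x. norm (f x) \<le> B"
    and g: "\<And>j. continuous_on UNIV (g j)" "\<And>j x. norm (g j x) \<le> DIM('b) * (1/2) ^ Suc j"
    and J: "B + 2 * DIM('b) \<le> J" and ev: "\<And>j. J \<le> j \<Longrightarrow> \<not> deviates j (\<lambda>x. f x + (\<Sum>i<j. g i x)) (g j)"
  shows "frostman_series \<mu> K s C f g J"
proof unfold_locales
  fix j E and y :: 'b assume j: "J \<le> j" and E: "E \<in> tests j"
  define F where "F j x = f x + (\<Sum>i<j. g i x)" for j x
  have cF: "continuous_on UNIV (F j)" for j unfolding F_def by (intro continuous_intros f g)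
  have Fm: "F j \<in> borel_measurable borel" for j by (rule borel_measurable_continuous_onI[OF cF])
  have Em: "E \<in> sets borel" by (rule tests_borel[OF E])
  have FS: "F (Suc j) = (\<lambda>x. F j x + g j x)" by (simp add: F_def add.assoc fun_eq_iff)
  have "\<bar>dens (Suc j) E (F (Suc j)) y - dens j E (F j) y\<bar> \<le> tol j"
  proof (cases "norm y \<le> real j")
    case True
    define L where "L i = dens_lip DIM('b) i" for i
    obtain z where z: "z \<in> grid j" "(L (Suc j) + L j) * norm (y - z) \<le> tol j / 2"
      using grid(2)[OF True] unfolding L_def by blast
    have "\<bar>dens (Suc j) E (F (Suc j)) z - dens j E (F j) z\<bar> \<le> tol j / 2"
      using ev[OF j] z(1) E unfolding deviates_def F_def[symmetric] FS by (meson not_less)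
    moreover have "\<bar>dens (Suc j) E (F (Suc j)) y - dens (Suc j) E (F (Suc j)) z\<bar> \<le> L (Suc j) * norm (y - z)"
      "\<bar>dens j E (F j) y - dens j E (F j) z\<bar> \<le> L j * norm (y - z)"
      unfolding L_def by (rule dens_lipschitz[OF Em Fm])+
    ultimately show ?thesis using z(2) unfolding distrib_right by linarith
  next
    case False
    have "norm (F j x) \<le> B + DIM('b)" for j x
    proof -
      have "norm (\<Sum>l<j. g l x) \<le> DIM('b)" using g(2) by (intro norm_sum_half_pow_le) auto
      then show ?thesis unfolding F_def using norm_triangle_ineq[of "f x" "\<Sum>l<j. g l x"] f(2)[of x] by linarith
    qed
    moreover have "B + DIM('b) + DIM('b) < norm y" using False j J by linarith
    ultimately have "dens i E (F i) y = 0" for i by (rule dens_eq_0)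
    then show ?thesis using tol_pos[of j] by simp
  qed
  then show "\<bar>dens (Suc j) E (\<lambda>x. f x + (\<Sum>i<Suc j. g i x)) y - dens j E (\<lambda>x. f x + (\<Sum>i<j. g i x)) y\<bar> \<le> tol j"
    unfolding F_def .
qed (rule f(1) g(1) g(2))+

section \<open>Translations of the space of maps and the law of the random series\<close>

lemma C_add_topspace:
  fixes f g :: "'a \<Rightarrow> 'b::euclidean_space"
  assumes "f \<in> topspace (C_top K)" "g \<in> topspace (C_top K)"
  shows "C_add K f g \<in> topspace (C_top K)"
proof (rule C_topI[OF compact_K])
  have "continuous_on K (\<lambda>x. f x + g x)"
    using assms compact_K by (intro continuous_on_add) (simp_all add: topspace_C_top)
  then show "continuous_on K (C_add K f g)" by (rule continuous_on_eq) (simp add: C_add_def)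
qed (simp add: C_add_def)

lemma measurable_C_add:
  fixes g :: "'a \<Rightarrow> 'b::euclidean_space"
  assumes g: "g \<in> topspace (C_top K)"
  shows "(\<lambda>h. C_add K h g) \<in> measurable (borel_of (C_top K)) (borel_of (C_top K))"
proof (rule measurable_borel_ofI)
  fix U :: "('a \<Rightarrow> 'b) set" assume U: "openin (C_top K) U"
  have "openin (C_top K) ((\<lambda>h. C_add K h g) -` U \<inter> topspace (C_top K))"
    unfolding openin_C_top[OF compact_K K_ne]
  proof (intro conjI ballI)
    fix h assume h: "h \<in> (\<lambda>h. C_add K h g) -` U \<inter> topspace (C_top K)"
    then obtain r where r: "0 < r" "\<And>k. k \<in> topspace (C_top K) \<Longrightarrow> (\<forall>x\<in>K. dist (C_add K h g x) (k x) < r) \<Longrightarrow> k \<in> U"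
      using U unfolding openin_C_top[OF compact_K K_ne] by (metis IntD1 vimageD)
    show "\<exists>r>0. \<forall>k\<in>topspace (C_top K). (\<forall>x\<in>K. dist (h x) (k x) < r) \<longrightarrow> k \<in> (\<lambda>h. C_add K h g) -` U \<inter> topspace (C_top K)"
    proof (intro exI[of _ r] conjI ballI impI)
      fix k assume k: "k \<in> topspace (C_top K)" "\<forall>x\<in>K. dist (h x) (k x) < r"
      then have "C_add K k g \<in> U" using r(2)[OF C_add_topspace[OF k(1) g]] by (simp add: C_add_def)
      then show "k \<in> (\<lambda>h. C_add K h g) -` U \<inter> topspace (C_top K)" using k by simp
    qed (rule r)
  qed simp
  then show "(\<lambda>h. C_add K h g) -` U \<inter> space (borel_of (C_top K)) \<in> sets (borel_of (C_top K))"
    by (simp add: openin_in_borel_of)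
qed (rule Pi_I, simp add: C_add_topspace[OF _ g])

text \<open>\<open>\<nu>\<close> is the law of the random series. For each \<open>f\<close> the
  probabilities of the bad events are summable, so almost every outcome has a level from which on no
  deviation occurs, and \<open>frostman_series\<close> applies to it.\<close>

lemma good_maps_translates_prevalent:
  "\<exists>\<nu>. prob_space \<nu> \<and> sets \<nu> = sets (borel_of (C_top K :: ('a \<Rightarrow> 'b::euclidean_space) topology)) \<and>
    (\<forall>f\<in>topspace (C_top K). AE h in \<nu>. C_add K h f \<in> good_maps)"
proof -
  obtain \<Gamma> :: "nat \<Rightarrow> ('a \<Rightarrow> 'b) pmf" where gl: "good_levels \<Gamma>"
    using good_levels_exist by (rule exE)
  have \<Gamma>: "\<And>j. finite (set_pmf (\<Gamma> j))"
    "\<And>j g. g \<in> set_pmf (\<Gamma> j) \<Longrightarrow> continuous_on UNIV g"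
    "\<And>j g x. g \<in> set_pmf (\<Gamma> j) \<Longrightarrow> norm (g x) \<le> DIM('b) * (1/2) ^ Suc j"
    "\<And>j f. f \<in> borel_measurable borel \<Longrightarrow> measure_pmf.prob (\<Gamma> j)
      {g. \<exists>h. (\<forall>i<j. h i \<in> set_pmf (\<Gamma> i)) \<and> deviates j (\<lambda>x. f x + (\<Sum>i<j. h i x)) g} \<le> (1/2) ^ j"
    using gl by (simp_all add: good_levels_def)
  \<comment> \<open>Coding the finitely many maps of each level by natural numbers makes
    \<open>measurable_initial_segment\<close> applicable.\<close>
  define q :: "nat \<Rightarrow> nat pmf" where "q j = map_pmf (to_nat_on (set_pmf (\<Gamma> j))) (\<Gamma> j)" for j
  define dec where "dec j n = from_nat_into (set_pmf (\<Gamma> j)) n" for j n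
  have dec: "dec j n \<in> set_pmf (\<Gamma> j)" for j n
    unfolding dec_def by (rule from_nat_into) (rule set_pmf_not_empty)
  have map_dec: "map_pmf (dec j) (q j) = \<Gamma> j" for j
  proof -
    have "map_pmf (\<lambda>g. dec j (to_nat_on (set_pmf (\<Gamma> j)) g)) (\<Gamma> j) = map_pmf id (\<Gamma> j)"
      by (rule map_pmf_cong) (auto simp: dec_def \<Gamma>(1) countable_finite)
    then show ?thesis by (simp add: q_def map_pmf_comp map_pmf_id)
  qed
  define P where "P = PiM UNIV (\<lambda>j. measure_pmf (q j))"
  interpret P: product_prob_space "\<lambda>j. measure_pmf (q j)" UNIV
    by (rule product_prob_spaceI) (rule measure_pmf.prob_space_axioms)
  have probP: "prob_space P" unfolding P_def by (rule P.prob_space_axioms)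
  interpret PP: prob_space P by (rule probP)
  have spP [simp]: "space P = UNIV" by (simp add: P_def)
  define \<Phi> where "\<Phi> \<omega> = restrict (\<lambda>x. \<Sum>j. dec j (\<omega> j) x) K" for \<omega>
  define \<Psi> where "\<Psi> n xs = restrict (\<lambda>x. \<Sum>j<n. dec j (xs ! j) x) K" for n xs
  have dist\<Phi>: "dist (\<Psi> n (map \<omega> [0..<n]) x) (\<Phi> \<omega> x) \<le> DIM('b) * (1/2) ^ n" if "x \<in> K" for n \<omega> x
    using suminf_tail_norm_le(2)[of "\<lambda>j. dec j (\<omega> j) x" "DIM('b)" n] \<Gamma>(3)[OF dec] that
    by (simp add: \<Phi>_def \<Psi>_def dist_norm norm_minus_commute)
  have \<Psi>top: "\<Psi> n xs \<in> topspace (C_top K)" for n xs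
  proof -
    have "continuous_on UNIV (\<lambda>x. \<Sum>j<n. dec j (xs ! j) x)"
      by (intro continuous_on_sum \<Gamma>(2)[OF dec])
    then have "continuous_on K (\<lambda>x. \<Sum>j<n. dec j (xs ! j) x)" by (rule continuous_on_subset) simp
    then have "continuous_on K (\<Psi> n xs)" by (rule continuous_on_eq) (simp add: \<Psi>_def)
    then show ?thesis by (intro C_topI[OF compact_K]) (simp_all add: \<Psi>_def)
  qed
  have \<Phi>top: "\<Phi> \<omega> \<in> topspace (C_top K)" for \<omega>
  proof (rule C_topI[OF compact_K])
    have "continuous_on UNIV (\<lambda>x. \<Sum>j. dec j (\<omega> j) x)"
      by (rule continuous_on_suminf_half_pow[OF \<Gamma>(2)[OF dec] \<Gamma>(3)[OF dec]])
    then have "continuous_on K (\<lambda>x. \<Sum>j. dec j (\<omega> j) x)" by (rule continuous_on_subset) simp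
    then show "continuous_on K (\<Phi> \<omega>)" by (rule continuous_on_eq) (simp add: \<Phi>_def)
  qed (simp add: \<Phi>_def)
  have \<Phi>m: "\<Phi> \<in> measurable P (borel_of (C_top K))"
  proof (rule measurable_borel_ofI)
    fix U :: "('a \<Rightarrow> 'b) set" assume U: "openin (C_top K) U"
    \<comment> \<open>The random map lies in \<open>U\<close> iff for some \<open>n\<close> all maps
      within the tail bound of the \<open>n\<close>-th partial sum lie in \<open>U\<close>. This
      depends on an initial segment only.\<close>
    define Q where "Q n xs \<longleftrightarrow> (\<forall>k\<in>topspace (C_top K). (\<forall>x\<in>K. dist (\<Psi> n xs x) (k x) \<le> DIM('b) * (1/2) ^ n) \<longrightarrow> k \<in> U)" for n xs
    have "\<Phi> -` U \<inter> space P = (\<Union>n. (\<lambda>\<omega>. map \<omega> [0..<n]) -` {xs. Q n xs} \<inter> space P)"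
    proof safe
      fix \<omega> assume "\<Phi> \<omega> \<in> U"
      then obtain r where r: "0 < r" "\<And>k. k \<in> topspace (C_top K) \<Longrightarrow> (\<forall>x\<in>K. dist (\<Phi> \<omega> x) (k x) < r) \<Longrightarrow> k \<in> U"
        using U unfolding openin_C_top[OF compact_K K_ne] by metis
      obtain n where n: "2 * real DIM('b) * (1/2) ^ n < r" using half_pow_less[OF r(1)] by blast
      have "Q n (map \<omega> [0..<n])"
        unfolding Q_def
      proof (intro ballI impI)
        fix k assume k: "k \<in> topspace (C_top K)" "\<forall>x\<in>K. dist (\<Psi> n (map \<omega> [0..<n]) x) (k x) \<le> DIM('b) * (1/2) ^ n"
        have "dist (\<Phi> \<omega> x) (k x) < r" if "x \<in> K" for x
          using dist_triangle3[of "\<Phi> \<omega> x" "k x" "\<Psi> n (map \<omega> [0..<n]) x"] dist\<Phi>[OF that, of n \<omega>] k(2) that n by fastforce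
        then show "k \<in> U" using r(2) k(1) by blast
      qed
      then show "\<omega> \<in> (\<Union>n. (\<lambda>\<omega>. map \<omega> [0..<n]) -` {xs. Q n xs} \<inter> space P)" by auto
    next
      fix \<omega> n assume "Q n (map \<omega> [0..<n])"
      then show "\<omega> \<in> \<Phi> -` U" using dist\<Phi> \<Phi>top unfolding Q_def by blast
    qed
    also have "\<dots> \<in> sets P"
    proof (intro sets.countable_UN image_subsetI)
      show "(\<lambda>\<omega>. map \<omega> [0..<n]) -` {xs. Q n xs} \<inter> space P \<in> sets P" for n
        unfolding P_def by (rule measurable_sets[OF measurable_initial_segment]) simp
    qed
    finally show "\<Phi> -` U \<inter> space P \<in> sets P" .
  qed (use \<Phi>top in auto)
  define \<nu> where "\<nu> = distr P (borel_of (C_top K)) \<Phi>"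
  have "prob_space \<nu>" unfolding \<nu>_def by (rule PP.prob_space_distr[OF \<Phi>m])
  moreover have "sets \<nu> = sets (borel_of (C_top K))" by (simp add: \<nu>_def)
  moreover have "AE h in \<nu>. C_add K h f0 \<in> good_maps" if f0: "f0 \<in> topspace (C_top K)" for f0
  proof -
    have cf0: "continuous_on K f0" using f0 compact_K by (simp add: topspace_C_top)
    obtain B where B: "\<And>x. x \<in> K \<Longrightarrow> norm (f0 x) \<le> B"
      using compact_imp_bounded[OF compact_continuous_image[OF cf0 compact_K]] by (force simp: bounded_iff)
    have B0: "0 \<le> B" using B K_ne by (metis all_not_in_conv norm_ge_zero order_trans)
    have "closedin (top_of_set UNIV) K" using compact_K by (simp add: compact_imp_closed)
    \<comment> \<open>The densities are formed from maps on the whole space; the extension keeps the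
      bound \<open>B\<close>.\<close>
    from Tietze[OF cf0 this B0 B] obtain f where f: "continuous_on UNIV f" "\<And>x. x \<in> K \<Longrightarrow> f x = f0 x" "\<And>x. norm (f x) \<le> B"
      by (metis UNIV_I)
    have fm: "f \<in> borel_measurable borel" using f(1) by (rule borel_measurable_continuous_onI)
    define bad where "bad j = {g. \<exists>h. (\<forall>i<j. h i \<in> set_pmf (\<Gamma> i)) \<and> deviates j (\<lambda>x. f x + (\<Sum>i<j. h i x)) g}" for j
    define A where "A j = {\<omega>\<in>space P. \<omega> j \<in> dec j -` bad j}" for j
    have coord: "(\<lambda>\<omega>. \<omega> j) \<in> measurable P (measure_pmf (q j))" for j
      unfolding P_def by (rule measurable_component_singleton) simp
    have Am: "A j \<in> sets P" for j
      using measurable_sets[OF coord[of j], of "dec j -` bad j"] by (simp add: A_def vimage_def)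
    have pA: "measure P (A j) \<le> (1/2) ^ j" for j
    proof -
      have "measure P (A j) = measure (distr P (measure_pmf (q j)) (\<lambda>\<omega>. \<omega> j)) (dec j -` bad j)"
        using coord by (subst measure_distr) (auto simp: A_def vimage_def)
      also have "distr P (measure_pmf (q j)) (\<lambda>\<omega>. \<omega> j) = measure_pmf (q j)"
        unfolding P_def by (rule P.PiM_component) simp
      also have "measure_pmf.prob (q j) (dec j -` bad j) = measure_pmf.prob (map_pmf (dec j) (q j)) (bad j)" by simp
      also have "\<dots> \<le> (1/2) ^ j" unfolding map_dec bad_def by (rule \<Gamma>(4)[OF fm])
      finally show ?thesis .
    qed
    have "AE \<omega> in P. \<forall>\<^sub>F j in sequentially. \<omega> \<in> space P - A j"
    proof (rule borel_cantelli_AE1[OF Am])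
      show "summable (\<lambda>j. measure P (A j))"
        by (rule summable_comparison_test'[OF summable_geometric[of "1/2 :: real"], of 0]) (use pA in auto)
    qed (simp add: PP.emeasure_eq_measure)
    then have "AE \<omega> in P. C_add K (\<Phi> \<omega>) f0 \<in> good_maps"
    proof eventually_elim
      case (elim \<omega>)
      then obtain J0 where J0: "\<And>j. J0 \<le> j \<Longrightarrow> \<omega> \<notin> A j" by (auto simp: eventually_sequentially)
      define J where "J = max J0 (nat \<lceil>B + 2 * DIM('b)\<rceil>)"
      define g where "g j = dec j (\<omega> j)" for j
      have nb: "\<not> deviates j (\<lambda>x. f x + (\<Sum>i<j. g i x)) (g j)" if "J \<le> j" for j
      proof
        assume "deviates j (\<lambda>x. f x + (\<Sum>i<j. g i x)) (g j)"
        then have "g j \<in> bad j" unfolding bad_def by (intro CollectI exI[of _ g]) (simp add: g_def dec)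
        then have "\<omega> \<in> A j" by (simp add: A_def g_def)
        then show False using J0[of j] that by (simp add: J_def)
      qed
      have BJ: "B + 2 * DIM('b) \<le> J" unfolding J_def by linarith
      have g1: "continuous_on UNIV (g j)" for j unfolding g_def by (rule \<Gamma>(2)[OF dec])
      have g2: "norm (g j x) \<le> DIM('b) * (1/2) ^ Suc j" for j x unfolding g_def by (rule \<Gamma>(3)[OF dec])
      interpret S: frostman_series \<mu> K s C f g J
        by (rule frostman_series_if_not_deviates[OF f(1,3) g1 g2 BJ nb])
      define h where "h = C_add K (\<Phi> \<omega>) f0"
      have htop: "h \<in> topspace (C_top K)" unfolding h_def by (rule C_add_topspace[OF \<Phi>top f0])
      have "h x = S.limit_map x" if "x \<in> K" for x
        using that f(2) by (simp add: h_def C_add_def \<Phi>_def S.limit_map_def g_def)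
      then have "good_pts m h = good_pts m S.limit_map" for m
        unfolding good_pts_def fat_def by (intro Collect_cong conj_cong refl) (simp cong: conj_cong)
      then have "h \<in> good_maps" using htop S.good_pts_limit_map unfolding good_maps_def by simp
      then show ?case by (simp add: h_def)
    qed
    moreover have "{h \<in> space (borel_of (C_top K)). C_add K h f0 \<in> good_maps} \<in> sets (borel_of (C_top K))"
      using measurable_sets[OF measurable_C_add[OF f0] good_maps_borel] by (simp add: vimage_def Int_def conj_commute)
    ultimately show ?thesis unfolding \<nu>_def by (subst AE_distr_iff[OF \<Phi>m]) auto
  qed
  ultimately show ?thesis by blast
qed

text \<open>The translate of the complement of \<open>good_maps\<close> by \<open>f\<close> is its
  preimage under the translation by \<open>- f\<close>; hence it is Borel, and null by the almost
  sure statement for \<open>- f\<close>.\<close>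

lemma prevalent_if_good_maps:
  fixes Q :: "('a \<Rightarrow> 'b::euclidean_space) \<Rightarrow> bool"
  assumes "\<And>f. f \<in> good_maps \<Longrightarrow> Q f"
  shows "prevalent_in_C K Q"
proof -
  let ?T = "topspace (C_top K) :: ('a \<Rightarrow> 'b) set"
  obtain \<nu> where \<nu>: "prob_space \<nu>" "sets \<nu> = sets (borel_of (C_top K :: ('a \<Rightarrow> 'b) topology))"
    "\<And>f. f \<in> ?T \<Longrightarrow> AE h in \<nu>. C_add K h f \<in> good_maps"
    using good_maps_translates_prevalent[where 'b = 'b] by (elim exE conjE) (rule that; blast)
  define A where "A = ?T - good_maps"
  have sp: "space \<nu> = ?T" using sets_eq_imp_space_eq[OF \<nu>(2)] by simp
  have Am: "A \<in> sets (borel_of (C_top K))"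
    using sets.compl_sets[OF good_maps_borel] by (simp add: A_def)
  have "(\<lambda>h. C_add K h f) ` A \<in> null_sets \<nu>" if f: "f \<in> ?T" for f
  proof -
    define f' where "f' = restrict (\<lambda>x. - f x) K"
    have "continuous_on K (\<lambda>x. - f x)" using f compact_K by (intro continuous_on_minus) (simp add: topspace_C_top)
    then have "continuous_on K f'" by (rule continuous_on_eq) (simp add: f'_def)
    then have f': "f' \<in> ?T" by (intro C_topI[OF compact_K]) (simp_all add: f'_def)
    have cancel: "C_add K (C_add K h f) f' = h" "C_add K (C_add K h f') f = h" if "h \<in> ?T" for h
      using that compact_K by (auto simp: C_add_def f'_def topspace_C_top extensional_def restrict_def fun_eq_iff)
    have eq: "(\<lambda>h. C_add K h f) ` A = (\<lambda>h. C_add K h f') -` A \<inter> space (borel_of (C_top K))"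
    proof (intro subset_antisym subsetI)
      fix k assume "k \<in> (\<lambda>h. C_add K h f) ` A"
      then obtain h where h: "h \<in> A" "k = C_add K h f" by blast
      then show "k \<in> (\<lambda>h. C_add K h f') -` A \<inter> space (borel_of (C_top K))"
        using cancel[of h] C_add_topspace[OF _ f, of h] by (simp add: A_def)
    next
      fix h assume "h \<in> (\<lambda>h. C_add K h f') -` A \<inter> space (borel_of (C_top K))"
      then show "h \<in> (\<lambda>h. C_add K h f) ` A"
        using cancel[of h] by (intro image_eqI[of _ _ "C_add K h f'"]) simp_all
    qed
    have "AE h in \<nu>. h \<notin> (\<lambda>h. C_add K h f') -` A \<inter> space (borel_of (C_top K))"
      using \<nu>(3)[OF f'] by eventually_elim (auto simp: A_def)
    then show ?thesis
      unfolding eq using measurable_sets[OF measurable_C_add[OF f'] Am] \<nu>(2)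
      by (subst AE_iff_null_sets) simp_all
  qed
  then have "shy (C_top K) (C_add K) (?T - {f \<in> ?T. Q f})"
    unfolding shy_def using \<nu>(1,2) Am assms by (intro conjI exI[of _ A] exI[of _ \<nu>]) (auto simp: A_def)
  then show ?thesis unfolding prevalent_in_C_def prevalent_def by auto
qed

end

context ahlfors_regular
begin

text \<open>One \<open>U\<close> serves both measures and both dimensions. The exceptional set is
  compact, so being null for \<open>\<mu>\<close> makes it null for both measures. Density in the
  image holds because small balls about points of \<open>K\<close> have positive mass.\<close>

lemma good_maps_conclusion:
  fixes f :: "'a \<Rightarrow> 'b::euclidean_space"
  assumes "f \<in> good_maps"
  obtains U where "open U" "hausdorff_measure s {x \<in> K. f x \<in> U} = hausdorff_measure s K"
    "packing_measure s {x \<in> K. f x \<in> U} = packing_measure s K" "f ` K \<subseteq> closure (U \<inter> f ` K)"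
    "\<And>y. y \<in> U \<Longrightarrow> hausdorff_dim {x \<in> K. f x = y} = ereal s"
    "\<And>y. y \<in> U \<Longrightarrow> packing_dim {x \<in> K. f x = y} = ereal s"
proof -
  obtain U where U: "open U" "prob (K \<inter> f -` U) = 1" "closed (K - f -` U)"
    "\<And>y. y \<in> U \<Longrightarrow> ereal s \<le> hausdorff_dim {x\<in>K. f x = y}"
    using good_maps_open_set[OF assms] by blast
  have cont: "continuous_on K f" using assms by (auto simp: good_maps_def topspace_C_top compact_K)
  define E where "E = K - f -` U"
  have "compact (K \<inter> E)" using compact_K U(3) unfolding E_def by (rule compact_Int_closed)
  moreover have "K \<inter> E = E" by (auto simp: E_def)
  ultimately have cE: "compact E" by simp
  have EK: "E \<subseteq> K" by (auto simp: E_def)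
  have Km: "K \<in> sets borel" and Em: "E \<in> sets borel" using compact_K cE by (auto simp: borel_compact)
  have "K - E = K \<inter> f -` U" by (auto simp: E_def)
  moreover have "prob (K - E) = prob K - prob E" using Km Em EK by (intro finite_measure_Diff) auto
  ultimately have pE: "prob E = 0" using U(2) prob_K by simp
  have S: "{x \<in> K. f x \<in> U} = K \<inter> f -` U" by auto
  have KE: "K \<subseteq> {x \<in> K. f x \<in> U} \<union> E" by (auto simp: E_def)
  have "hausdorff_measure s K \<le> hausdorff_measure s {x \<in> K. f x \<in> U} + hausdorff_measure s E"
    by (rule order_trans[OF hausdorff_measure_mono[OF KE] hausdorff_measure_subadditive])
  moreover have "hausdorff_measure s {x \<in> K. f x \<in> U} \<le> hausdorff_measure s K"
    by (rule hausdorff_measure_mono) auto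
  ultimately have 1: "hausdorff_measure s {x \<in> K. f x \<in> U} = hausdorff_measure s K"
    using hausdorff_measure_null[OF cE EK pE] by (simp add: antisym)
  have "packing_measure s K \<le> packing_measure s {x \<in> K. f x \<in> U}"
    by (rule order_trans[OF packing_measure_mono[OF KE] packing_measure_Un_null[OF packing_premeasure_null[OF cE EK pE]]])
  moreover have "packing_measure s {x \<in> K. f x \<in> U} \<le> packing_measure s K"
    by (rule packing_measure_mono) auto
  ultimately have 2: "packing_measure s {x \<in> K. f x \<in> U} = packing_measure s K"
    by (simp add: antisym)
  have 3: "f ` K \<subseteq> closure (U \<inter> f ` K)"
  proof safe
    fix x assume x: "x \<in> K"
    show "f x \<in> closure (U \<inter> f ` K)"
      unfolding closure_approachable
    proof (intro allI impI)
      fix e :: real assume "0 < e"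
      then obtain d where d: "0 < d" "\<And>z. z \<in> K \<Longrightarrow> dist z x < d \<Longrightarrow> dist (f z) (f x) < e"
        using cont x unfolding continuous_on_iff by metis
      define \<delta> where "\<delta> = min 1 (d / 2)"
      have \<delta>: "0 < \<delta>" "\<delta> \<le> 1" "\<delta> < d" using d(1) by (auto simp: \<delta>_def)
      have "0 < c * \<delta> powr s" using c_pos \<delta> by simp
      also have "\<dots> \<le> prob (cball x \<delta>)" using x \<delta> by (intro prob_cball_ge) auto
      finally have pos: "0 < prob (cball x \<delta>)" .
      have "\<exists>z\<in>K. f z \<in> U \<and> z \<in> cball x \<delta>"
      proof (rule ccontr)
        assume "\<not> ?thesis"
        then have "cball x \<delta> \<inter> K \<subseteq> E" by (auto simp: E_def)
        then have "prob (cball x \<delta>) \<le> prob E" using Em by (intro prob_mono_K) auto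
        then show False using pos pE by simp
      qed
      then obtain z where "z \<in> K" "f z \<in> U" "dist z x < d" using \<delta>(3) by (auto simp: dist_commute)
      then show "\<exists>y\<in>U \<inter> f ` K. dist y (f x) < e" using d(2) by blast
    qed
  qed
  have sub: "{x \<in> K. f x = y} \<subseteq> K" for y by auto
  show thesis
  proof (rule that[OF U(1) 1 2 3])
    fix y assume "y \<in> U"
    then show "hausdorff_dim {x \<in> K. f x = y} = ereal s" "packing_dim {x \<in> K. f x = y} = ereal s"
      using U(4) hausdorff_dim_le_s[OF sub] packing_dim_eq_s[OF sub] by (auto intro: antisym)
  qed
qed

lemma prevalent_hausdorff_fibers:
  "prevalent_in_C K (\<lambda>f :: 'a \<Rightarrow> 'b::euclidean_space. \<exists>U. open U \<and>
    hausdorff_measure s {x \<in> K. f x \<in> U} = hausdorff_measure s K \<and>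
    f ` K \<subseteq> closure (U \<inter> f ` K) \<and> (\<forall>y\<in>U. hausdorff_dim {x \<in> K. f x = y} = ereal s))"
proof (rule prevalent_if_good_maps)
  fix f :: "'a \<Rightarrow> 'b" assume "f \<in> good_maps"
  then show "\<exists>U. open U \<and> hausdorff_measure s {x \<in> K. f x \<in> U} = hausdorff_measure s K \<and>
    f ` K \<subseteq> closure (U \<inter> f ` K) \<and> (\<forall>y\<in>U. hausdorff_dim {x \<in> K. f x = y} = ereal s)"
    by (rule good_maps_conclusion) (intro exI conjI ballI; assumption | simp only:)
qed

lemma prevalent_packing_fibers:
  "prevalent_in_C K (\<lambda>f :: 'a \<Rightarrow> 'b::euclidean_space. \<exists>U. open U \<and>
    packing_measure s {x \<in> K. f x \<in> U} = packing_measure s K \<and>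
    f ` K \<subseteq> closure (U \<inter> f ` K) \<and> (\<forall>y\<in>U. packing_dim {x \<in> K. f x = y} = ereal s))"
proof (rule prevalent_if_good_maps)
  fix f :: "'a \<Rightarrow> 'b" assume "f \<in> good_maps"
  then show "\<exists>U. open U \<and> packing_measure s {x \<in> K. f x \<in> U} = packing_measure s K \<and>
    f ` K \<subseteq> closure (U \<inter> f ` K) \<and> (\<forall>y\<in>U. packing_dim {x \<in> K. f x = y} = ereal s)"
    by (rule good_maps_conclusion) (intro exI conjI ballI; assumption | simp only:)
qed

lemma packing_dim_K: "packing_dim K = ereal s"
  by (rule packing_dim_eq_s) (simp_all add: hausdorff_dim_K)

end

section \<open>Self-similar sets\<close>

text \<open>After subtraction of \<open>F 0\<close> the map scales norms, hence is linear and
  injective. Surjectivity serves to find balls inside the images of an open set.\<close>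

lemma similarity_surj:
  fixes F :: "'a::euclidean_space \<Rightarrow> 'a"
  assumes "0 < r" "\<And>x y. dist (F x) (F y) = r * dist x y"
  shows "surj F"
proof -
  define f where "f x = F x - F 0" for x
  have "dist (f x) (f y) = r * dist x y" for x y using assms(2)[of x y] by (simp add: f_def dist_norm)
  then have lin: "linear f" by (intro scaling_linear[of f r]) (auto simp: f_def)
  have "inj f"
  proof (rule injI)
    fix x y assume "f x = f y"
    then have "r * dist x y = 0" using assms(2)[of x y] by (simp add: f_def dist_norm)
    then show "x = y" using assms(1) by simp
  qed
  then have "surj f" using lin by (intro linear_injective_imp_surjective) simp_all
  have "\<exists>x. y = F x" for y
  proof -
    obtain x where "y - F 0 = f x" using \<open>surj f\<close> by (metis surjD)
    then show ?thesis by (intro exI[of _ x]) (simp add: f_def)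
  qed
  then show ?thesis by (auto simp: surj_def)
qed

text \<open>The Moran equation, by the intermediate value theorem: the sum is \<open>k\<close> at
  exponent 0 and at most 1 at an exponent \<open>n\<close> with
  \<open>\<rho> ^ n < 1 / k\<close>.\<close>

lemma similarity_dimension_exists:
  fixes r :: "nat \<Rightarrow> real"
  assumes k: "2 \<le> k" and r: "\<And>i. i < k \<Longrightarrow> 0 < r i \<and> r i < 1"
  obtains s where "0 < s" "(\<Sum>i<k. r i powr s) = 1"
proof -
  define \<rho> where "\<rho> = Max (r ` {..<k})"
  have fin: "finite (r ` {..<k})" "r ` {..<k} \<noteq> {}" using k by (auto simp: lessThan_empty_iff)
  have "\<rho> \<in> r ` {..<k}" unfolding \<rho>_def by (rule Max_in[OF fin])
  then have \<rho>: "0 < \<rho>" "\<rho> < 1" using r by auto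
  have r\<rho>: "r i \<le> \<rho>" if "i < k" for i unfolding \<rho>_def using that by (intro Max_ge) auto
  obtain n where n: "\<rho> ^ n < 1 / k" using real_arch_pow_inv[of "1 / k" \<rho>] \<rho> k by auto
  have "(\<Sum>i<k. r i powr real n) \<le> (\<Sum>i<k. 1 / k)"
  proof (rule sum_mono)
    fix i assume i: "i \<in> {..<k}"
    have "r i powr n = r i ^ n" using r i by (simp add: powr_realpow)
    also have "\<dots> \<le> \<rho> ^ n" using r r\<rho> i by (intro power_mono) (auto intro: less_imp_le)
    finally show "r i powr n \<le> 1 / k" using n by simp
  qed
  also have "\<dots> = 1" using k by simp
  finally have le: "(\<Sum>i<k. r i powr real n) \<le> 1" .
  have r0: "r i \<noteq> 0" if "i < k" for i using r[OF that] by simp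
  have ge: "(\<Sum>i<k. r i powr 0) = k" using r0 by simp
  have "\<exists>s. 0 \<le> s \<and> s \<le> real n \<and> (\<Sum>i<k. r i powr s) = 1"
  proof (rule IVT2)
    show "\<forall>s. 0 \<le> s \<and> s \<le> real n \<longrightarrow> isCont (\<lambda>s. \<Sum>i<k. r i powr s) s"
      using r0 by (auto intro!: continuous_intros)
  qed (use le ge k in auto)
  then obtain s where s: "0 \<le> s" "(\<Sum>i<k. r i powr s) = 1" by blast
  moreover have "s \<noteq> 0" using s(2) ge k by auto
  ultimately have "0 < s" by simp
  then show ?thesis using s(2) by (rule that)
qed

lemma separated_card_bounded:
  fixes R b :: real
  assumes "0 < b"
  obtains N where "\<And>S :: 'a::euclidean_space set. S \<subseteq> cball 0 R \<Longrightarrow>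
    (\<And>x y. x \<in> S \<Longrightarrow> y \<in> S \<Longrightarrow> x \<noteq> y \<Longrightarrow> b \<le> dist x y) \<Longrightarrow> finite S \<and> card S \<le> N"
proof -
  have "0 < b / 2" using assms by simp
  then obtain X where X: "finite X" "cball (0::'a) R \<subseteq> (\<Union>x\<in>X. ball x (b / 2))"
    using compact_cball[of "0::'a" R] unfolding compact_eq_totally_bounded by blast
  show thesis
  proof (rule that[of "card X"])
    fix S :: "'a set" assume S: "S \<subseteq> cball 0 R" "\<And>x y. x \<in> S \<Longrightarrow> y \<in> S \<Longrightarrow> x \<noteq> y \<Longrightarrow> b \<le> dist x y"
    have "\<forall>z\<in>S. \<exists>x\<in>X. z \<in> ball x (b / 2)" using S(1) X(2) by blast
    then obtain c where c: "\<And>z. z \<in> S \<Longrightarrow> c z \<in> X" "\<And>z. z \<in> S \<Longrightarrow> z \<in> ball (c z) (b / 2)" by metis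
    have "inj_on c S"
    proof (rule inj_onI, rule ccontr)
      fix x y assume xy: "x \<in> S" "y \<in> S" "c x = c y" "x \<noteq> y"
      then have "dist x y < b / 2 + b / 2"
        using c(2)[of x] c(2)[of y] dist_triangle3[of x y "c x"] by simp
      then show False using S(2)[of x y] xy by simp
    qed
    moreover have "c ` S \<subseteq> X" using c(1) by blast
    ultimately show "finite S \<and> card S \<le> card X" using X(1) by (meson card_inj_on_le inj_on_finite)
  qed
qed

locale osc_ifs =
  fixes k :: nat and F :: "nat \<Rightarrow> 'a::euclidean_space \<Rightarrow> 'a" and r :: "nat \<Rightarrow> real" and K V :: "'a set" and s :: real
  assumes k: "2 \<le> k" and ratio: "\<And>i. i < k \<Longrightarrow> 0 < r i \<and> r i < 1"
    and sim: "\<And>i x y. i < k \<Longrightarrow> dist (F i x) (F i y) = r i * dist x y"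
    and compact_K: "compact K" and K_ne: "K \<noteq> {}" and K_eq: "K = (\<Union>i<k. F i ` K)"
    and V_ne: "V \<noteq> {}" and bounded_V: "bounded V" and open_V: "open V"
    and V_sub: "(\<Union>i<k. F i ` V) \<subseteq> V" and V_disj: "disjoint_family_on (\<lambda>i. F i ` V) {..<k}"
    and s_pos: "0 < s" and sum_1: "(\<Sum>i<k. r i powr s) = 1"
begin

section \<open>Words, cylinders and cuts\<close>

primrec Fw :: "nat list \<Rightarrow> 'a \<Rightarrow> 'a" where
  "Fw [] x = x"
| "Fw (i # u) x = F i (Fw u x)"

definition rw :: "nat list \<Rightarrow> real" where "rw u = prod_list (map r u)"

abbreviation W where "W \<equiv> lists {..<k}"

lemma rw_simps [simp]: "rw [] = 1" "rw (i # u) = r i * rw u" "rw (u @ v) = rw u * rw v"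
  by (simp_all add: rw_def)

lemma Fw_append: "Fw (u @ v) x = Fw u (Fw v x)"
  by (induction u) auto

lemma rw_pos: "u \<in> W \<Longrightarrow> 0 < rw u"
  by (induction u) (use ratio in auto)

lemma rw_le_1: "u \<in> W \<Longrightarrow> rw u \<le> 1"
proof (induction u)
  case (Cons i u)
  then have "r i * rw u \<le> 1 * 1"
    using ratio[of i] rw_pos[of u] by (intro mult_mono) auto
  then show ?case by simp
qed simp

lemma dist_Fw: "u \<in> W \<Longrightarrow> dist (Fw u x) (Fw u y) = rw u * dist x y"
  by (induction u) (auto simp: sim)

lemma Fw_K: "u \<in> W \<Longrightarrow> x \<in> K \<Longrightarrow> Fw u x \<in> K"
  by (induction u) (use K_eq in auto)

lemma Fw_V: "u \<in> W \<Longrightarrow> x \<in> V \<Longrightarrow> Fw u x \<in> V"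
  by (induction u) (use V_sub in auto)

lemma surj_Fw: "u \<in> W \<Longrightarrow> surj (Fw u)"
proof (induction u)
  case (Cons i u)
  then have "i < k" by simp
  then have "surj (F i)" using ratio sim by (intro similarity_surj[of "r i"]) auto
  moreover have "surj (Fw u)" using Cons by simp
  ultimately have "surj (F i \<circ> Fw u)" by (rule comp_surj[rotated])
  moreover have "F i \<circ> Fw u = Fw (i # u)" by auto
  ultimately show ?case by simp
qed simp

lemma ball_Fw:
  assumes "u \<in> W" "ball z a \<subseteq> V" shows "ball (Fw u z) (rw u * a) \<subseteq> Fw u ` V"
proof
  fix y assume y: "y \<in> ball (Fw u z) (rw u * a)"
  obtain x where x: "y = Fw u x" using surj_Fw[OF assms(1)] by (metis surjD)
  have "x \<in> ball z a" using y x rw_pos[OF assms(1)] by (simp add: dist_Fw[OF assms(1)])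
  then show "y \<in> Fw u ` V" using assms(2) x by blast
qed

text \<open>Incomparable words differ at some letter. There the open set condition separates them,
  and the common prefix acts injectively.\<close>

lemma Fw_V_disjoint:
  "u \<in> W \<Longrightarrow> v \<in> W \<Longrightarrow> (\<And>w. v \<noteq> u @ w) \<Longrightarrow> (\<And>w. u \<noteq> v @ w) \<Longrightarrow> Fw u ` V \<inter> Fw v ` V = {}"
proof (induction u arbitrary: v)
  case (Cons i u)
  show ?case
  proof (cases v)
    case (Cons j v')
    have ij: "i < k" "j < k" "u \<in> W" "v' \<in> W" using Cons.prems Cons by auto
    show ?thesis
    proof (cases "i = j")
      case True
      have "Fw u ` V \<inter> Fw v' ` V = {}"
        using Cons.prems(3,4) ij True Cons by (intro Cons.IH) auto
      moreover have "x = y" if "F i x = F i y" for x y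
        using sim[of i x y] that ij ratio[of i] by simp
      ultimately show ?thesis using True Cons by auto
    next
      case False
      have "F i ` V \<inter> F j ` V = {}" using V_disj ij False by (auto simp: disjoint_family_on_def)
      moreover have "Fw (i # u) ` V \<subseteq> F i ` V" "Fw v ` V \<subseteq> F j ` V"
        using Fw_V ij Cons by auto
      ultimately show ?thesis by blast
    qed
  qed (use Cons.prems in auto)
qed auto

text \<open>The words stopped when their ratio first drops to \<open>q\<close> or below, so that all
  their cylinders have size comparable to \<open>q\<close>.\<close>

definition cut :: "real \<Rightarrow> nat list set" where
  "cut q = {u \<in> W. u \<noteq> [] \<and> rw u \<le> q \<and> q < rw (butlast u)}"

lemma cut_prefix_free:
  assumes "u \<in> cut q" "v \<in> cut q" "v = u @ w" shows "v = u"
proof (rule ccontr)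
  assume "v \<noteq> u"
  then have "w \<noteq> []" using assms(3) by auto
  then have bl: "butlast v = u @ butlast w" using assms(3) by (simp add: butlast_append)
  have "butlast w \<in> W" using assms by (auto simp: cut_def dest: in_set_butlastD)
  then have "rw u * rw (butlast w) \<le> rw u * 1"
    using rw_le_1 rw_pos[of u] assms(1) by (intro mult_left_mono) (auto simp: cut_def)
  then show False using assms(1,2) bl by (auto simp: cut_def)
qed

definition rmin :: real where "rmin = Min (r ` {..<k})"

lemma rmin: "0 < rmin" "rmin < 1" "i < k \<Longrightarrow> rmin \<le> r i"
proof -
  have "rmin \<in> r ` {..<k}" unfolding rmin_def using k by (intro Min_in) (auto simp: lessThan_empty_iff)
  then show "0 < rmin" "rmin < 1" using ratio by auto
  show "i < k \<Longrightarrow> rmin \<le> r i" unfolding rmin_def by (intro Min_le) auto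
qed

definition rmax :: real where "rmax = Max (r ` {..<k})"

lemma rmax: "0 < rmax" "rmax < 1" "i < k \<Longrightarrow> r i \<le> rmax"
proof -
  have "rmax \<in> r ` {..<k}" unfolding rmax_def using k by (intro Max_in) (auto simp: lessThan_empty_iff)
  then show "0 < rmax" "rmax < 1" using ratio by auto
  show "i < k \<Longrightarrow> r i \<le> rmax" unfolding rmax_def by (intro Max_ge) auto
qed

lemma rw_le_rmax: "u \<in> W \<Longrightarrow> rw u \<le> rmax ^ length u"
proof (induction u)
  case (Cons i u)
  then have "r i * rw u \<le> rmax * rmax ^ length u"
    using rmax ratio[of i] rw_pos[of u] by (intro mult_mono) auto
  then show ?case by simp
qed simp

lemma cut_rw_ge:
  assumes "u \<in> cut q" "0 < q" shows "rmin * q \<le> rw u"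
proof -
  have u: "u = butlast u @ [last u]" "u \<in> W" using assms by (auto simp: cut_def)
  then have "last u < k" "butlast u \<in> W" by (metis append_in_lists_conv Cons_in_lists_iff lessThan_iff)+
  then have "rmin \<le> r (last u)" "q < rw (butlast u)" using rmin assms by (auto simp: cut_def)
  then have "q * rmin \<le> rw (butlast u) * r (last u)" using assms rmin(1) by (intro mult_mono) auto
  also have "\<dots> = rw u" by (subst (3) u(1)) simp
  finally show ?thesis by (simp add: mult.commute)
qed

text \<open>Induction on \<open>n\<close>: if the ratio of the first letter is at most
  \<open>q\<close>, that letter alone suffices; otherwise the preimage point is treated at the
  larger scale \<open>q / r i\<close>.\<close>

lemma word_at_scale:
  "0 < q \<Longrightarrow> q \<le> 1 \<Longrightarrow> rmax ^ n \<le> q \<Longrightarrow> x \<in> K \<Longrightarrow> \<exists>u\<in>W. x \<in> Fw u ` K \<and> rmin * q \<le> rw u \<and> rw u \<le> q"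
proof (induction n arbitrary: q x)
  case 0
  then have "q = 1" by simp
  then show ?case using 0 rmin(2) by (intro bexI[of _ "[]"]) auto
next
  case (Suc n)
  obtain i x' where i: "i < k" "x' \<in> K" "x = F i x'"
    using Suc.prems(4) K_eq by (metis (no_types, lifting) UN_E imageE lessThan_iff)
  show ?case
  proof (cases "r i \<le> q")
    case True
    have "rmin * q \<le> r i"
      using rmin Suc.prems(1,2) mult_left_le[of q rmin] i(1) by (meson less_imp_le order_trans)
    then show ?thesis using True i by (intro bexI[of _ "[i]"]) auto
  next
    case False
    have ri: "0 < r i" "r i \<le> rmax" using ratio rmax i by auto
    have "rmax ^ Suc n \<le> q" by fact
    then have "rmax ^ n \<le> q / rmax" using rmax(1) by (simp add: field_simps)
    also have "\<dots> \<le> q / r i" using ri Suc.prems by (intro divide_left_mono) auto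
    finally have "\<exists>u\<in>W. x' \<in> Fw u ` K \<and> rmin * (q / r i) \<le> rw u \<and> rw u \<le> q / r i"
      using ri False Suc.prems i by (intro Suc.IH) auto
    then obtain u where u: "u \<in> W" "x' \<in> Fw u ` K" "rmin * (q / r i) \<le> rw u" "rw u \<le> q / r i" by blast
    then have "rmin * q \<le> r i * rw u" "r i * rw u \<le> q" using ri by (auto simp: field_simps)
    then show ?thesis using u i by (intro bexI[of _ "i # u"]) auto
  qed
qed

text \<open>The points \<open>Fw u z\<close> for the words \<open>u\<close> of a cut are separated at the scale of the cut, by the
  open set condition.\<close>

lemma cut_near_bounded:
  obtains N :: nat where "\<And>x q. 0 < q \<Longrightarrow> finite {u \<in> cut q. Fw u ` K \<inter> cball x q \<noteq> {}} \<and>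
    card {u \<in> cut q. Fw u ` K \<inter> cball x q \<noteq> {}} \<le> N"
proof -
  obtain z where z: "z \<in> V" using V_ne by blast
  obtain a where a: "0 < a" "ball z a \<subseteq> V" using open_V z open_contains_ball by blast
  obtain D where D: "\<And>y. y \<in> K \<Longrightarrow> dist z y \<le> D"
    using compact_imp_bounded[OF compact_K] by (meson bounded_any_center)
  have "0 < a * rmin" using a rmin by simp
  then obtain N where N: "\<And>S :: 'a set. S \<subseteq> cball 0 (D + 1) \<Longrightarrow>
    (\<And>x y. x \<in> S \<Longrightarrow> y \<in> S \<Longrightarrow> x \<noteq> y \<Longrightarrow> a * rmin \<le> dist x y) \<Longrightarrow> finite S \<and> card S \<le> N"
    using separated_card_bounded[of "a * rmin" "D + 1"] by metis
  show thesis
  proof (rule that[of N])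
    fix x q assume q: "(0::real) < q"
    define A where "A = {u \<in> cut q. Fw u ` K \<inter> cball x q \<noteq> {}}"
    \<comment> \<open>Rescaling by \<open>1 / q\<close> puts the points into a fixed ball with a
      fixed separation, so that \<open>N\<close> depends on neither \<open>x\<close> nor
      \<open>q\<close>.\<close>
    define pt where "pt u = (1 / q) *\<^sub>R (Fw u z - x)" for u
    have sep: "a * rmin \<le> dist (pt u) (pt v)" if uv: "u \<in> A" "v \<in> A" "u \<noteq> v" for u v
    proof -
      have W: "u \<in> cut q" "v \<in> cut q" "u \<in> W" "v \<in> W" using uv by (auto simp: A_def cut_def)
      have "Fw u ` V \<inter> Fw v ` V = {}"
        using W cut_prefix_free uv(3) by (intro Fw_V_disjoint) metis+
      then have "Fw v z \<notin> ball (Fw u z) (rw u * a)" using ball_Fw[OF W(3) a(2)] z by blast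
      then have "rw u * a \<le> dist (Fw u z) (Fw v z)" by (simp add: not_less)
      moreover have "rmin * q * a \<le> rw u * a" using cut_rw_ge[OF W(1) q] a by (intro mult_right_mono) auto
      moreover have "dist (pt u) (pt v) = dist (Fw u z) (Fw v z) / q"
        using q by (simp add: pt_def dist_norm scaleR_diff_right[symmetric])
      ultimately have "rmin * q * a / q \<le> dist (pt u) (pt v)" using q divide_right_mono[of "rmin * q * a" "dist (Fw u z) (Fw v z)" q] by linarith
      then show ?thesis using q by (simp add: mult.commute)
    qed
    have inj: "inj_on pt A" using sep \<open>0 < a * rmin\<close> by (intro inj_onI) (metis dist_self not_le)
    have "pt ` A \<subseteq> cball 0 (D + 1)"
    proof safe
      fix u assume "u \<in> A"
      then obtain y where y: "y \<in> K" "dist x (Fw u y) \<le> q" "u \<in> W" "rw u \<le> q" by (auto simp: A_def cut_def)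
      have "dist (Fw u z) x \<le> dist (Fw u z) (Fw u y) + dist x (Fw u y)" by (rule dist_triangle2)
      also have "dist (Fw u z) (Fw u y) \<le> q * D"
        unfolding dist_Fw[OF y(3)] using D[OF y(1)] y(4) q by (intro mult_mono) auto
      finally have "dist (Fw u z) x \<le> q * (D + 1)" using y(2) by (simp add: algebra_simps)
      moreover have "norm (pt u) = dist (Fw u z) x / q" using q by (simp add: pt_def dist_norm)
      ultimately have "norm (pt u) \<le> D + 1" using q by (simp add: divide_le_eq mult.commute)
      then show "pt u \<in> cball 0 (D + 1)" by simp
    qed
    then have "finite (pt ` A) \<and> card (pt ` A) \<le> N" using sep by (intro N) auto
    then show "finite {u \<in> cut q. Fw u ` K \<inter> cball x q \<noteq> {}} \<and> card {u \<in> cut q. Fw u ` K \<inter> cball x q \<noteq> {}} \<le> N"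
      using inj unfolding A_def[symmetric] by (simp add: card_image finite_image_iff)
  qed
qed

section \<open>The natural measure and its Ahlfors regularity\<close>

definition symbol_pmf :: "nat pmf" where
  "symbol_pmf = embed_pmf (\<lambda>i. if i < k then r i powr s else 0)"

lemma pmf_symbol: "pmf symbol_pmf i = (if i < k then r i powr s else 0)"
  unfolding symbol_pmf_def
proof (rule pmf_embed_pmf)
  have "(\<integral>\<^sup>+ x. ennreal (if x < k then r x powr s else 0) \<partial>count_space UNIV) =
      (\<Sum>x<k. ennreal (if x < k then r x powr s else 0))"
    by (rule nn_integral_count_space') auto
  also have "\<dots> = ennreal (\<Sum>x<k. r x powr s)" by (subst sum_ennreal[symmetric]) auto
  finally show "(\<integral>\<^sup>+ x. ennreal (if x < k then r x powr s else 0) \<partial>count_space UNIV) = 1"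
    by (simp add: sum_1)
qed simp

lemma set_pmf_symbol: "set_pmf symbol_pmf \<subseteq> {..<k}"
  by (auto simp: set_pmf_iff pmf_symbol split: if_splits)

definition \<Omega> :: "(nat \<Rightarrow> nat) measure" where "\<Omega> = PiM UNIV (\<lambda>_. measure_pmf symbol_pmf)"

lemma space_\<Omega> [simp]: "space \<Omega> = UNIV" by (simp add: \<Omega>_def)

sublocale \<Omega>: product_prob_space "\<lambda>_. measure_pmf symbol_pmf" "UNIV :: nat set"
  by (rule product_prob_spaceI) (rule measure_pmf.prob_space_axioms)

lemma prob_space_\<Omega>: "prob_space \<Omega>" unfolding \<Omega>_def by (rule \<Omega>.prob_space_axioms)

lemma segment_measurable: "(\<lambda>\<omega>. map \<omega> [0..<n]) \<in> measurable \<Omega> (count_space UNIV)"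
  unfolding \<Omega>_def by (rule measurable_initial_segment)

definition cyl :: "nat list \<Rightarrow> (nat \<Rightarrow> nat) set" where "cyl u = {\<omega>. map \<omega> [0..<length u] = u}"

lemma cyl_sets: "cyl u \<in> sets \<Omega>"
  using measurable_sets[OF segment_measurable[of "length u"], of "{u}"] by (simp add: cyl_def vimage_def)

lemma measure_cyl:
  assumes "u \<in> W" shows "measure \<Omega> (cyl u) = rw u powr s"
proof -
  let ?n = "length u"
  have "map \<omega> [0..<?n] = u \<longleftrightarrow> (\<forall>i\<in>{..<?n}. \<omega> i = u ! i)" for \<omega>
    by (subst list_eq_iff_nth_eq) auto
  then have "cyl u = prod_emb UNIV (\<lambda>_. measure_pmf symbol_pmf) {..<?n} (\<Pi>\<^sub>E i\<in>{..<?n}. {u ! i})"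
    by (simp add: cyl_def prod_emb_def PiE_iff vimage_def)
  then have "measure \<Omega> (cyl u) = (\<Prod>i<?n. measure_pmf.prob symbol_pmf {u ! i})"
    unfolding \<Omega>_def by (simp add: \<Omega>.measure_PiM_emb)
  also have "\<dots> = (\<Prod>i<?n. r (u ! i) powr s)"
    using assms by (intro prod.cong) (auto simp: measure_pmf_single pmf_symbol lists_eq_set dest: nth_mem)
  also have "\<dots> = prod_list (map (\<lambda>i. r i powr s) u)"
    by (simp add: prod.list_conv_set_nth atLeast0LessThan)
  also have "\<dots> = rw u powr s"
    using assms
  proof (induction u)
    case (Cons i u)
    then show ?case using ratio[of i] rw_pos[of u] by (simp add: powr_mult)
  qed simp
  finally show ?thesis .
qed

lemma AE_symbols: "AE \<omega> in \<Omega>. \<forall>i. \<omega> i < k"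
  unfolding AE_all_countable
proof
  fix i :: nat
  have "AE x in measure_pmf symbol_pmf. x < k" using set_pmf_symbol by (auto simp: AE_measure_pmf_iff)
  then show "AE \<omega> in \<Omega>. \<omega> i < k"
    unfolding \<Omega>_def by (intro AE_PiM_component) (auto intro: measure_pmf.prob_space_axioms)
qed

definition base :: 'a where "base = (SOME x. x \<in> K)"

lemma base_K: "base \<in> K" unfolding base_def using K_ne by (simp add: some_in_eq)

text \<open>The address map. The limit exists when all symbols are below \<open>k\<close>, which
  holds almost surely.\<close>

definition code :: "(nat \<Rightarrow> nat) \<Rightarrow> 'a" where "code \<omega> = lim (\<lambda>n. Fw (map \<omega> [0..<n]) base)"

lemma code_measurable: "code \<in> borel_measurable \<Omega>"
  unfolding code_def
proof (rule borel_measurable_lim_metric)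
  fix n
  show "(\<lambda>\<omega>. Fw (map \<omega> [0..<n]) base) \<in> borel_measurable \<Omega>"
    by (rule measurable_compose[OF segment_measurable]) simp
qed

lemma segment_W: "(\<And>i. \<omega> i < k) \<Longrightarrow> map \<omega> [0..<n] \<in> W"
  by auto

lemma Fw_segment:
  assumes "\<And>i. \<omega> i < k" "n \<le> m"
  shows "Fw (map \<omega> [0..<m]) base \<in> Fw (map \<omega> [0..<n]) ` K"
proof -
  have "[0..<m] = [0..<n] @ [n..<m]" using assms(2) by (metis le_add_diff_inverse upt_add_eq_append zero_le)
  then have "Fw (map \<omega> [0..<m]) base = Fw (map \<omega> [0..<n]) (Fw (map \<omega> [n..<m]) base)" by (simp add: Fw_append)
  moreover have "Fw (map \<omega> [n..<m]) base \<in> K" using assms by (intro Fw_K base_K) auto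
  ultimately show ?thesis by blast
qed

lemma dist_Fw_image_le:
  assumes "u \<in> W" "x \<in> Fw u ` K" "y \<in> Fw u ` K"
  shows "dist x y \<le> rw u * diameter K"
proof -
  obtain x' y' where xy: "x' \<in> K" "x = Fw u x'" "y' \<in> K" "y = Fw u y'" using assms by blast
  then have "dist x' y' \<le> diameter K"
    using diameter_bounded_bound[OF compact_imp_bounded[OF compact_K]] by blast
  then show ?thesis unfolding xy dist_Fw[OF assms(1)]
    using rw_pos[OF assms(1)] by (intro mult_left_mono) auto
qed

lemma code_in:
  assumes "\<And>i. \<omega> i < k" shows "code \<omega> \<in> Fw (map \<omega> [0..<n]) ` K"
proof -
  let ?z = "\<lambda>n. Fw (map \<omega> [0..<n]) base"
  have W: "map \<omega> [0..<n] \<in> W" for n using assms by (rule segment_W)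
  have d0: "0 \<le> diameter K" using compact_imp_bounded[OF compact_K] by (rule diameter_ge_0)
  have "Cauchy ?z"
  proof (rule metric_CauchyI)
    fix e :: real assume e: "0 < e"
    have "(\<lambda>n. rmax ^ n * diameter K) \<longlonglongrightarrow> 0"
      using rmax by (intro tendsto_mult_left_zero LIMSEQ_realpow_zero) auto
    then have "\<forall>\<^sub>F n in sequentially. rmax ^ n * diameter K < e" using e by (rule order_tendstoD)
    from eventually_happens'[OF sequentially_bot this] obtain n where n: "rmax ^ n * diameter K < e" by blast
    have "dist (?z m) (?z m') < e" if "n \<le> m" "n \<le> m'" for m m'
    proof -
      have "dist (?z m) (?z m') \<le> rw (map \<omega> [0..<n]) * diameter K"
        using assms that by (intro dist_Fw_image_le[OF W] Fw_segment)
      also have "\<dots> \<le> rmax ^ n * diameter K"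
        using rw_le_rmax[OF W[of n]] d0 by (intro mult_right_mono) auto
      finally show ?thesis using n by simp
    qed
    then show "\<exists>M. \<forall>m\<ge>M. \<forall>n\<ge>M. dist (?z m) (?z n) < e" by blast
  qed
  then have "?z \<longlonglongrightarrow> code \<omega>" unfolding code_def by (simp add: Cauchy_convergent convergent_LIMSEQ_iff[symmetric])
  moreover have "closed (Fw (map \<omega> [0..<n]) ` K)"
  proof -
    have "continuous_on K (Fw (map \<omega> [0..<n]))"
      by (rule lipschitz_on_continuous_on[of "rw (map \<omega> [0..<n])"], rule lipschitz_onI)
        (use dist_Fw[OF W[of n]] rw_pos[OF W[of n]] in auto)
    then show ?thesis using compact_K by (intro compact_imp_closed compact_continuous_image)
  qed
  moreover have "\<forall>\<^sub>F m in sequentially. ?z m \<in> Fw (map \<omega> [0..<n]) ` K"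
    unfolding eventually_sequentially by (intro exI[of _ n] allI impI Fw_segment assms)
  ultimately show ?thesis by (rule_tac Lim_in_closed_set) auto
qed

definition natural_measure :: "'a measure" where "natural_measure = distr \<Omega> borel code"

lemma measure_natural_measure: "A \<in> sets borel \<Longrightarrow> measure natural_measure A = measure \<Omega> {\<omega>. code \<omega> \<in> A}"
  unfolding natural_measure_def by (subst measure_distr[OF code_measurable]) (auto simp: vimage_def)

lemma code_sets: "A \<in> sets borel \<Longrightarrow> {\<omega>. code \<omega> \<in> A} \<in> sets \<Omega>"
  using measurable_sets[OF code_measurable, of A] by (simp add: vimage_def)

interpretation P: prob_space \<Omega> by (rule prob_space_\<Omega>)

lemma natural_measure_K: "measure natural_measure K = 1"
proof -
  have "measure \<Omega> {\<omega>. code \<omega> \<in> K} = 1"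
  proof (subst P.prob_eq_1)
    show "AE \<omega> in \<Omega>. \<omega> \<in> {\<omega>. code \<omega> \<in> K}"
      using AE_symbols by eventually_elim (use code_in[where n = 0] in auto)
  qed (use compact_K in \<open>auto intro!: code_sets simp: borel_compact\<close>)
  then show ?thesis using compact_K by (subst measure_natural_measure) (auto simp: borel_compact)
qed

lemma ex_cut:
  assumes "\<And>i. \<omega> i < k" "0 < q" "q < 1"
  obtains n where "map \<omega> [0..<n] \<in> cut q"
proof -
  have W: "map \<omega> [0..<n] \<in> W" for n using assms(1) by (rule segment_W)
  obtain m where "rmax ^ m < q" using real_arch_pow_inv[OF assms(2) rmax(2)] by blast
  then have ex: "rw (map \<omega> [0..<m]) \<le> q" using rw_le_rmax[OF W[of m]] by simp
  define n where "n = (LEAST n. rw (map \<omega> [0..<n]) \<le> q)"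
  have n: "rw (map \<omega> [0..<n]) \<le> q" unfolding n_def using ex by (rule LeastI)
  then have "n \<noteq> 0" using assms(3) by (intro notI) simp
  then obtain l where l: "n = Suc l" using not0_implies_Suc by blast
  then have "\<not> rw (map \<omega> [0..<l]) \<le> q" unfolding n_def by (intro not_less_Least) simp
  then have "map \<omega> [0..<n] \<in> cut q" using n l W[of n] by (simp add: cut_def)
  then show ?thesis by (rule that)
qed

text \<open>An address of a point in the ball begins with a word of the cut at scale
  \<open>q\<close> whose cylinder meets the ball. There are at most \<open>N\<close> such words,
  each of mass at most \<open>q powr s\<close>.\<close>

lemma natural_measure_cball_le:
  obtains C where "\<And>x q. 0 < q \<Longrightarrow> measure natural_measure (cball x q) \<le> C * q powr s"
proof -
  obtain N where N: "\<And>x q. 0 < q \<Longrightarrow> finite {u \<in> cut q. Fw u ` K \<inter> cball x q \<noteq> {}} \<and>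
    card {u \<in> cut q. Fw u ` K \<inter> cball x q \<noteq> {}} \<le> N" by (rule cut_near_bounded) (rule that; blast)
  \<comment> \<open>The summand 1 covers the radii \<open>q \<ge> 1\<close>, where the total mass is
    the bound.\<close>
  have "measure natural_measure (cball x q) \<le> (real N + 1) * q powr s" if q: "0 < q" for x q
  proof (cases "q < 1")
    case True
    define A where "A = {u \<in> cut q. Fw u ` K \<inter> cball x q \<noteq> {}}"
    have A: "finite A" "card A \<le> N" using N[OF q, of x] by (auto simp: A_def)
    have "measure natural_measure (cball x q) = measure \<Omega> {\<omega>. code \<omega> \<in> cball x q}"
      by (rule measure_natural_measure) simp
    also have "\<dots> \<le> measure \<Omega> (\<Union>u\<in>A. cyl u)"
    proof (rule P.finite_measure_mono_AE)
      show "AE \<omega> in \<Omega>. \<omega> \<in> {\<omega>. code \<omega> \<in> cball x q} \<longrightarrow> \<omega> \<in> (\<Union>u\<in>A. cyl u)"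
        using AE_symbols
      proof eventually_elim
        case (elim \<omega>)
        then obtain n where n: "map \<omega> [0..<n] \<in> cut q" using ex_cut[OF _ q True] by blast
        show ?case
        proof
          assume "\<omega> \<in> {\<omega>. code \<omega> \<in> cball x q}"
          then have "map \<omega> [0..<n] \<in> A" using n code_in[of \<omega> n] elim by (auto simp: A_def)
          then show "\<omega> \<in> (\<Union>u\<in>A. cyl u)" by (intro UN_I[of "map \<omega> [0..<n]"]) (auto simp: cyl_def)
        qed
      qed
    qed (use A cyl_sets in auto)
    also have "\<dots> \<le> (\<Sum>u\<in>A. measure \<Omega> (cyl u))"
      using A cyl_sets by (intro P.finite_measure_subadditive_finite) auto
    also have "\<dots> \<le> (\<Sum>u\<in>A. q powr s)"
    proof (rule sum_mono)
      fix u assume "u \<in> A"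
      then have u: "u \<in> W" "rw u \<le> q" by (auto simp: A_def cut_def)
      then show "measure \<Omega> (cyl u) \<le> q powr s"
        unfolding measure_cyl[OF u(1)] using rw_pos[OF u(1)] s_pos by (intro powr_mono2) auto
    qed
    also have "\<dots> = card A * q powr s" by simp
    also have "\<dots> \<le> (real N + 1) * q powr s" using A(2) by (intro mult_right_mono) auto
    finally show ?thesis .
  next
    case False
    have "measure natural_measure (cball x q) \<le> 1" by (subst measure_natural_measure) auto
    also have "\<dots> \<le> 1 * q powr s" using False s_pos by (simp add: ge_one_powr_ge_zero)
    also have "\<dots> \<le> (real N + 1) * q powr s" by (intro mult_right_mono) auto
    finally show ?thesis .
  qed
  then show ?thesis by (rule that)
qed

text \<open>The ball contains a cylinder through \<open>x\<close> of size comparable to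
  \<open>q\<close>, and the mass of a cylinder is known exactly.\<close>

lemma natural_measure_cball_ge:
  obtains c where "0 < c" "\<And>x q. x \<in> K \<Longrightarrow> 0 < q \<Longrightarrow> q \<le> 1 \<Longrightarrow> c * q powr s \<le> measure natural_measure (cball x q)"
proof -
  \<comment> \<open>The maximum with 1 ensures \<open>q / D \<le> 1\<close>, the range of
    \<open>word_at_scale\<close>, and \<open>D > 0\<close>.\<close>
  define D where "D = max 1 (diameter K)"
  have D: "1 \<le> D" "diameter K \<le> D" by (auto simp: D_def)
  define c where "c = (rmin / D) powr s"
  have "0 < c" using rmin D by (simp add: c_def)
  moreover have "c * q powr s \<le> measure natural_measure (cball x q)" if x: "x \<in> K" and q: "0 < q" "q \<le> 1" for x q
  proof -
    have qD: "0 < q / D" "q / D \<le> 1" using q D by (auto simp: field_simps)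
    obtain n where "rmax ^ n < q / D" using real_arch_pow_inv[OF qD(1) rmax(2)] by blast
    then obtain u where u: "u \<in> W" "x \<in> Fw u ` K" "rmin * (q / D) \<le> rw u" "rw u \<le> q / D"
      using word_at_scale[OF qD _ x, of n] by (auto intro: less_imp_le)
    have sub: "Fw u ` K \<subseteq> cball x q"
    proof
      fix y assume "y \<in> Fw u ` K"
      then have "dist x y \<le> rw u * diameter K" using u by (intro dist_Fw_image_le) auto
      also have "\<dots> \<le> q / D * D" using u(4) D qD compact_imp_bounded[OF compact_K]
        by (intro mult_mono) (auto simp: diameter_ge_0)
      finally show "y \<in> cball x q" using D by simp
    qed
    have "c * q powr s = (rmin * (q / D)) powr s"
      unfolding c_def using q D rmin by (simp add: powr_mult[symmetric])
    also have "\<dots> \<le> rw u powr s" using u(3) mult_pos_pos[OF rmin(1) qD(1)] s_pos by (intro powr_mono2) simp_all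
    also have "\<dots> = measure \<Omega> (cyl u)" by (simp add: measure_cyl[OF u(1)])
    also have "\<dots> \<le> measure \<Omega> {\<omega>. code \<omega> \<in> cball x q}"
    proof (rule P.finite_measure_mono_AE)
      show "AE \<omega> in \<Omega>. \<omega> \<in> cyl u \<longrightarrow> \<omega> \<in> {\<omega>. code \<omega> \<in> cball x q}"
        using AE_symbols
      proof eventually_elim
        case (elim \<omega>)
        then have "code \<omega> \<in> Fw (map \<omega> [0..<length u]) ` K" by (intro code_in) simp
        then show ?case using sub by (auto simp: cyl_def)
      qed
    qed (rule code_sets, simp)
    also have "\<dots> = measure natural_measure (cball x q)" by (subst measure_natural_measure) auto
    finally show ?thesis .
  qed
  ultimately show ?thesis by (rule that)
qed

lemma ahlfors_regular_exists: "\<exists>C c. ahlfors_regular natural_measure K s C c"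
proof -
  obtain C where C: "\<And>x q. 0 < q \<Longrightarrow> measure natural_measure (cball x q) \<le> C * q powr s"
    by (rule natural_measure_cball_le) (rule that; blast)
  obtain c where c: "0 < c" "\<And>x q. x \<in> K \<Longrightarrow> 0 < q \<Longrightarrow> q \<le> 1 \<Longrightarrow> c * q powr s \<le> measure natural_measure (cball x q)"
    by (rule natural_measure_cball_ge) (rule that; blast)
  interpret N: prob_space natural_measure
    unfolding natural_measure_def by (rule P.prob_space_distr[OF code_measurable])
  have "ahlfors_regular natural_measure K s C c"
  proof unfold_locales
    show "compact K" "0 < s" "measure natural_measure K = 1" "0 < c" by (fact compact_K s_pos natural_measure_K c(1))+
    show "sets natural_measure = sets borel" by (simp add: natural_measure_def)
  qed (fact C, fact c(2))
  then show ?thesis by blast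
qed

end

theorem corollary4p25:
  fixes K :: "(real ^ 'm) set" and F :: "nat \<Rightarrow> real ^ 'm \<Rightarrow> real ^ 'm" and k :: nat and s :: real
  assumes "self_similar_set k F K"
    and "open_set_condition k F"
    and "s = real_of_ereal (hausdorff_dim K)"
  shows "hausdorff_dim K = ereal s \<and> packing_dim K = ereal s \<and>
    0 < hausdorff_measure s K \<and> hausdorff_measure s K < \<infinity> \<and>
    0 < packing_measure s K \<and> packing_measure s K < \<infinity> \<and>
    prevalent_in_C K (\<lambda>f :: real ^ 'm \<Rightarrow> real ^ 'd.
      \<exists>U. open U \<and>
        hausdorff_measure s {x \<in> K. f x \<in> U} = hausdorff_measure s K \<and>
        f ` K \<subseteq> closure (U \<inter> f ` K) \<and>
        (\<forall>y\<in>U. hausdorff_dim {x \<in> K. f x = y} = ereal s)) \<and>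
    prevalent_in_C K (\<lambda>f :: real ^ 'm \<Rightarrow> real ^ 'd.
      \<exists>V. open V \<and>
        packing_measure s {x \<in> K. f x \<in> V} = packing_measure s K \<and>
        f ` K \<subseteq> closure (V \<inter> f ` K) \<and>
        (\<forall>y\<in>V. packing_dim {x \<in> K. f x = y} = ereal s))"
proof -
  have "\<exists>r. \<forall>i<k. 0 < r i \<and> r i < 1 \<and> (\<forall>x y. dist (F i x) (F i y) = r i * dist x y)"
    using assms(1) unfolding self_similar_set_def contracting_similarity_def by metis
  then obtain r where r: "\<And>i. i < k \<Longrightarrow> 0 < r i \<and> r i < 1"
    "\<And>i x y. i < k \<Longrightarrow> dist (F i x) (F i y) = r i * dist x y" by blast
  have k: "2 \<le> k" and K: "compact K" "K \<noteq> {}" "K = (\<Union>i<k. F i ` K)"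
    using assms(1) unfolding self_similar_set_def by simp_all
  obtain V where V: "V \<noteq> {}" "bounded V" "open V" "(\<Union>i<k. F i ` V) \<subseteq> V" "disjoint_family_on (\<lambda>i. F i ` V) {..<k}"
    using assms(2) unfolding open_set_condition_def by blast
  \<comment> \<open>The exponent \<open>t\<close> solves the Moran equation; it is identified with
    \<open>s\<close> only after the natural measure has given the Hausdorff dimension of
    \<open>K\<close>.\<close>
  obtain t where t: "0 < t" "(\<Sum>i<k. r i powr t) = 1" using similarity_dimension_exists[of k r, OF k r(1)] by blast
  interpret osc_ifs k F r K V t by (rule osc_ifs.intro) (fact k r K V t)+
  obtain \<mu> C c where "ahlfors_regular \<mu> K t C c" using ahlfors_regular_exists by blast
  then interpret A: ahlfors_regular \<mu> K t C c .
  have st: "s = t" using assms(3) A.hausdorff_dim_K by simp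
  show ?thesis
    unfolding st by (intro conjI A.hausdorff_dim_K A.packing_dim_K A.hausdorff_measure_pos A.hausdorff_measure_finite
      A.packing_measure_pos A.packing_measure_finite A.prevalent_hausdorff_fibers A.prevalent_packing_fibers)
qed

end
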